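(* Let $Z=(Z_t)_{t\ge 0}$ be a real Lévy process with càdlàg sample paths, starting from $0$, without Brownian (Gaussian) part. Let $a:\mathbb{R}\to\mathbb{R}$ be a $\mathcal{C}^1$ function with bounded derivative, let $x\in\mathbb{R}$, and let $X=(X_t)_{t\ge 0}$ be the unique strong solution of $$X_t = x+\int_0^t a(X_s)\,ds + Z_t,\qquad t\ge 0.$$ Then for every $t>0$, $$Z_t\ll\lambda\ \Longrightarrow\ X_t\ll\lambda.$$
   Context: $\lambda$ denotes Lebesgue measure on $\mathbb{R}$. For a real random variable $X$, $X\ll\lambda$ means that the law of $X$ is absolutely continuous with respect to $\lambda$. *)

theory Defs
  imports "HOL-Probability.Probability"
begin

definition cadlag :: "(real \<Rightarrow> real) \<Rightarrow> bool" where
  "cadlag f \<longleftrightarrow>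
     (\<forall>t\<ge>0. (f \<longlongrightarrow> f t) (at_right t)) \<and>
     (\<forall>t>0. \<exists>l. (f \<longlongrightarrow> l) (at_left t))"

text \<open>Time is the half-line of nonnegative reals: values of a process at negative times are
  junk and never constrained. Stochastic continuity is not listed since it follows from
  right-continuity at 0 and stationarity of the increments.\<close>

locale levy_process = prob_space M for M :: "'w measure" +
  fixes Z :: "real \<Rightarrow> 'w \<Rightarrow> real"
  assumes random_variable: "\<And>t. 0 \<le> t \<Longrightarrow> random_variable borel (Z t)"
    and start_zero: "AE \<omega> in M. Z 0 \<omega> = 0"
    and cadlag_paths: "AE \<omega> in M. cadlag (\<lambda>t. Z t \<omega>)"
    and independent_increments:
      "\<And>(n::nat) (\<tau>::nat \<Rightarrow> real). 0 \<le> \<tau> 0 \<Longrightarrow> mono \<tau> \<Longrightarrow>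
         indep_vars (\<lambda>_. borel) (\<lambda>i \<omega>. Z (\<tau> (Suc i)) \<omega> - Z (\<tau> i) \<omega>) {..<n}"
    and stationary_increments:
      "\<And>s t. 0 \<le> s \<Longrightarrow> s \<le> t \<Longrightarrow>
         distr M borel (\<lambda>\<omega>. Z t \<omega> - Z s \<omega>) = distr M borel (Z (t - s))"

definition levy_measure :: "real measure \<Rightarrow> bool" where
  "levy_measure \<nu> \<longleftrightarrow>
     sets \<nu> = sets borel \<and> emeasure \<nu> {0} = 0 \<and>
     (\<integral>\<^sup>+ z. ennreal (min 1 (z\<^sup>2)) \<partial>\<nu>) < \<infinity>"

definition levy_exponent :: "real \<Rightarrow> real \<Rightarrow> real measure \<Rightarrow> real \<Rightarrow> complex" where
  "levy_exponent b q \<nu> u =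
     \<i> * of_real (u * b) - of_real (q * u\<^sup>2 / 2) +
     (CLINT z|\<nu>. iexp (u * z) - 1 - \<i> * of_real (u * z * indicator {-1..1} z))"

text \<open>The Levy--Khintchine triplet: drift \<open>b\<close>, Gaussian variance \<open>q\<close>, jump measure \<open>\<nu>\<close>.\<close>

definition has_levy_triplet ::
  "'w measure \<Rightarrow> (real \<Rightarrow> 'w \<Rightarrow> real) \<Rightarrow> real \<Rightarrow> real \<Rightarrow> real measure \<Rightarrow> bool" where
  "has_levy_triplet M Z b q \<nu> \<longleftrightarrow>
     0 \<le> q \<and> levy_measure \<nu> \<and>
     (\<forall>t\<ge>0. \<forall>u. char (distr M borel (Z t)) u = exp (of_real t * levy_exponent b q \<nu> u))"

text \<open>By the Levy--Khintchine theorem every Levy process has exactly one triplet, so this says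
  that the Gaussian variance in it vanishes.\<close>

definition no_gaussian_part :: "'w measure \<Rightarrow> (real \<Rightarrow> 'w \<Rightarrow> real) \<Rightarrow> bool" where
  "no_gaussian_part M Z \<longleftrightarrow> (\<exists>b \<nu>. has_levy_triplet M Z b 0 \<nu>)"

definition augmented_filtration ::
  "'w measure \<Rightarrow> (real \<Rightarrow> 'w \<Rightarrow> real) \<Rightarrow> real \<Rightarrow> 'w measure" where
  "augmented_filtration M Z t =
     sigma (space M)
       ({Z s -` A \<inter> space M | s A. 0 \<le> s \<and> s \<le> t \<and> A \<in> sets borel} \<union> null_sets M)"

text \<open>Strong solution, driven by \<open>Z\<close>, of \<open>dX = a(X) dt + dZ\<close>, \<open>X\<^sub>0 = x\<close>: the equation holds
  almost surely at all times simultaneously.\<close>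

definition strong_solution ::
  "'w measure \<Rightarrow> (real \<Rightarrow> 'w \<Rightarrow> real) \<Rightarrow> (real \<Rightarrow> real) \<Rightarrow> real \<Rightarrow> (real \<Rightarrow> 'w \<Rightarrow> real) \<Rightarrow> bool"
where
  "strong_solution M Z a x X \<longleftrightarrow>
     (\<forall>t\<ge>0. X t \<in> borel_measurable (augmented_filtration M Z t)) \<and>
     (AE \<omega> in M. cadlag (\<lambda>t. X t \<omega>)) \<and>
     (AE \<omega> in M. \<forall>t\<ge>0. X t \<omega> = x + (LBINT s:{0..t}. a (X s \<omega>)) + Z t \<omega>)"

end

theory Submission imports Defs begin

text \<open>
  Fix a Lebesgue null set \<open>A\<close>; the paths are split according to whether the drift \<open>a(X)\<close>
  jumps somewhere before time \<open>t\<close>.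

  If \<open>a(X)\<close> has a jump at some time \<open>T\<close>, that is \<open>a(X\<^sub>T\<^sub>-) \<noteq> a(X\<^sub>T)\<close>, the randomness of
  \<open>T\<close> alone smooths the law of \<open>X\<^sub>t\<close>: delaying a jump by a time \<open>h\<close>, with the rest of the noise
  unchanged, moves the solution by about \<open>h (a(X\<^sub>T\<^sub>-) - a(X\<^sub>T))\<close>, and the flow shrinks this displacement
  by a bounded factor only, because \<open>a\<close> is Lipschitz. To make this rigorous, the
  equation is discretised by an explicit scheme driven by the increments of \<open>Z\<close> over a grid.
  These are exchangeable, so among all configurations that differ only by the position of one
  exceptionally large increment inside a short time window, each is equally likely, while the final
  values of the scheme are ordered and equally spaced up to constants. Hence a window with \<open>r\<close>
  positions gives an interval of length \<open>l\<close> at most a mass of order \<open>l + 1/r\<close>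
  (\<open>one_big_jump_prob_le\<close>). Letting \<open>r\<close> grow, on the event that the path has one large jump in the
  window, \<open>X\<^sub>t\<close> has a bounded density (\<open>one_big_jump_avoids_null_set\<close>). A window is described by
  rational parameters, and every path with a jump of \<open>a(X)\<close> belongs to one of these countably many
  events (\<open>jump_in_window\<close>).

  If \<open>a(X)\<close> has no jump in \<open>(0,t)\<close>, it is continuous there. Wherever \<open>a'(X\<^sub>s) \<noteq> 0\<close>, the
  function \<open>a\<close> is injective near \<open>X\<^sub>s\<close>, so \<open>X\<close>, and with it \<open>Z\<close>, would be continuous on a
  whole interval. This almost surely does not happen (\<open>no_continuity_interval\<close>): without Gaussian
  part, the increment of \<open>Z\<close> over an interval of continuity is a deterministic number, so that
  continuity with positive probability would put an atom into the law of \<open>Z\<^sub>t\<close>. So \<open>X\<close> stays in the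
  critical set of \<open>a\<close>, the continuous function \<open>a(X)\<close> takes values in a null set by Sard's
  theorem, and it is constant (\<open>drift_constant\<close>). Therefore \<open>X\<^sub>t = x + t a(x) + Z\<^sub>t\<close> on such paths,
  and \<open>Z\<^sub>t \<lless> \<lambda>\<close> gives the claim.
\<close>

section \<open>Moving one increment of the splitting scheme\<close>

text \<open>
  One step adds the increment of the noise and then follows the drift for a time \<open>h\<close> from the new
  position. Evaluating the drift after the noise makes right-continuity of the paths sufficient for
  convergence, and gives an exact formula for the effect of exchanging two consecutive increments.
\<close>

fun splitting_scheme :: "(real \<Rightarrow> real) \<Rightarrow> real \<Rightarrow> real \<Rightarrow> (nat \<Rightarrow> real) \<Rightarrow> nat \<Rightarrow> real" where
  "splitting_scheme a h x w 0 = x"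
| "splitting_scheme a h x w (Suc k) =
     splitting_scheme a h x w k + w k + h * a (splitting_scheme a h x w k + w k)"

lemma splitting_scheme_cong:
  "(\<And>l. l < k \<Longrightarrow> w l = w' l) \<Longrightarrow> splitting_scheme a h x w k = splitting_scheme a h x w' k"
  by (induction k) auto

lemma measurable_splitting_scheme:
  assumes [measurable]: "a \<in> borel_measurable borel"
  shows "k \<le> n \<Longrightarrow> (\<lambda>w. splitting_scheme a h x w k) \<in> borel_measurable (PiM {..<n} (\<lambda>_. borel))"
proof (induction k)
  case (Suc k)
  then have [measurable]: "(\<lambda>w. splitting_scheme a h x w k) \<in> borel_measurable (PiM {..<n} (\<lambda>_. borel))"
    by simp
  have [measurable]: "(\<lambda>w. w k) \<in> borel_measurable (PiM {..<n} (\<lambda>_. borel))"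
    using Suc.prems by (intro measurable_component_singleton) auto
  show ?case by simp
qed simp

text \<open>
  \<open>w \<circ> move_to p i\<close> is the sequence \<open>w\<close> with its entry number \<open>p\<close> moved to position
  \<open>i \<ge> p\<close>, the entries in between moving one place to the left; \<open>w \<circ> move_back p i\<close> undoes this.
\<close>

definition move_to :: "nat \<Rightarrow> nat \<Rightarrow> nat \<Rightarrow> nat" where
  "move_to p i k = (if p \<le> k \<and> k < i then Suc k else if k = i then p else k)"

definition move_back :: "nat \<Rightarrow> nat \<Rightarrow> nat \<Rightarrow> nat" where
  "move_back p i k = (if k = p then i else if p < k \<and> k \<le> i then k - 1 else k)"

lemma move_to_move_back: "p \<le> i \<Longrightarrow> move_to p i (move_back p i k) = k"
  by (auto simp: move_to_def move_back_def)

lemma move_back_move_to: "p \<le> i \<Longrightarrow> move_back p i (move_to p i k) = k"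
  by (auto simp: move_to_def move_back_def)

text \<open>
  The map \<open>u \<mapsto> u + h a(u)\<close> is increasing with slopes at least \<open>1 - h L\<close>. The sign \<open>s\<close> says
  which of two positions is the larger one, so that both orders are treated at once.
\<close>

lemma scheme_step_expands:
  fixes L h s :: real
  assumes lip: "\<And>u v. \<bar>a u - a v\<bar> \<le> L * \<bar>u - v\<bar>" and "0 \<le> h" "h * L \<le> 1"
    and s: "s = 1 \<or> s = -1" and d: "0 \<le> s * (u' - u)"
  shows "(1 - h * L) * (s * (u' - u)) \<le> s * ((u' + h * a u') - (u + h * a u))"
proof -
  have "\<bar>s * (a u' - a u)\<bar> \<le> L * (s * (u' - u))"
    using lip[of u' u] s d by (auto simp: abs_mult)
  then have "- (L * (s * (u' - u))) \<le> s * (a u' - a u)" by linarith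
  then have "h * (- (L * (s * (u' - u)))) \<le> h * (s * (a u' - a u))"
    using assms(2) by (rule mult_left_mono)
  then show ?thesis by (simp add: algebra_simps)
qed

lemma scheme_expands:
  fixes L h s c :: real
  assumes lip: "\<And>u v. \<bar>a u - a v\<bar> \<le> L * \<bar>u - v\<bar>" and h: "0 \<le> h" "h * L \<le> 1"
    and s: "s = 1 \<or> s = -1" and c: "0 \<le> c"
    and start: "c \<le> s * (splitting_scheme a h x w' q - splitting_scheme a h x w q)"
    and eq: "\<And>l. q \<le> l \<Longrightarrow> w' l = w l"
  shows "(1 - h * L) ^ k * c
    \<le> s * (splitting_scheme a h x w' (q + k) - splitting_scheme a h x w (q + k))"
proof (induction k)
  case (Suc k)
  let ?u = "splitting_scheme a h x w (q + k) + w (q + k)"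
  let ?u' = "splitting_scheme a h x w' (q + k) + w (q + k)"
  have le: "(1 - h * L) ^ k * c \<le> s * (?u' - ?u)" using Suc by simp
  then have "0 \<le> s * (?u' - ?u)" using h c by (smt (verit) mult_nonneg_nonneg zero_le_power)
  from scheme_step_expands[OF lip h s this]
  have "(1 - h * L) * (s * (?u' - ?u)) \<le> s * ((?u' + h * a ?u') - (?u + h * a ?u))" .
  moreover have "(1 - h * L) * ((1 - h * L) ^ k * c) \<le> (1 - h * L) * (s * (?u' - ?u))"
    using le h by (intro mult_left_mono) auto
  ultimately show ?case using eq[of "q + k"] by (simp add: mult.assoc)
qed (use start in simp)

text \<open>
  The first increment of the window \<open>{p..<p + m}\<close> is close to \<open>J\<close>, the position before it is close to
  \<open>\<rho>\<close>, and the remaining increments of the window have small partial sums. Moving the first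
  increment within the window keeps the scheme close to \<open>\<rho>\<close> before the large increment and close to
  \<open>\<rho> + J\<close> after it.
\<close>

definition big_jump_first ::
  "(real \<Rightarrow> real) \<Rightarrow> real \<Rightarrow> real \<Rightarrow> nat \<Rightarrow> nat \<Rightarrow> real \<Rightarrow> real \<Rightarrow> real \<Rightarrow> (nat \<Rightarrow> real) \<Rightarrow> bool" where
  "big_jump_first a h x p m \<rho> J \<epsilon> w \<longleftrightarrow>
     \<bar>splitting_scheme a h x w p - \<rho>\<bar> \<le> \<epsilon> \<and> \<bar>w p - J\<bar> \<le> \<epsilon> \<and>
     (\<forall>k\<in>{p<..<p + m}. \<bar>\<Sum>l\<in>{p<..k}. w l\<bar> \<le> \<epsilon>)"

definition drift_separated :: "(real \<Rightarrow> real) \<Rightarrow> real \<Rightarrow> real \<Rightarrow> real \<Rightarrow> real \<Rightarrow> real \<Rightarrow> bool" where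
  "drift_separated a \<rho> J \<epsilon> s c \<longleftrightarrow>
     (\<forall>u v. \<bar>u - \<rho>\<bar> \<le> 4 * \<epsilon> \<longrightarrow> \<bar>v - (\<rho> + J)\<bar> \<le> 4 * \<epsilon> \<longrightarrow> c \<le> s * (a u - a v))"

text \<open>
  Exchanging the large increment \<open>J\<close> with the next, small one, \<open>y\<close>, changes two steps of the scheme
  started at \<open>v\<close> by exactly \<open>h (a(v + y) - a(v + J))\<close>, up to the final drift map of these steps. This
  has a fixed sign and is at least \<open>h c\<close> in size, and the later steps cannot shrink it by more than a
  factor \<open>1 - h L\<close> each.
\<close>

lemma moved_jump_separation:
  fixes L h s c K \<epsilon> :: real
  assumes lip: "\<And>u v. \<bar>a u - a v\<bar> \<le> L * \<bar>u - v\<bar>" and h: "0 \<le> h" "h * L \<le> 1" "0 \<le> L"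
    and s: "s = 1 \<or> s = -1" and c: "0 \<le> c"
    and start: "big_jump_first a h x p m \<rho> J \<epsilon> w"
    and sep: "drift_separated a \<rho> J \<epsilon> s c"
    and bound: "\<And>u. \<bar>u - \<rho>\<bar> \<le> 3 * \<epsilon> \<Longrightarrow> \<bar>a u\<bar> \<le> K"
    and short: "real m * h * K \<le> \<epsilon>"
    and i: "p \<le> i" "Suc i < p + m" and n: "p + m \<le> n"
  shows "(1 - h * L) ^ n * (h * c) \<le>
    s * (splitting_scheme a h x (w \<circ> move_to p (Suc i)) n - splitting_scheme a h x (w \<circ> move_to p i) n)"
proof -
  \<comment> \<open>\<open>v k\<close> is the position after \<open>k\<close> steps of the window without the large increment.\<close>
  define v where "v = (\<lambda>k. splitting_scheme a h x (w \<circ> move_to p (p + k)) (p + k))"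
  have near0: "\<bar>splitting_scheme a h x w p - \<rho>\<bar> \<le> \<epsilon>" and J: "\<bar>w p - J\<bar> \<le> \<epsilon>"
    and sums: "\<And>k. 0 < k \<Longrightarrow> k < m \<Longrightarrow> \<bar>\<Sum>l\<in>{p<..p + k}. w l\<bar> \<le> \<epsilon>"
    using start unfolding big_jump_first_def by auto
  have \<epsilon>: "0 \<le> \<epsilon>" using J by linarith
  have K: "0 \<le> K" using bound[of \<rho>] \<epsilon> by fastforce
  have v0: "v 0 = splitting_scheme a h x w p"
    using splitting_scheme_cong[of p "w \<circ> move_to p p" w] by (simp add: v_def move_to_def)
  have v_Suc: "v (Suc k) = v k + w (p + Suc k) + h * a (v k + w (p + Suc k))" for k
  proof -
    have "splitting_scheme a h x (w \<circ> move_to p (p + Suc k)) (p + k) = v k"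
      unfolding v_def by (rule splitting_scheme_cong) (auto simp: move_to_def)
    then show ?thesis by (simp add: v_def move_to_def)
  qed
  have v_sum: "\<bar>v k - (v 0 + (\<Sum>l\<in>{p<..p + k}. w l))\<bar> \<le> real k * h * K" if "k < m" for k
    using that
  proof (induction k)
    case (Suc k)
    let ?S = "\<lambda>k. \<Sum>l\<in>{p<..p + k}. w l"
    have S: "?S (Suc k) = ?S k + w (p + Suc k)"
    proof -
      have "{p<..p + Suc k} = insert (p + Suc k) {p<..p + k}" by auto
      then show ?thesis by simp
    qed
    have IH: "\<bar>v k - (v 0 + ?S k)\<bar> \<le> real k * h * K" using Suc by simp
    also have "\<dots> \<le> real m * h * K"
      using Suc.prems h K by (intro mult_right_mono) auto
    finally have "\<bar>v k + w (p + Suc k) - \<rho>\<bar> \<le> 3 * \<epsilon>"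
      using short near0 sums[of "Suc k"] Suc.prems unfolding v0 S by linarith
    then have "\<bar>h * a (v k + w (p + Suc k))\<bar> \<le> h * K"
      using bound h by (auto simp: abs_mult intro: mult_left_mono)
    then show ?case using IH unfolding v_Suc S by (simp add: algebra_simps)
  qed simp
  define k where "k = i - p"
  have ik: "i = p + k" "Suc k < m" using i by (auto simp: k_def)
  have km: "real k * h * K \<le> \<epsilon>"
    using ik h K short by (smt (verit) mult_right_mono of_nat_mono less_imp_le Suc_lessD)
  have close: "\<bar>v k - \<rho>\<bar> \<le> 3 * \<epsilon>"
  proof (cases "k = 0")
    case False
    then show ?thesis using v_sum[of k] ik km near0 sums[of k] unfolding v0 by linarith
  qed (use v0 near0 \<epsilon> in simp)
  have close': "\<bar>v k + w (Suc i) - \<rho>\<bar> \<le> 3 * \<epsilon>"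
  proof -
    have "{p<..p + Suc k} = insert (p + Suc k) {p<..p + k}" by auto
    then have "(\<Sum>l\<in>{p<..p + Suc k}. w l) = (\<Sum>l\<in>{p<..p + k}. w l) + w (Suc i)"
      by (simp add: ik)
    then show ?thesis using v_sum[of k] ik km near0 sums[of "Suc k"] unfolding v0 by linarith
  qed
  let ?w = "w \<circ> move_to p i" and ?w' = "w \<circ> move_to p (Suc i)"
  have st: "splitting_scheme a h x ?w i = v k" by (simp add: v_def ik)
  have st': "splitting_scheme a h x ?w' i = v k"
    unfolding v_def ik by (rule splitting_scheme_cong) (auto simp: move_to_def)
  have vals: "?w i = w p" "?w (Suc i) = w (Suc i)" "?w' i = w (Suc i)" "?w' (Suc i) = w p"
    using i by (auto simp: move_to_def)
  let ?z = "v k + w p + h * a (v k + w p) + w (Suc i)"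
  let ?z' = "v k + w (Suc i) + h * a (v k + w (Suc i)) + w p"
  have e: "splitting_scheme a h x ?w (Suc (Suc i)) = ?z + h * a ?z"
    "splitting_scheme a h x ?w' (Suc (Suc i)) = ?z' + h * a ?z'"
    using vals by (simp_all add: st st')
  have "c \<le> s * (a (v k + w (Suc i)) - a (v k + w p))"
    using sep close close' J \<epsilon> unfolding drift_separated_def by (smt (verit))
  then have hc: "h * c \<le> s * (?z' - ?z)"
    using mult_left_mono[OF _ h(1)] by (fastforce simp: algebra_simps)
  then have "0 \<le> s * (?z' - ?z)" using h c by (smt (verit) mult_nonneg_nonneg)
  from scheme_step_expands[OF lip h(1,2) s this]
  have "(1 - h * L) * (s * (?z' - ?z)) \<le> s * ((?z' + h * a ?z') - (?z + h * a ?z))" .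
  moreover have "(1 - h * L) * (h * c) \<le> (1 - h * L) * (s * (?z' - ?z))"
    using hc h by (intro mult_left_mono) auto
  ultimately have start2: "(1 - h * L) * (h * c) \<le> s * (splitting_scheme a h x ?w' (Suc (Suc i))
      - splitting_scheme a h x ?w (Suc (Suc i)))"
    unfolding e by linarith
  have nn: "n = Suc (Suc i) + (n - Suc (Suc i))" using i n by simp
  have "(1 - h * L) ^ (n - Suc (Suc i)) * ((1 - h * L) * (h * c))
    \<le> s * (splitting_scheme a h x ?w' (Suc (Suc i) + (n - Suc (Suc i)))
      - splitting_scheme a h x ?w (Suc (Suc i) + (n - Suc (Suc i))))"
    using h c start2
    by (intro scheme_expands[OF lip h(1,2) s]) (auto simp: move_to_def)
  moreover have "(1 - h * L) ^ n \<le> (1 - h * L) ^ Suc (n - Suc (Suc i))"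
    using h i n by (intro power_decreasing) auto
  then have "(1 - h * L) ^ n * (h * c) \<le> (1 - h * L) ^ (n - Suc (Suc i)) * ((1 - h * L) * (h * c))"
    using h c by (metis mult.assoc mult_nonneg_nonneg mult_right_mono power_Suc2)
  ultimately show ?thesis unfolding nn[symmetric] by linarith
qed

lemma card_separated_le:
  fixes F :: "nat \<Rightarrow> real"
  assumes d: "0 < d" and s: "s = 1 \<or> s = -1" and uv: "u \<le> v"
    and step: "\<And>i. p \<le> i \<Longrightarrow> Suc i < p + m \<Longrightarrow> d \<le> s * (F (Suc i) - F i)"
  shows "real (card {i\<in>{p..<p + m}. F i \<in> {u..v}}) \<le> (v - u) / d + 1"
proof (cases "{i\<in>{p..<p + m}. F i \<in> {u..v}} = {}")
  case True
  then show ?thesis using d uv by (simp only: card.empty) auto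
next
  case False
  let ?S = "{i\<in>{p..<p + m}. F i \<in> {u..v}}"
  have far: "real k * d \<le> s * (F (i + k) - F i)" if "p \<le> i" "i + k < p + m" for i k
    using that
  proof (induction k)
    case (Suc k)
    then show ?case using step[of "i + k"] by (simp add: algebra_simps)
  qed simp
  have fin: "finite ?S" by simp
  define i0 i1 where "i0 = Min ?S" and "i1 = Max ?S"
  have mem: "i0 \<in> ?S" "i1 \<in> ?S" unfolding i0_def i1_def using Min_in Max_in fin False by blast+
  have le: "i0 \<le> i1" using mem(2) fin by (simp add: i0_def)
  have "real (i1 - i0) * d \<le> s * (F (i0 + (i1 - i0)) - F i0)"
    using mem le by (intro far) auto
  also have "\<dots> \<le> v - u" using mem le s by auto
  finally have *: "real (i1 - i0) \<le> (v - u) / d" using d by (simp add: field_simps)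
  have "?S \<subseteq> {i0..i1}" using fin by (auto simp: i0_def i1_def)
  then have "card ?S \<le> Suc (i1 - i0)"
    by (metis Suc_diff_le card_atLeastAtMost card_mono finite_atLeastAtMost le)
  then have "real (card ?S) \<le> real (i1 - i0) + 1" by linarith
  then show ?thesis using * by linarith
qed

section \<open>The probability of hitting an interval\<close>

text \<open>
  The disjoint events \<open>R i w \<in> B\<close> all have the probability of \<open>B\<close>, so \<open>B\<close> has probability at most
  \<open>1 / card I\<close>. Pulled back to \<open>B\<close>, the event \<open>S\<close> counts how many of the copies \<open>T i w\<close> of a point
  \<open>w\<close> hit \<open>S\<close>, which is at most \<open>N\<close>.
\<close>

lemma (in prob_space) moved_copies_prob_le:
  fixes N :: real
  assumes I: "finite I" "I \<noteq> {}"
    and T: "\<And>i. i \<in> I \<Longrightarrow> T i \<in> measurable M M" "\<And>i. i \<in> I \<Longrightarrow> distr M M (T i) = M"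
    and R: "\<And>i. i \<in> I \<Longrightarrow> R i \<in> measurable M M"
      "\<And>i w. i \<in> I \<Longrightarrow> w \<in> space M \<Longrightarrow> R i (T i w) = w"
    and B: "B \<in> sets M" and S: "S \<in> sets M"
    and disj: "\<And>i j w. i \<in> I \<Longrightarrow> j \<in> I \<Longrightarrow> i \<noteq> j \<Longrightarrow> w \<in> space M \<Longrightarrow> R i w \<in> B \<Longrightarrow> R j w \<notin> B"
    and count: "\<And>w. w \<in> B \<Longrightarrow> real (card {i\<in>I. T i w \<in> S}) \<le> N"
    and N: "0 \<le> N"
  shows "prob ({w\<in>space M. \<exists>i\<in>I. R i w \<in> B} \<inter> S) \<le> N / card I"
proof -
  define C where "C i = R i -` B \<inter> space M" for i
  define T' where "T' i = T i -` S \<inter> space M" for i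
  have C[measurable]: "C i \<in> sets M" if "i \<in> I" for i
    using R(1)[OF that] B unfolding C_def by measurable
  have T'[measurable]: "T' i \<in> sets M" if "i \<in> I" for i
    using T(1)[OF that] S unfolding T'_def by measurable
  have disjC: "disjoint_family_on C I"
    using disj by (auto simp: disjoint_family_on_def C_def)
  have pull: "prob A = prob (T i -` A \<inter> space M)" if "i \<in> I" "A \<in> sets M" for i A
    using T(1)[OF that(1)] that(2) measure_distr[of "T i" M M A] by (simp add: T(2)[OF that(1)])
  have TC: "T i -` C i \<inter> space M = B" if "i \<in> I" for i
    using R(2)[OF that] T(1)[OF that] sets.sets_into_space[OF B]
    by (auto simp: C_def measurable_space)
  have "real (card I) * prob B = (\<Sum>i\<in>I. prob (C i))"
    using pull[OF _ C] TC by simp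
  also have "\<dots> = prob (\<Union>i\<in>I. C i)"
    using I C disjC by (intro finite_measure_finite_Union[symmetric]) auto
  also have "\<dots> \<le> 1" by simp
  finally have B1: "real (card I) * prob B \<le> 1" .
  have "{w\<in>space M. \<exists>i\<in>I. R i w \<in> B} \<inter> S = (\<Union>i\<in>I. C i \<inter> S)"
    by (auto simp: C_def)
  also have "prob \<dots> \<le> (\<Sum>i\<in>I. prob (C i \<inter> S))"
    using I C S by (intro finite_measure_subadditive_finite) auto
  also have "\<dots> = (\<Sum>i\<in>I. prob (B \<inter> T' i))"
  proof (intro sum.cong refl)
    fix i assume i: "i \<in> I"
    have "T i -` (C i \<inter> S) \<inter> space M = B \<inter> T' i"
      using TC[OF i] by (auto simp: T'_def)
    then show "prob (C i \<inter> S) = prob (B \<inter> T' i)"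
      using pull[OF i, of "C i \<inter> S"] C[OF i] S by simp
  qed
  also have "\<dots> = (\<Sum>i\<in>I. \<integral>w. indicator (B \<inter> T' i) w \<partial>M)"
    using B T' by (intro sum.cong refl) (simp add: Int_absorb2 sets.sets_into_space)
  also have "\<dots> = (\<integral>w. (\<Sum>i\<in>I. indicator (B \<inter> T' i) w) \<partial>M)"
    using B T' by (intro Bochner_Integration.integral_sum[symmetric]) (auto simp: less_top[symmetric])
  also have "\<dots> \<le> (\<integral>w. N * indicator B w \<partial>M)"
  proof (rule integral_mono)
    show "integrable M (\<lambda>w. \<Sum>i\<in>I. indicator (B \<inter> T' i) w :: real)"
      using B T' by (intro Bochner_Integration.integrable_sum) (auto simp: less_top[symmetric])
    show "integrable M (\<lambda>w. N * indicator B w)"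
      using B by (auto simp: less_top[symmetric])
    fix w assume w: "w \<in> space M"
    show "(\<Sum>i\<in>I. indicator (B \<inter> T' i) w) \<le> N * indicator B w"
    proof (cases "w \<in> B")
      case True
      have "(\<Sum>i\<in>I. indicator (B \<inter> T' i) w) = (\<Sum>i\<in>I. if T i w \<in> S then 1 else 0 :: real)"
        using True w by (intro sum.cong) (auto simp: T'_def)
      also have "\<dots> = card {i\<in>I. T i w \<in> S}"
        using I by (simp add: sum.If_cases Int_def)
      finally show ?thesis using count[OF True] True by simp
    qed simp
  qed
  also have "\<dots> = N * prob B"
    using B by (simp add: Int_absorb2 sets.sets_into_space)
  also have "\<dots> \<le> N / card I"
    using B1 I N mult_left_mono[OF B1 N] by (simp add: field_simps card_gt_0_iff)
  finally show ?thesis .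
qed

lemma move_to_lt: "p \<le> i \<Longrightarrow> i < n \<Longrightarrow> k < n \<Longrightarrow> move_to p i k < n"
  by (auto simp: move_to_def)

lemma move_back_lt: "p \<le> i \<Longrightarrow> i < n \<Longrightarrow> k < n \<Longrightarrow> move_back p i k < n"
  by (auto simp: move_back_def)

lemma PiM_permute:
  fixes \<mu> :: "'a measure" and f :: "nat \<Rightarrow> nat"
  assumes "prob_space \<mu>" and f: "inj_on f {..<n}" "\<And>k. k < n \<Longrightarrow> f k < n" "\<And>k. n \<le> k \<Longrightarrow> f k = k"
  defines "P \<equiv> PiM {..<n} (\<lambda>_. \<mu>)"
  shows "(\<lambda>w. w \<circ> f) \<in> measurable P P" and "distr P P (\<lambda>w. w \<circ> f) = P"
proof -
  have eq: "w \<circ> f = (\<lambda>k\<in>{..<n}. w (f k))" if "w \<in> space P" for w :: "nat \<Rightarrow> 'a"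
  proof
    fix k show "(w \<circ> f) k = (\<lambda>k\<in>{..<n}. w (f k)) k"
      using that f(3)[of k] unfolding P_def space_PiM PiE_def extensional_def by auto
  qed
  have "(\<lambda>w. \<lambda>k\<in>{..<n}. w (f k)) \<in> measurable P P"
    unfolding P_def using f(2) by (intro measurable_restrict measurable_component_singleton) auto
  then show "(\<lambda>w. w \<circ> f) \<in> measurable P P" using eq by (simp cong: measurable_cong)
  have "distr P P (\<lambda>w. w \<circ> f) = distr P P (\<lambda>w. \<lambda>k\<in>{..<n}. w (f k))"
    using eq by (intro distr_cong) auto
  also have "\<dots> = P"
    unfolding P_def using assms(1) f by (intro distr_PiM_reindex) auto
  finally show "distr P P (\<lambda>w. w \<circ> f) = P" .
qed

lemma sets_big_jump_first:
  fixes \<mu> :: "real measure"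
  assumes \<mu>: "sets \<mu> = sets borel" and a: "a \<in> borel_measurable borel" and n: "p < n" "p + m \<le> n"
  defines "P \<equiv> PiM {..<n} (\<lambda>_. \<mu>)"
  shows "{w\<in>space P. big_jump_first a h x p m \<rho> J \<epsilon> w} \<in> sets P"
proof -
  have sP: "sets P = sets (PiM {..<n} (\<lambda>_. borel))"
    unfolding P_def by (intro sets_PiM_cong refl \<mu>)
  have comp: "(\<lambda>w. w k) \<in> borel_measurable P" if "k < n" for k
    unfolding measurable_cong_sets[OF sP refl]
    using that by (intro measurable_component_singleton) auto
  have sums: "(\<lambda>w. \<Sum>l\<in>{p<..k}. w l) \<in> borel_measurable P" if "k < p + m" for k
    using that n by (intro borel_measurable_sum comp) auto
  have "{w\<in>space P. big_jump_first a h x p m \<rho> J \<epsilon> w} =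
    {w\<in>space P. \<bar>splitting_scheme a h x w p - \<rho>\<bar> \<le> \<epsilon> \<and> \<bar>w p - J\<bar> \<le> \<epsilon>} \<inter>
    {w\<in>space P. \<forall>k\<in>{p<..<p + m}. \<bar>\<Sum>l\<in>{p<..k}. w l\<bar> \<le> \<epsilon>}"
    by (auto simp: big_jump_first_def)
  moreover have "{w\<in>space P. \<bar>splitting_scheme a h x w p - \<rho>\<bar> \<le> \<epsilon> \<and> \<bar>w p - J\<bar> \<le> \<epsilon>} \<in> sets P"
  proof -
    have [measurable]: "(\<lambda>w. splitting_scheme a h x w p) \<in> borel_measurable P"
      unfolding measurable_cong_sets[OF sP refl] using n by (intro measurable_splitting_scheme a) simp
    have [measurable]: "(\<lambda>w. w p) \<in> borel_measurable P"
      using n by (intro comp) simp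
    show ?thesis by measurable
  qed
  moreover have "{w\<in>space P. \<forall>k\<in>{p<..<p + m}. \<bar>\<Sum>l\<in>{p<..k}. w l\<bar> \<le> \<epsilon>} \<in> sets P"
    by (intro sets.sets_Collect_finite_All) (auto intro!: borel_measurable_le sums borel_measurable_abs)
  ultimately show ?thesis by simp
qed

lemma measurable_move:
  fixes \<mu> :: "'a measure"
  assumes \<mu>: "prob_space \<mu>" and i: "p \<le> i" "i < n"
  defines "P \<equiv> PiM {..<n} (\<lambda>_. \<mu>)"
  shows "(\<lambda>w. w \<circ> move_to p i) \<in> measurable P P"
    and "distr P P (\<lambda>w. w \<circ> move_to p i) = P"
    and "(\<lambda>w. w \<circ> move_back p i) \<in> measurable P P"
proof -
  have "inj_on (move_to p i) {..<n}"
    using i by (intro inj_on_inverseI[of _ "move_back p i"]) (auto simp: move_back_move_to)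
  moreover have "move_to p i k < n" if "k < n" for k
    using that i by (intro move_to_lt) auto
  moreover have "move_to p i k = k" if "n \<le> k" for k
    using that i by (auto simp: move_to_def)
  ultimately show "(\<lambda>w. w \<circ> move_to p i) \<in> measurable P P" "distr P P (\<lambda>w. w \<circ> move_to p i) = P"
    unfolding P_def by (blast intro: PiM_permute \<mu>)+
  have "inj_on (move_back p i) {..<n}"
    using i by (intro inj_on_inverseI[of _ "move_to p i"]) (auto simp: move_to_move_back)
  moreover have "move_back p i k < n" if "k < n" for k
    using that i by (intro move_back_lt) auto
  moreover have "move_back p i k = k" if "n \<le> k" for k
    using that i by (auto simp: move_back_def)
  ultimately show "(\<lambda>w. w \<circ> move_back p i) \<in> measurable P P"
    unfolding P_def by (blast intro: PiM_permute \<mu>)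
qed

text \<open>
  The large increment may stand at any position \<open>i\<close> of the window; moving it back to the front gives a
  configuration with \<open>big_jump_first\<close>.
\<close>

definition one_big_jump ::
  "(real \<Rightarrow> real) \<Rightarrow> real \<Rightarrow> real \<Rightarrow> nat \<Rightarrow> nat \<Rightarrow> real \<Rightarrow> real \<Rightarrow> real \<Rightarrow> (nat \<Rightarrow> real) \<Rightarrow> bool" where
  "one_big_jump a h x p m \<rho> J \<epsilon> w \<longleftrightarrow>
     (\<exists>i\<in>{p..<p + m}. big_jump_first a h x p m \<rho> J \<epsilon> (w \<circ> move_back p i))"

lemma sets_one_big_jump:
  fixes \<mu> :: "real measure"
  assumes \<mu>: "prob_space \<mu>" "sets \<mu> = sets borel" and a: "a \<in> borel_measurable borel" and n: "p + m \<le> n"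
  defines "P \<equiv> PiM {..<n} (\<lambda>_. \<mu>)"
  shows "{w\<in>space P. one_big_jump a h x p m \<rho> J \<epsilon> w} \<in> sets P"
proof -
  let ?B = "{w\<in>space P. big_jump_first a h x p m \<rho> J \<epsilon> w}"
  have R: "(\<lambda>w. w \<circ> move_back p i) \<in> measurable P P" if "i \<in> {p..<p + m}" for i
    unfolding P_def using that n by (intro measurable_move \<mu>) auto
  have B: "?B \<in> sets P" if "i \<in> {p..<p + m}" for i
    unfolding P_def using that n by (intro sets_big_jump_first \<mu> a) auto
  have "(\<Union>i\<in>{p..<p + m}. (\<lambda>w. w \<circ> move_back p i) -` ?B \<inter> space P) \<in> sets P"
    using R B by (intro sets.finite_UN) (auto intro: measurable_sets)
  also have "(\<Union>i\<in>{p..<p + m}. (\<lambda>w. w \<circ> move_back p i) -` ?B \<inter> space P) =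
    {w\<in>space P. one_big_jump a h x p m \<rho> J \<epsilon> w}"
    using measurable_space[OF R] unfolding one_big_jump_def by blast
  finally show ?thesis .
qed

text \<open>
  The condition \<open>3 \<epsilon> < \<bar>J\<bar>\<close> makes the position of the large increment unique: an increment standing
  before the large one is a difference of two small partial sums, hence at most \<open>2 \<epsilon>\<close> in size.
\<close>

lemma one_big_jump_prob_le:
  fixes L h s c K \<epsilon> \<kappa> u v :: real and \<mu> :: "real measure"
  assumes \<mu>: "prob_space \<mu>" "sets \<mu> = sets borel"
    and lip: "\<And>u v. \<bar>a u - a v\<bar> \<le> L * \<bar>u - v\<bar>" and h: "0 < h" "h * L \<le> 1" "0 \<le> L"
    and a[measurable]: "a \<in> borel_measurable borel"
    and s: "s = 1 \<or> s = -1" and c: "0 < c"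
    and \<kappa>: "0 < \<kappa>" "\<kappa> \<le> (1 - h * L) ^ n"
    and sep: "drift_separated a \<rho> J \<epsilon> s c"
    and bound: "\<And>u. \<bar>u - \<rho>\<bar> \<le> 3 * \<epsilon> \<Longrightarrow> \<bar>a u\<bar> \<le> K"
    and short: "real m * h * K \<le> \<epsilon>"
    and big: "3 * \<epsilon> < \<bar>J\<bar>"
    and n: "0 < m" "p + m \<le> n" and uv: "u \<le> v"
  defines "P \<equiv> PiM {..<n} (\<lambda>_. \<mu>)"
  shows "measure P {w\<in>space P. one_big_jump a h x p m \<rho> J \<epsilon> w \<and>
        splitting_scheme a h x w n \<in> {u..v}}
      \<le> ((v - u) / (\<kappa> * (h * c)) + 1) / m"
proof -
  interpret P: prob_space P
    unfolding P_def by (intro prob_space_PiM \<mu>)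
  have sP: "sets P = sets (PiM {..<n} (\<lambda>_. borel))"
    unfolding P_def by (intro sets_PiM_cong refl \<mu>)
  have sch: "(\<lambda>w. splitting_scheme a h x w k) \<in> borel_measurable P" if "k \<le> n" for k
    using measurable_splitting_scheme[OF a that] measurable_cong_sets[OF sP refl] by blast
  define B where "B = {w\<in>space P. big_jump_first a h x p m \<rho> J \<epsilon> w}"
  define S where "S = {w\<in>space P. splitting_scheme a h x w n \<in> {u..v}}"
  have B: "B \<in> sets P"
    unfolding B_def P_def using n by (intro sets_big_jump_first \<mu> a) auto
  have S: "S \<in> sets P" 
  proof -
    have [measurable]: "(\<lambda>w. splitting_scheme a h x w n) \<in> borel_measurable P" by (rule sch) simp
    show ?thesis unfolding S_def by measurable
  qed
  let ?I = "{p..<p + m}"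
  let ?T = "\<lambda>i w. w \<circ> move_to p i" and ?R = "\<lambda>i w. w \<circ> move_back p i"
  have T: "?T i \<in> measurable P P" "distr P P (?T i) = P" "?R i \<in> measurable P P" if "i \<in> ?I" for i
    using that n unfolding P_def by (auto intro!: measurable_move \<mu>)
  have eq: "{w\<in>space P. \<exists>i\<in>?I. ?R i w \<in> B} =
    {w\<in>space P. one_big_jump a h x p m \<rho> J \<epsilon> w}"
    using measurable_space[OF T(3)] unfolding B_def one_big_jump_def by blast
  have small_before: "\<bar>w i\<bar> \<le> 2 * \<epsilon>" if "?R j w \<in> B" "p \<le> i" "i < j" "j < p + m" for i j and w :: "nat \<Rightarrow> real"
  proof -
    let ?w = "w \<circ> move_back p j"
    have sums: "\<bar>\<Sum>l\<in>{p<..k}. ?w l\<bar> \<le> \<epsilon>" if "p \<le> k" "k < p + m" for k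
    proof (cases "k = p")
      case True
      have "\<bar>?w p - J\<bar> \<le> \<epsilon>" using \<open>?R j w \<in> B\<close> by (auto simp: B_def big_jump_first_def)
      then show ?thesis using True by simp
    qed (use \<open>?R j w \<in> B\<close> that in \<open>auto simp: B_def big_jump_first_def\<close>)
    have "{p<..Suc i} = insert (Suc i) {p<..i}" using that by auto
    then have "(\<Sum>l\<in>{p<..Suc i}. ?w l) = ?w (Suc i) + (\<Sum>l\<in>{p<..i}. ?w l)" by simp
    moreover have "?w (Suc i) = w i" using that by (auto simp: move_back_def)
    ultimately show ?thesis using sums[of i] sums[of "Suc i"] that by linarith
  qed
  have at: "\<bar>w i - J\<bar> \<le> \<epsilon>" if "?R i w \<in> B" for i and w :: "nat \<Rightarrow> real"
    using that by (auto simp: B_def big_jump_first_def move_back_def)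
  have disj: "?R j w \<notin> B" if "i \<in> ?I" "j \<in> ?I" "i \<noteq> j" "?R i w \<in> B" for i j w
  proof
    assume j: "?R j w \<in> B"
    show False
    proof (cases "i < j")
      case True
      then show False using small_before[OF j, of i] at[OF \<open>?R i w \<in> B\<close>] that big by auto
    next
      case False
      then show False using small_before[OF \<open>?R i w \<in> B\<close>, of j] at[OF j] that big by auto
    qed
  qed
  have "P.prob ({w\<in>space P. \<exists>i\<in>?I. ?R i w \<in> B} \<inter> S) \<le> ((v - u) / (\<kappa> * (h * c)) + 1) / card ?I"
  proof (rule P.moved_copies_prob_le[where T = "?T"])
    show "finite ?I" "?I \<noteq> {}" using n by auto
    show "?T i \<in> measurable P P" "distr P P (?T i) = P" "?R i \<in> measurable P P" if "i \<in> ?I" for i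
      using T that by blast+
    show "?R i (?T i w) = w" if "i \<in> ?I" for i w
      using that by (auto simp: fun_eq_iff move_to_move_back)
    show "?R j w \<notin> B" if "i \<in> ?I" "j \<in> ?I" "i \<noteq> j" "?R i w \<in> B" for i j w
      using disj that by blast
    show "0 \<le> (v - u) / (\<kappa> * (h * c)) + 1" using uv \<kappa> h c by simp
    show "real (card {i\<in>?I. ?T i w \<in> S}) \<le> (v - u) / (\<kappa> * (h * c)) + 1" if w: "w \<in> B" for w
    proof -
      have "\<kappa> * (h * c) \<le>
        s * (splitting_scheme a h x (?T (Suc i) w) n - splitting_scheme a h x (?T i w) n)"
        if "p \<le> i" "Suc i < p + m" for i
      proof -
        have "\<kappa> * (h * c) \<le> (1 - h * L) ^ n * (h * c)"
          using \<kappa> h c by (intro mult_right_mono) auto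
        also have "\<dots> \<le> s * (splitting_scheme a h x (?T (Suc i) w) n - splitting_scheme a h x (?T i w) n)"
          using w h c that n
          by (intro moved_jump_separation[OF lip _ _ _ s _ _ sep bound short]) (auto simp: B_def)
        finally show ?thesis .
      qed
      then have "real (card {i\<in>?I. splitting_scheme a h x (?T i w) n \<in> {u..v}})
        \<le> (v - u) / (\<kappa> * (h * c)) + 1"
        using \<kappa> h c uv by (intro card_separated_le[OF _ s]) auto
      moreover have "{i\<in>?I. ?T i w \<in> S} = {i\<in>?I. splitting_scheme a h x (?T i w) n \<in> {u..v}}"
        using w measurable_space[OF T(1)] by (auto simp: S_def B_def)
      ultimately show ?thesis by simp
    qed
  qed (use B S in auto)
  moreover have "{w\<in>space P. \<exists>i\<in>?I. ?R i w \<in> B} \<inter> S =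
    {w\<in>space P. one_big_jump a h x p m \<rho> J \<epsilon> w \<and>
        splitting_scheme a h x w n \<in> {u..v}}"
    unfolding eq by (auto simp: S_def)
  ultimately show "measure P {w\<in>space P. one_big_jump a h x p m \<rho> J \<epsilon> w \<and>
        splitting_scheme a h x w n \<in> {u..v}}
      \<le> ((v - u) / (\<kappa> * (h * c)) + 1) / m"
    by simp
qed

section \<open>Independent increments and null sets\<close>

text \<open>
  A null set is covered by countably many intervals with disjoint interiors and small total length,
  and the bound is summed over this cover.
\<close>

lemma (in prob_space) prob_null_if_interval_bound:
  assumes Y[measurable]: "Y \<in> borel_measurable M" and E[measurable]: "E \<in> events" and C: "0 \<le> C"
    and bound: "\<And>u v. u \<le> v \<Longrightarrow> prob (E \<inter> {\<omega>\<in>space M. Y \<omega> \<in> {u<..<v}}) \<le> C * (v - u)"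
    and A: "A \<in> null_sets lborel"
  shows "prob (E \<inter> {\<omega>\<in>space M. Y \<omega> \<in> A}) = 0"
proof -
  have A_borel[measurable]: "A \<in> sets borel" using A by (auto simp: null_sets_def)
  define Q where "Q B = emeasure M (E \<inter> {\<omega>\<in>space M. Y \<omega> \<in> B})" for B
  have closed: "Q {c..d} \<le> ennreal C * ennreal (d - c)" if "c \<le> d" for c d
  proof -
    have "prob (E \<inter> {\<omega>\<in>space M. Y \<omega> \<in> {c..d}}) \<le> C * (d - c) + \<theta>" if "0 < \<theta>" for \<theta>
    proof -
      define \<eta> where "\<eta> = \<theta> / (2 * (C + 1))"
      have \<eta>: "0 < \<eta>" using that C by (simp add: \<eta>_def)
      have "prob (E \<inter> {\<omega>\<in>space M. Y \<omega> \<in> {c..d}}) \<le> prob (E \<inter> {\<omega>\<in>space M. Y \<omega> \<in> {c-\<eta><..<d+\<eta>}})"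
        using \<eta> by (intro finite_measure_mono) auto
      also have "\<dots> \<le> C * ((d + \<eta>) - (c - \<eta>))" using \<eta> \<open>c \<le> d\<close> by (intro bound) auto
      also have "\<dots> \<le> C * (d - c) + \<theta>"
      proof -
        have "C * (2 * \<eta>) \<le> (C + 1) * (2 * \<eta>)" using \<eta> by (intro mult_right_mono) auto
        also have "\<dots> = \<theta>" using C by (simp add: \<eta>_def field_simps)
        finally show ?thesis by (simp add: algebra_simps)
      qed
      finally show ?thesis .
    qed
    then have "prob (E \<inter> {\<omega>\<in>space M. Y \<omega> \<in> {c..d}}) \<le> C * (d - c)" by (rule field_le_epsilon)
    then show ?thesis
      using C that by (simp add: Q_def emeasure_eq_measure ennreal_mult[symmetric] ennreal_leI)
  qed
  have bounded: "Q (A \<inter> {-real N..real N}) = 0" for N :: nat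
  proof -
    let ?A = "A \<inter> cbox (- real N) (real N)"
    have A_leb: "?A \<in> lmeasurable" "measure lebesgue ?A = 0"
    proof -
      have "?A \<in> null_sets lborel" using A by (intro null_set_Int2) auto
      then have "?A \<in> null_sets lebesgue" by (rule null_sets_completionI)
      then show "?A \<in> lmeasurable" "measure lebesgue ?A = 0"
        by (auto simp: fmeasurable_def null_sets_def measure_def)
    qed
    have small: "Q (A \<inter> {-real N..real N}) \<le> ennreal C * ennreal e" if e0: "0 < e" for e
    proof -
      obtain D where D: "countable D" "\<And>K. K \<in> D \<Longrightarrow> K \<noteq> {} \<and> (\<exists>c d. K = cbox c d)"
        "pairwise (\<lambda>A B. interior A \<inter> interior B = {}) D" "?A \<subseteq> \<Union>D"
        "\<Union>D \<in> lmeasurable" "measure lebesgue (\<Union>D) \<le> e"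
        using measurable_outer_intervals_bounded[OF A_leb(1) _ e0, of "- real N" "real N"] A_leb(2)
        by (metis Int_lower2 add_0)
      \<comment> \<open>An enumeration of the cover without repetitions, padded by empty sets.\<close>
      define K where "K n = (if n \<in> to_nat_on D ` D then from_nat_into D n else {})" for n
      have K_in: "K n = {} \<or> K n \<in> D" for n using D(1) by (auto simp: K_def)
      have K_Un: "(\<Union>n. K n) = \<Union>D"
      proof
        show "(\<Union>n. K n) \<subseteq> \<Union>D" using K_in by blast
        show "\<Union>D \<subseteq> (\<Union>n. K n)"
        proof (rule Union_least)
          fix B assume "B \<in> D"
          then have "B = K (to_nat_on D B)" using D(1) by (simp add: K_def)
          then show "B \<subseteq> (\<Union>n. K n)" by blast
        qed
      qed
      have K_disj: "disjoint_family (\<lambda>n. interior (K n))"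
      proof (unfold disjoint_family_on_def, intro ballI impI)
        fix m n :: nat assume "m \<noteq> n"
        then show "interior (K m) \<inter> interior (K n) = {}"
        proof (cases "m \<in> to_nat_on D ` D \<and> n \<in> to_nat_on D ` D")
          case True
          then obtain A B where AB: "A \<in> D" "B \<in> D" "m = to_nat_on D A" "n = to_nat_on D B" by blast
          then have "K m = A" "K n = B" "A \<noteq> B" using D(1) \<open>m \<noteq> n\<close> by (auto simp: K_def)
          then show ?thesis using D(3) AB by (auto simp: pairwise_def)
        qed (auto simp: K_def)
      qed
      have K_cbox: "\<exists>c d. K n = {c..d} \<and> interior (K n) = {c<..<d} \<and> K n \<in> sets borel \<and>
          Q (K n) \<le> ennreal C * emeasure lborel (interior (K n))" for n
      proof (cases "K n = {}")
        case True
        then show ?thesis by (intro exI[of _ 1] exI[of _ 0]) (auto simp: Q_def)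
      next
        case False
        then obtain c d where cd: "K n = {c..d}" "c \<le> d"
          using K_in[of n] D(2)[of "K n"] by (auto simp: cbox_interval)
        then show ?thesis using closed[of c d] by (intro exI[of _ c] exI[of _ d]) auto
      qed
      have K_sets[measurable]: "K n \<in> sets borel" for n using K_cbox by blast
      have UnD: "\<Union>D \<in> sets borel" unfolding K_Un[symmetric] by auto
      have "Q (A \<inter> {-real N..real N}) \<le> Q (\<Union>n. K n)"
        unfolding Q_def
      proof (rule emeasure_mono)
        show "E \<inter> {\<omega>\<in>space M. Y \<omega> \<in> A \<inter> {-real N..real N}} \<subseteq> E \<inter> {\<omega>\<in>space M. Y \<omega> \<in> (\<Union>n. K n)}"
          using D(4) unfolding K_Un by auto
        have "{\<omega>\<in>space M. Y \<omega> \<in> (\<Union>n. K n)} \<in> events"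
          using measurable_sets[OF Y UnD[folded K_Un]] by (simp add: vimage_def Int_def conj_commute)
        then show "E \<inter> {\<omega>\<in>space M. Y \<omega> \<in> (\<Union>n. K n)} \<in> events" using E by (rule sets.Int[rotated])
      qed
      also have "\<dots> = emeasure M (\<Union>n. E \<inter> {\<omega>\<in>space M. Y \<omega> \<in> K n})"
        unfolding Q_def by (rule arg_cong[where f = "emeasure M"]) auto
      also have "\<dots> \<le> (\<Sum>n. Q (K n))"
        unfolding Q_def by (intro emeasure_subadditive_countably) auto
      also have "\<dots> \<le> (\<Sum>n. ennreal C * emeasure lborel (interior (K n)))"
        using K_cbox by (intro suminf_le) auto
      also have "\<dots> = ennreal C * (\<Sum>n. emeasure lborel (interior (K n)))" by simp
      also have "(\<Sum>n. emeasure lborel (interior (K n))) = emeasure lborel (\<Union>n. interior (K n))"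
        using K_disj by (intro suminf_emeasure) auto
      also have "\<dots> \<le> emeasure lborel (\<Union>D)"
        using UnD interior_subset K_Un by (intro emeasure_mono) (auto, blast)
      also have "\<dots> = emeasure lebesgue (\<Union>D)" using UnD by simp
      also have "\<dots> = ennreal (measure lebesgue (\<Union>D))"
        using D(5) by (simp add: emeasure_eq_measure2)
      also have "\<dots> \<le> ennreal e" using D(6) by (rule ennreal_leI)
      finally show ?thesis by (simp add: mult_left_mono)
    qed
    have "Q (A \<inter> {-real N..real N}) \<le> 0"
    proof (rule ennreal_le_epsilon)
      fix e :: real assume "0 < e"
      have "Q (A \<inter> {-real N..real N}) \<le> ennreal C * ennreal (e / (C + 1))"
        using \<open>0 < e\<close> C by (intro small) simp
      also have "\<dots> = ennreal (C * (e / (C + 1)))" using C \<open>0 < e\<close> by (subst ennreal_mult) auto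
      also have "\<dots> \<le> ennreal e"
        using C \<open>0 < e\<close> by (intro ennreal_leI) (simp add: field_simps)
      finally show "Q (A \<inter> {-real N..real N}) \<le> 0 + ennreal e" by simp
    qed
    then show ?thesis by simp
  qed
  have "E \<inter> {\<omega>\<in>space M. Y \<omega> \<in> A} = (\<Union>N. E \<inter> {\<omega>\<in>space M. Y \<omega> \<in> A \<inter> {-real N..real N}})"
  proof -
    have N: "\<exists>N::nat. y \<in> {-real N..real N}" for y :: real
    proof -
      obtain N :: nat where "\<bar>y\<bar> \<le> real N" using real_arch_simple by blast
      then show ?thesis by (intro exI[of _ N]) auto
    qed
    show ?thesis using N by blast
  qed
  also have "emeasure M \<dots> = 0"
    using bounded unfolding Q_def by (intro emeasure_UN_eq_0) auto
  finally show ?thesis by (simp add: measure_def)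
qed

text \<open>
  As in Fatou's lemma: up to a null set, \<open>A\<close> lies in the increasing union of the intersections of
  the tails of \<open>E\<close>.
\<close>

lemma (in prob_space) prob_eventually_le:
  fixes c :: "nat \<Rightarrow> real"
  assumes A: "A \<in> events" and E: "\<And>n. E n \<in> events"
    and ev: "AE \<omega> in M. \<omega> \<in> A \<longrightarrow> (\<forall>\<^sub>F n in sequentially. \<omega> \<in> E n)"
    and c: "\<forall>\<^sub>F n in sequentially. prob (E n) \<le> c n" "c \<longlonglongrightarrow> l"
  shows "prob A \<le> l"
proof -
  define D where "D n = (\<Inter>r\<in>{n..}. E r)" for n
  have D: "D n \<in> events" for n using E by (auto simp: D_def)
  have inc: "incseq D" by (auto simp: incseq_def D_def)
  have "AE \<omega> in M. \<omega> \<in> A \<longrightarrow> \<omega> \<in> (\<Union>n. D n)"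
    using ev by eventually_elim (auto simp: D_def eventually_sequentially)
  then have "prob A \<le> prob (\<Union>n. D n)" using D by (intro finite_measure_mono_AE) auto
  also have "prob (\<Union>n. D n) \<le> l"
  proof (rule tendsto_le[OF _ c(2)])
    show "(\<lambda>n. prob (D n)) \<longlonglongrightarrow> prob (\<Union>n. D n)"
      using D inc by (intro finite_Lim_measure_incseq) auto
    show "\<forall>\<^sub>F n in sequentially. prob (D n) \<le> c n"
      using c(1)
    proof eventually_elim
      case (elim n)
      have "prob (D n) \<le> prob (E n)" using E by (intro finite_measure_mono) (auto simp: D_def)
      then show ?case using elim by simp
    qed
  qed simp
  finally show ?thesis .
qed

context levy_process
begin

definition increment :: "real \<Rightarrow> 'w \<Rightarrow> nat \<Rightarrow> real" where
  "increment h \<omega> i = Z (real (Suc i) * h) \<omega> - Z (real i * h) \<omega>"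

lemma indep_increments_from:
  assumes "0 \<le> r" "0 \<le> h"
  shows "indep_vars (\<lambda>_. borel) (\<lambda>i \<omega>. Z (r + real (Suc i) * h) \<omega> - Z (r + real i * h) \<omega>) {..<n}"
  using assms by (intro independent_increments) (auto simp: mono_def mult_right_mono)

lemma distr_increment_from:
  assumes "0 \<le> r" "0 \<le> h"
  shows "distr M borel (\<lambda>\<omega>. Z (r + real (Suc i) * h) \<omega> - Z (r + real i * h) \<omega>) = distr M borel (Z h)"
proof -
  have "r + real i * h \<le> r + real (Suc i) * h" using assms by (simp add: mult_right_mono)
  moreover have "0 \<le> r + real i * h" using assms by simp
  moreover have "r + real (Suc i) * h - (r + real i * h) = h" by (simp add: distrib_right)
  ultimately show ?thesis using stationary_increments[of "r + real i * h" "r + real (Suc i) * h"] by simp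
qed

lemma measurable_increment[measurable]: "0 \<le> h \<Longrightarrow> (\<lambda>\<omega>. increment h \<omega> i) \<in> borel_measurable M"
  unfolding increment_def by (intro borel_measurable_diff random_variable) auto

lemma distr_increments:
  assumes h: "0 \<le> h" and n: "0 < n"
  shows "distr M (PiM {..<n} (\<lambda>_. borel)) (\<lambda>\<omega>. \<lambda>i\<in>{..<n}. increment h \<omega> i)
    = PiM {..<n} (\<lambda>_. distr M borel (Z h))"
proof -
  have "indep_vars (\<lambda>_. borel) (\<lambda>i \<omega>. increment h \<omega> i) {..<n}"
    using indep_increments_from[of 0 h n] h by (simp add: increment_def)
  then have "distr M (PiM {..<n} (\<lambda>_. borel)) (\<lambda>\<omega>. \<lambda>i\<in>{..<n}. increment h \<omega> i)
    = PiM {..<n} (\<lambda>i. distr M borel (\<lambda>\<omega>. increment h \<omega> i))"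
    using h n by (subst (asm) indep_vars_iff_distr_eq_PiM') auto
  also have "\<dots> = PiM {..<n} (\<lambda>_. distr M borel (Z h))"
    using distr_increment_from[of 0 h] h by (simp add: increment_def)
  finally show ?thesis .
qed

text \<open>
  Events that depend on the first \<open>n\<close> increments only can be computed in the product space, where
  permutations of coordinates preserve the measure.
\<close>

lemma prob_increments:
  assumes h: "0 \<le> h" and n: "0 < n"
    and A: "{w\<in>space (PiM {..<n} (\<lambda>_. distr M borel (Z h))). A w} \<in> sets (PiM {..<n} (\<lambda>_. distr M borel (Z h)))"
    and local: "\<And>w w'. (\<And>i. i < n \<Longrightarrow> w i = w' i) \<Longrightarrow> A w = A w'"
  shows "{\<omega>\<in>space M. A (increment h \<omega>)} \<in> events"
    and "prob {\<omega>\<in>space M. A (increment h \<omega>)} =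
      measure (PiM {..<n} (\<lambda>_. distr M borel (Z h))) {w\<in>space (PiM {..<n} (\<lambda>_. distr M borel (Z h))). A w}"
proof -
  let ?P = "PiM {..<n} (\<lambda>_. distr M borel (Z h))" and ?B = "PiM {..<n} (\<lambda>_. borel :: real measure)"
  let ?V = "\<lambda>\<omega>. \<lambda>i\<in>{..<n}. increment h \<omega> i"
  have V: "?V \<in> measurable M ?B" using h by (intro measurable_restrict measurable_increment)
  have sP: "sets ?P = sets ?B" by (intro sets_PiM_cong) auto
  have eq: "?V -` {w\<in>space ?P. A w} \<inter> space M = {\<omega>\<in>space M. A (increment h \<omega>)}"
  proof -
    have "A (?V \<omega>) = A (increment h \<omega>)" for \<omega> by (rule local) simp
    moreover have "?V \<omega> \<in> space ?P" if "\<omega> \<in> space M" for \<omega>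
      using measurable_space[OF V that] sets_eq_imp_space_eq[OF sP] by simp
    ultimately show ?thesis by auto
  qed
  show "{\<omega>\<in>space M. A (increment h \<omega>)} \<in> events"
    unfolding eq[symmetric] using A unfolding sP by (rule measurable_sets[OF V])
  have "measure (distr M ?B ?V) {w\<in>space ?P. A w} = prob {\<omega>\<in>space M. A (increment h \<omega>)}"
    unfolding eq[symmetric] using A unfolding sP by (rule measure_distr[OF V])
  then show "prob {\<omega>\<in>space M. A (increment h \<omega>)} = measure ?P {w\<in>space ?P. A w}"
    unfolding distr_increments[OF h n] by (rule sym)
qed

end

lemma big_jump_first_cong:
  assumes eq: "\<And>l. l < p + m \<Longrightarrow> w l = w' l" and "0 < m"
  shows "big_jump_first a h x p m \<rho> J \<epsilon> w = big_jump_first a h x p m \<rho> J \<epsilon> w'"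
proof -
  have "splitting_scheme a h x w p = splitting_scheme a h x w' p"
    using eq by (intro splitting_scheme_cong) auto
  moreover have "(\<Sum>l\<in>{p<..k}. w l) = (\<Sum>l\<in>{p<..k}. w' l)" if "k \<in> {p<..<p + m}" for k
    using that eq by (intro sum.cong) auto
  ultimately show ?thesis using eq[of p] \<open>0 < m\<close> by (simp add: big_jump_first_def)
qed

lemma one_big_jump_cong:
  assumes eq: "\<And>l. l < p + m \<Longrightarrow> w l = w' l"
  shows "one_big_jump a h x p m \<rho> J \<epsilon> w = one_big_jump a h x p m \<rho> J \<epsilon> w'"
  unfolding one_big_jump_def
proof (intro bex_cong refl big_jump_first_cong)
  fix i l assume "i \<in> {p..<p + m}" "l < p + m"
  then have "move_back p i l < p + m" by (intro move_back_lt) auto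
  then show "(w \<circ> move_back p i) l = (w' \<circ> move_back p i) l" using eq by simp
qed auto

text \<open>
  With \<open>h = t / (k r)\<close> the final values of the scheme are at least \<open>\<kappa> h c\<close> apart, so the interval
  \<open>[u,v]\<close> gets at most the mass \<open>((v - u) / (\<kappa> h c) + 1) / r\<close>, which equals
  \<open>C (v - u) + 1 / r\<close> for a constant \<open>C\<close>. Convergence of the scheme turns this into a bound for open
  intervals and the limit.
\<close>

lemma (in levy_process) one_big_jump_avoids_null_set:
  fixes L s c K \<epsilon> \<rho> J t :: real and k j :: nat
  assumes X[measurable]: "X \<in> borel_measurable M"
    and conv: "AE \<omega> in M. (\<lambda>r. splitting_scheme a (t / real k / real r) x
      (increment (t / real k / real r) \<omega>) (k * r)) \<longlonglongrightarrow> X \<omega>"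
    and lip: "\<And>u v. \<bar>a u - a v\<bar> \<le> L * \<bar>u - v\<bar>" and L: "0 \<le> L"
    and a: "a \<in> borel_measurable borel"
    and s: "s = 1 \<or> s = -1" and c: "0 < c" and t: "0 < t"
    and sep: "drift_separated a \<rho> J \<epsilon> s c"
    and bound: "\<And>u. \<bar>u - \<rho>\<bar> \<le> 3 * \<epsilon> \<Longrightarrow> \<bar>a u\<bar> \<le> K"
    and big: "3 * \<epsilon> < \<bar>J\<bar>"
    and j: "j < k" and short: "t / real k * K \<le> \<epsilon>"
    and A: "A \<in> null_sets lborel"
  shows "AE \<omega> in M. (\<forall>\<^sub>F r in sequentially. one_big_jump a (t / real k / real r) x (j * r) r \<rho> J \<epsilon>
      (increment (t / real k / real r) \<omega>)) \<longrightarrow> X \<omega> \<notin> A"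
proof -
  define h where "h r = t / real k / real r" for r :: nat
  define W where "W r = {\<omega>\<in>space M. one_big_jump a (h r) x (j * r) r \<rho> J \<epsilon> (increment (h r) \<omega>)}" for r
  have h0: "0 \<le> h r" for r using t by (simp add: h_def)
  have jk: "j * r + r \<le> k * r" for r
    using mult_le_mono1[OF Suc_leI[OF j], of r] by simp
  have pz: "prob_space (distr M borel (Z h'))" if "0 \<le> h'" for h'
    using random_variable[OF that] by (rule prob_space_distr)
  have W: "W r \<in> events" for r
  proof (cases "r = 0")
    case True
    then show ?thesis by (simp add: W_def one_big_jump_def)
  next
    case False
    show ?thesis unfolding W_def
    proof (rule prob_increments(1)[OF h0, of "k * r"])
      show "0 < k * r" using False j by simp
      show "{w \<in> space (Pi\<^sub>M {..<k * r} (\<lambda>_. distr M borel (Z (h r)))). one_big_jump a (h r) x (j * r) r \<rho> J \<epsilon> w}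
        \<in> sets (Pi\<^sub>M {..<k * r} (\<lambda>_. distr M borel (Z (h r))))"
        using h0 jk by (intro sets_one_big_jump pz a) auto
      show "one_big_jump a (h r) x (j * r) r \<rho> J \<epsilon> w = one_big_jump a (h r) x (j * r) r \<rho> J \<epsilon> w'"
        if "\<And>i. i < k * r \<Longrightarrow> w i = w' i" for w w'
        using that jk[of r] by (intro one_big_jump_cong) auto
    qed
  qed
  define E where "E = {\<omega>\<in>space M. \<forall>\<^sub>F r in sequentially. \<omega> \<in> W r}"
  have E: "E \<in> events" unfolding E_def using W by measurable
  \<comment> \<open>Half of the limit of \<open>(1 - h L) ^ (k r)\<close> is a lower bound for large \<open>r\<close>.\<close>
  define \<kappa> where "\<kappa> = exp (- (t * L)) / 2"
  have \<kappa>: "0 < \<kappa>" by (simp add: \<kappa>_def)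
  have hkr: "h r = t / real (k * r)" for r by (simp add: h_def)
  have ev\<kappa>: "\<forall>\<^sub>F r in sequentially. \<kappa> \<le> (1 - h r * L) ^ (k * r)"
  proof -
    have "((\<lambda>n. (1 + (- (t * L)) / real n) ^ n) \<longlonglongrightarrow> exp (- (t * L)))" by (rule tendsto_exp_limit_sequentially)
    moreover have "filterlim (\<lambda>r. k * r) sequentially sequentially"
      using j by (intro mult_nat_left_at_top) auto
    ultimately have "(\<lambda>r. (1 + (- (t * L)) / real (k * r)) ^ (k * r)) \<longlonglongrightarrow> exp (- (t * L))"
      by (rule filterlim_compose)
    moreover have "\<kappa> < exp (- (t * L))" by (simp add: \<kappa>_def)
    ultimately have "\<forall>\<^sub>F r in sequentially. \<kappa> < (1 + (- (t * L)) / real (k * r)) ^ (k * r)"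
      by (rule order_tendstoD)
    then show ?thesis by eventually_elim (simp add: hkr)
  qed
  have evh: "\<forall>\<^sub>F r in sequentially. h r * L \<le> 1"
  proof -
    have "(\<lambda>r. t / real k / real r * L) \<longlonglongrightarrow> 0 * L" by (intro tendsto_intros lim_const_over_n)
    then have "\<forall>\<^sub>F r in sequentially. h r * L < 1" unfolding h_def by (rule order_tendstoD) simp
    then show ?thesis by eventually_elim simp
  qed
  define C where "C = real k / (\<kappa> * t * c)"
  have C: "0 \<le> C" using \<kappa> t c by (simp add: C_def)
  have interval: "prob (E \<inter> {\<omega>\<in>space M. X \<omega> \<in> {u<..<v}}) \<le> C * (v - u)" if uv: "u \<le> v" for u v
  proof -
    define S where "S r = {\<omega>\<in>space M. one_big_jump a (h r) x (j * r) r \<rho> J \<epsilon> (increment (h r) \<omega>) \<and>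
        splitting_scheme a (h r) x (increment (h r) \<omega>) (k * r) \<in> {u..v}}" for r
    have S: "S r \<in> events \<and> (h r * L \<le> 1 \<longrightarrow> \<kappa> \<le> (1 - h r * L) ^ (k * r) \<longrightarrow>
      prob (S r) \<le> ((v - u) / (\<kappa> * (h r * c)) + 1) / real r)" if r: "0 < r" for r
    proof -
      let ?P = "Pi\<^sub>M {..<k * r} (\<lambda>_. distr M borel (Z (h r)))"
      let ?A = "\<lambda>w. one_big_jump a (h r) x (j * r) r \<rho> J \<epsilon> w \<and> splitting_scheme a (h r) x w (k * r) \<in> {u..v}"
      have sP: "sets ?P = sets (PiM {..<k * r} (\<lambda>_. borel))"
        by (intro sets_PiM_cong refl) auto
      have kr: "0 < k * r" using r j by simp
      have meas: "{w\<in>space ?P. ?A w} \<in> sets ?P"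
      proof -
        have "{w\<in>space ?P. one_big_jump a (h r) x (j * r) r \<rho> J \<epsilon> w} \<in> sets ?P"
          using h0 jk by (intro sets_one_big_jump pz a) auto
        moreover have "(\<lambda>w. splitting_scheme a (h r) x w (k * r)) \<in> borel_measurable ?P"
          unfolding measurable_cong_sets[OF sP refl] by (intro measurable_splitting_scheme a) simp
        then have "(\<lambda>w. splitting_scheme a (h r) x w (k * r)) -` {u..v} \<inter> space ?P \<in> sets ?P"
          by (rule measurable_sets) simp
        moreover have "{w\<in>space ?P. ?A w} = {w\<in>space ?P. one_big_jump a (h r) x (j * r) r \<rho> J \<epsilon> w} \<inter>
          ((\<lambda>w. splitting_scheme a (h r) x w (k * r)) -` {u..v} \<inter> space ?P)" by auto
        ultimately show ?thesis by auto
      qed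
      have local: "?A w = ?A w'" if "\<And>i. i < k * r \<Longrightarrow> w i = w' i" for w w'
      proof -
        have "splitting_scheme a (h r) x w (k * r) = splitting_scheme a (h r) x w' (k * r)"
          using that by (intro splitting_scheme_cong) auto
        moreover have "one_big_jump a (h r) x (j * r) r \<rho> J \<epsilon> w = one_big_jump a (h r) x (j * r) r \<rho> J \<epsilon> w'"
          using that jk[of r] by (intro one_big_jump_cong) auto
        ultimately show ?thesis by simp
      qed
      have "S r \<in> events"
        unfolding S_def by (rule prob_increments(1)[OF h0 kr meas local])
      moreover have "prob (S r) \<le> ((v - u) / (\<kappa> * (h r * c)) + 1) / real r"
        if "h r * L \<le> 1" "\<kappa> \<le> (1 - h r * L) ^ (k * r)"
      proof -
        have "prob (S r) = measure ?P {w\<in>space ?P. ?A w}"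
          unfolding S_def by (rule prob_increments(2)[OF h0 kr meas local])
        also have "\<dots> \<le> ((v - u) / (\<kappa> * (h r * c)) + 1) / real r"
        proof (rule one_big_jump_prob_le[OF _ _ lip _ that(1) L a s c \<kappa> that(2) sep bound _ big r jk uv])
          show "prob_space (distr M borel (Z (h r)))" using h0 by (rule pz)
          show "0 < h r" using t r j by (simp add: h_def)
          show "real r * h r * K \<le> \<epsilon>" using short r by (simp add: h_def)
        qed auto
        finally show ?thesis .
      qed
      ultimately show ?thesis by blast
    qed
    show ?thesis
    proof (rule prob_eventually_le[where E = "\<lambda>r. S (Suc r)" and c = "\<lambda>r. C * (v - u) + 1 / real (Suc r)"])
      show "E \<inter> {\<omega>\<in>space M. X \<omega> \<in> {u<..<v}} \<in> events" using E by measurable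
      show "S (Suc r) \<in> events" for r using S by blast
      show "AE \<omega> in M. \<omega> \<in> E \<inter> {\<omega>\<in>space M. X \<omega> \<in> {u<..<v}} \<longrightarrow> (\<forall>\<^sub>F r in sequentially. \<omega> \<in> S (Suc r))"
        using conv
      proof eventually_elim
        case (elim \<omega>)
        show ?case
        proof
          assume w: "\<omega> \<in> E \<inter> {\<omega>\<in>space M. X \<omega> \<in> {u<..<v}}"
          have "\<forall>\<^sub>F r in sequentially. splitting_scheme a (h r) x (increment (h r) \<omega>) (k * r) \<in> {u<..<v}"
            using topological_tendstoD[OF elim, of "{u<..<v}"] w unfolding h_def by auto
          moreover have "\<forall>\<^sub>F r in sequentially. \<omega> \<in> W r" using w by (auto simp: E_def)
          ultimately have "\<forall>\<^sub>F r in sequentially. \<omega> \<in> S r"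
            by eventually_elim (auto simp: S_def W_def)
          then show "\<forall>\<^sub>F r in sequentially. \<omega> \<in> S (Suc r)"
            by (rule eventually_sequentially_Suc[THEN iffD2])
        qed
      qed
      have "\<forall>\<^sub>F r in sequentially. prob (S r) \<le> C * (v - u) + 1 / real r"
        using ev\<kappa> evh eventually_gt_at_top[of 0]
      proof eventually_elim
        case (elim r)
        have "((v - u) / (\<kappa> * (h r * c)) + 1) / real r = C * (v - u) + 1 / real r"
          using elim t j \<kappa> c by (simp add: C_def h_def field_simps)
        then show ?case using S[OF elim(3)] elim by simp
      qed
      then show "\<forall>\<^sub>F r in sequentially. prob (S (Suc r)) \<le> C * (v - u) + 1 / real (Suc r)"
        by (rule eventually_sequentially_Suc[THEN iffD2])
      have "(\<lambda>r. C * (v - u) + 1 / real (Suc r)) \<longlonglongrightarrow> C * (v - u) + 0"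
        by (intro tendsto_intros LIMSEQ_Suc lim_const_over_n)
      then show "(\<lambda>r. C * (v - u) + 1 / real (Suc r)) \<longlonglongrightarrow> C * (v - u)" by simp
    qed
  qed
  have A': "A \<in> sets borel" using A by (auto simp: null_sets_def)
  have "prob (E \<inter> {\<omega>\<in>space M. X \<omega> \<in> A}) = 0"
    by (rule prob_null_if_interval_bound[OF X E C interval A])
  moreover have "E \<inter> {\<omega>\<in>space M. X \<omega> \<in> A} \<in> events" using E A' by measurable
  ultimately have "E \<inter> {\<omega>\<in>space M. X \<omega> \<in> A} \<in> null_sets M"
    by (auto simp: null_sets_def emeasure_eq_measure)
  then have "AE \<omega> in M. \<omega> \<notin> E \<inter> {\<omega>\<in>space M. X \<omega> \<in> A}" by (rule AE_not_in)
  then show ?thesis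
    using AE_space by eventually_elim (auto simp: E_def W_def h_def)
qed

section \<open>Cadlag paths and convergence of the scheme\<close>

lemma cadlag_right_close:
  assumes "cadlag f" "0 \<le> t" "0 < e"
  obtains d where "0 < d" "\<And>s. t \<le> s \<Longrightarrow> s < t + d \<Longrightarrow> \<bar>f s - f t\<bar> < e"
proof -
  have "(f \<longlongrightarrow> f t) (at_right t)" using assms by (simp add: cadlag_def)
  then have "\<forall>\<^sub>F s in at_right t. dist (f s) (f t) < e" using assms(3) by (rule tendstoD)
  then obtain b where b: "t < b" "\<And>s. t < s \<Longrightarrow> s < b \<Longrightarrow> dist (f s) (f t) < e"
    by (auto simp: eventually_at_right_field)
  show ?thesis
  proof (rule that[of "b - t"])
    fix s assume "t \<le> s" "s < t + (b - t)"
    then show "\<bar>f s - f t\<bar> < e"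
      using b(2)[of s] assms(3) by (cases "s = t") (auto simp: dist_real_def)
  qed (use b in simp)
qed

lemma cadlag_left_limit:
  assumes "cadlag f" "0 < t"
  obtains l where "(f \<longlongrightarrow> l) (at_left t)"
  using assms unfolding cadlag_def by blast

lemma left_limit_close:
  fixes f :: "real \<Rightarrow> real"
  assumes "(f \<longlongrightarrow> l) (at_left t)" "0 < e"
  obtains d where "0 < d" "\<And>s. t - d < s \<Longrightarrow> s < t \<Longrightarrow> \<bar>f s - l\<bar> < e"
proof -
  have "\<forall>\<^sub>F s in at_left t. dist (f s) l < e" using assms by (rule tendstoD)
  then obtain b where b: "b < t" "\<And>s. b < s \<Longrightarrow> s < t \<Longrightarrow> dist (f s) l < e"
    by (auto simp: eventually_at_left_field)
  show ?thesis
    by (rule that[of "t - b"]) (use b in \<open>auto simp: dist_real_def\<close>)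
qed

lemma cadlag_bounded:
  assumes "cadlag f"
  obtains C where "0 \<le> C" "\<And>t. 0 \<le> t \<Longrightarrow> t \<le> b \<Longrightarrow> \<bar>f t\<bar> \<le> C"
proof -
  have "\<exists>d C. 0 < d \<and> (\<forall>s. 0 \<le> s \<longrightarrow> \<bar>s - t\<bar> < d \<longrightarrow> \<bar>f s\<bar> \<le> C)" if t0: "0 \<le> t" for t
  proof -
    obtain d where d: "0 < d" "\<And>s. t \<le> s \<Longrightarrow> s < t + d \<Longrightarrow> \<bar>f s - f t\<bar> < 1"
      using cadlag_right_close[OF assms t0, of 1] by auto
    show ?thesis
    proof (cases "t = 0")
      case True
      have "\<bar>f s\<bar> \<le> \<bar>f t\<bar> + 1" if "0 \<le> s" "\<bar>s - t\<bar> < d" for s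
        using d(2)[of s] that True by auto
      then show ?thesis using d(1) by blast
    next
      case False
      then obtain l where "(f \<longlongrightarrow> l) (at_left t)"
        using cadlag_left_limit[OF assms, of t] t0 by force
      then obtain d' where d': "0 < d'" "\<And>s. t - d' < s \<Longrightarrow> s < t \<Longrightarrow> \<bar>f s - l\<bar> < 1"
        by (rule left_limit_close[where e = 1]) auto
      have "\<bar>f s\<bar> \<le> \<bar>f t\<bar> + \<bar>l\<bar> + 1" if "0 \<le> s" "\<bar>s - t\<bar> < min d d'" for s
      proof (cases "t \<le> s")
        case True
        then show ?thesis using d(2)[of s] that by linarith
      next
        case False
        then show ?thesis using d'(2)[of s] that by linarith
      qed
      moreover have "0 < min d d'" using d d' by simp
      ultimately show ?thesis by blast
    qed
  qed
  then obtain d C where dC: "\<And>t. 0 \<le> t \<Longrightarrow> 0 < d t"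
      "\<And>t s. 0 \<le> t \<Longrightarrow> 0 \<le> s \<Longrightarrow> \<bar>s - t\<bar> < d t \<Longrightarrow> \<bar>f s\<bar> \<le> C t"
    by metis
  have cover: "{0..b} \<subseteq> (\<Union>t\<in>{0..b}. ball t (d t))"
  proof
    fix t assume "t \<in> {0..b}"
    then show "t \<in> (\<Union>t\<in>{0..b}. ball t (d t))" using dC(1)[of t] by (intro UN_I[of t]) auto
  qed
  obtain F where F: "F \<subseteq> {0..b}" "finite F" "{0..b} \<subseteq> (\<Union>t\<in>F. ball t (d t))"
    by (rule compactE_image[OF compact_Icc _ cover]) auto
  have "\<bar>f t\<bar> \<le> (\<Sum>u\<in>F. \<bar>C u\<bar>)" if t: "0 \<le> t" "t \<le> b" for t
  proof -
    have "t \<in> (\<Union>t\<in>F. ball t (d t))" using F(3) t by (meson atLeastAtMost_iff subsetD)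
    then obtain u where u: "u \<in> F" "\<bar>t - u\<bar> < d u" by (auto simp: dist_real_def abs_minus_commute)
    then have "\<bar>f t\<bar> \<le> C u" using dC(2)[of u t] F(1) t by auto
    also have "\<dots> \<le> (\<Sum>u\<in>F. \<bar>C u\<bar>)"
      using member_le_sum[of u F "\<lambda>u. \<bar>C u\<bar>"] u F(2) by auto
    finally show ?thesis .
  qed
  then show ?thesis by (intro that[of "\<Sum>u\<in>F. \<bar>C u\<bar>"]) (auto intro: sum_nonneg)
qed

text \<open>
  Rounding up to the grid approaches a time from the right, where a cadlag path is continuous.
\<close>

definition grid_above :: "real \<Rightarrow> real \<Rightarrow> real" where
  "grid_above h s = h * of_int \<lceil>s / h\<rceil>"

lemma grid_above_bounds: "0 < h \<Longrightarrow> s \<le> grid_above h s \<and> grid_above h s < s + h"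
proof -
  assume h: "0 < h"
  have "s / h \<le> of_int \<lceil>s / h\<rceil>" "of_int \<lceil>s / h\<rceil> < s / h + 1" by linarith+
  then have "h * (s / h) \<le> h * of_int \<lceil>s / h\<rceil>" "h * of_int \<lceil>s / h\<rceil> < h * (s / h + 1)"
    using h by (intro mult_left_mono mult_strict_left_mono; simp)+
  then show ?thesis using h by (simp add: grid_above_def distrib_left)
qed

lemma grid_above_cell:
  assumes "0 < h" "real i * h < s" "s \<le> real (Suc i) * h"
  shows "grid_above h s = real (Suc i) * h"
proof -
  have "\<lceil>s / h\<rceil> = int (Suc i)" using assms by (intro ceiling_unique) (auto simp: field_simps)
  then show ?thesis by (simp add: grid_above_def)
qed

lemma grid_above_tendsto:
  assumes f: "cadlag f" and s: "0 \<le> s" and \<delta>: "0 < \<delta>"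
  shows "(\<lambda>r. f (grid_above (\<delta> / real r) s)) \<longlonglongrightarrow> f s"
proof (rule tendstoI)
  fix e :: real assume "0 < e"
  then obtain d where d: "0 < d" "\<And>y. s \<le> y \<Longrightarrow> y < s + d \<Longrightarrow> \<bar>f y - f s\<bar> < e"
    using cadlag_right_close[OF f s] by blast
  have "(\<lambda>r. \<delta> / real r) \<longlonglongrightarrow> 0" by (rule lim_const_over_n)
  then have "\<forall>\<^sub>F r in sequentially. \<delta> / real r < d" using d(1) by (rule order_tendstoD)
  then show "\<forall>\<^sub>F r in sequentially. dist (f (grid_above (\<delta> / real r) s)) (f s) < e"
    using eventually_gt_at_top[of 0]
  proof eventually_elim
    case (elim r)
    then show ?case
      using grid_above_bounds[of "\<delta> / real r" s] \<delta> d(2)[of "grid_above (\<delta> / real r) s"]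
      by (auto simp: dist_real_def)
  qed
qed

lemma measurable_grid_above: "(\<lambda>s. f (grid_above h (max 0 s))) \<in> borel_measurable borel"
proof -
  have "(\<lambda>k::int. f (h * of_int k)) \<in> borel_measurable (count_space UNIV)" by simp
  moreover have "(\<lambda>s::real. \<lceil>max 0 s / h\<rceil>) \<in> measurable borel (count_space UNIV)" by measurable
  ultimately show ?thesis unfolding grid_above_def by (rule measurable_compose[rotated])
qed

text \<open>
  Values at negative times are arbitrary, hence the restriction to \<open>max 0 s\<close>.
\<close>

lemma measurable_cadlag:
  assumes "cadlag f"
  shows "(\<lambda>s. f (max 0 s)) \<in> borel_measurable borel"
proof (rule borel_measurable_LIMSEQ_real[of _ "\<lambda>r s. f (grid_above (1 / real r) (max 0 s))"])
  show "(\<lambda>r. f (grid_above (1 / real r) (max 0 s))) \<longlonglongrightarrow> f (max 0 s)" for s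
    by (rule grid_above_tendsto[OF assms]) auto
qed (rule measurable_grid_above)

lemma bounded_measurable_set_integrable:
  fixes g :: "real \<Rightarrow> real"
  assumes [measurable]: "g \<in> borel_measurable borel" and C: "\<And>s. 0 \<le> s \<Longrightarrow> s \<le> b \<Longrightarrow> \<bar>g s\<bar> \<le> C"
  shows "set_integrable lborel {0..b} g"
  unfolding set_integrable_def
  by (rule integrableI_bounded_set_indicator[of _ _ _ C])
     (use C in \<open>auto simp: emeasure_lborel_Icc_eq\<close>)

lemma cadlag_set_integrable:
  fixes f a :: "real \<Rightarrow> real"
  assumes f: "cadlag f" and a: "continuous_on UNIV a"
  shows "set_integrable lborel {0..b} (\<lambda>s. a (f s))"
proof -
  obtain C where C: "\<And>t. 0 \<le> t \<Longrightarrow> t \<le> b \<Longrightarrow> \<bar>f t\<bar> \<le> C" using cadlag_bounded[OF f] by metis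
  have "compact (a ` {-C..C})"
    using a by (intro compact_continuous_image) (auto intro: continuous_on_subset)
  then obtain D where D: "\<And>u. \<bar>u\<bar> \<le> C \<Longrightarrow> \<bar>a u\<bar> \<le> D"
    by (force dest!: compact_imp_bounded simp: bounded_iff abs_le_iff)
  have "set_integrable lborel {0..b} (\<lambda>s. a (f (max 0 s)))"
  proof (rule bounded_measurable_set_integrable)
    show "(\<lambda>s. a (f (max 0 s))) \<in> borel_measurable borel"
      using measurable_compose[OF measurable_cadlag[OF f] borel_measurable_continuous_onI[OF a]] .
    show "\<bar>a (f (max 0 s))\<bar> \<le> D" if "0 \<le> s" "s \<le> b" for s
      using that C D by simp
  qed
  then show ?thesis by (rule set_integrable_cong[THEN iffD1, rotated -1]) auto
qed

lemma lipschitz_continuous: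
  fixes a :: "real \<Rightarrow> real"
  assumes lip: "\<And>u v. \<bar>a u - a v\<bar> \<le> L * \<bar>u - v\<bar>" and "0 \<le> L"
  shows "continuous_on UNIV a"
proof -
  have "L-lipschitz_on UNIV a" using assms by (auto simp: lipschitz_on_def dist_real_def)
  then show ?thesis by (rule lipschitz_on_continuous_on)
qed

text \<open>
  A discrete Gronwall argument: the error is controlled by \<open>G\<close>, the distance between \<open>f\<close> and its value
  at the next grid point, integrated over time. By right-continuity and dominated convergence this
  integral vanishes in the limit.
\<close>

lemma scheme_tendsto:
  fixes f z a :: "real \<Rightarrow> real" and x \<delta> L :: real
  assumes f: "cadlag f" and lip: "\<And>u v. \<bar>a u - a v\<bar> \<le> L * \<bar>u - v\<bar>" and L: "0 \<le> L"
    and eq: "\<And>t. 0 \<le> t \<Longrightarrow> f t = x + integral {0..t} (\<lambda>s. a (f s)) + z t"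
    and z0: "z 0 = 0" and \<delta>: "0 < \<delta>"
  shows "(\<lambda>r. splitting_scheme a (\<delta> / real r) x
      (\<lambda>i. z (real (Suc i) * (\<delta> / real r)) - z (real i * (\<delta> / real r))) (j * r)) \<longlonglongrightarrow> f (real j * \<delta>)"
proof -
  define b where "b = real j * \<delta>"
  have b: "0 \<le> b" using \<delta> by (simp add: b_def)
  have cont: "continuous_on UNIV a" using lip L by (rule lipschitz_continuous)
  obtain C where C: "0 \<le> C" "\<And>t. 0 \<le> t \<Longrightarrow> t \<le> b + \<delta> \<Longrightarrow> \<bar>f t\<bar> \<le> C"
    using cadlag_bounded[OF f] by metis
  define K where "K = \<bar>a 0\<bar> + L * C"
  have K: "0 \<le> K" using L C by (simp add: K_def)
  have aK: "\<bar>a (f s)\<bar> \<le> K" if "0 \<le> s" "s \<le> b" for s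
  proof -
    have "\<bar>a (f s)\<bar> \<le> \<bar>a 0\<bar> + L * \<bar>f s\<bar>" using lip[of "f s" 0] by simp
    also have "\<dots> \<le> K" unfolding K_def using L C(2)[of s] that \<delta> by (intro add_mono mult_left_mono) auto
    finally show ?thesis .
  qed
  have int_a: "(\<lambda>s. a (f s)) integrable_on {0..c}" for c
    by (rule set_borel_integral_eq_integral(1)[OF cadlag_set_integrable[OF f cont]])
  define G where "G h s = \<bar>f (grid_above h s) - f s\<bar>" for h s
  have G_bound: "\<bar>G h s\<bar> \<le> 2 * C" if "0 \<le> s" "s \<le> b" "0 < h" "h \<le> \<delta>" for h s
  proof -
    have "0 \<le> grid_above h s" "grid_above h s \<le> b + \<delta>" using grid_above_bounds[of h s] that by auto
    then show ?thesis using C(2)[of "grid_above h s"] C(2)[of s] that \<delta> by (auto simp: G_def)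
  qed
  have int_G: "G h integrable_on {0..b}" if "0 < h" "h \<le> \<delta>" for h
  proof -
    have "set_integrable lborel {0..b} (\<lambda>s. G h (max 0 s))"
    proof (rule bounded_measurable_set_integrable)
      have [measurable]: "(\<lambda>s. f (max 0 s)) \<in> borel_measurable borel"
        "(\<lambda>s. f (grid_above h (max 0 s))) \<in> borel_measurable borel"
        using measurable_cadlag[OF f] measurable_grid_above by auto
      show "(\<lambda>s. G h (max 0 s)) \<in> borel_measurable borel" unfolding G_def by measurable
    qed (use G_bound that in auto)
    then have "(\<lambda>s. G h (max 0 s)) integrable_on {0..b}" by (rule set_borel_integral_eq_integral(1))
    then show ?thesis by (rule integrable_eq) auto
  qed
  have step: "\<bar>splitting_scheme a h x (\<lambda>i. z (real (Suc i) * h) - z (real i * h)) i - f (real i * h)\<bar>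
    \<le> exp (L * h * i) * (L * (real i * h * h * K) + L * integral {0..real i * h} (G h))"
    if "0 < h" "h \<le> \<delta>" "real i * h \<le> b" for h i
    using that(3)
  proof (induction i)
    case 0
    then show ?case using eq[of 0] z0 by simp
  next
    case (Suc i)
    define p q where "p = real i * h" and "q = real (Suc i) * h"
    have pq: "0 \<le> p" "p < q" "q \<le> b" "q - p = h" using that(1) Suc.prems by (auto simp: p_def q_def field_simps)
    define S where "S = splitting_scheme a h x (\<lambda>i. z (real (Suc i) * h) - z (real i * h))"
    define u where "u = S i + (z q - z p)"
    define d where "d = S i - f p"
    have int_pq: "(\<lambda>s. a (f s)) integrable_on {p..q}"
      by (rule integrable_subinterval_real[OF int_a[where c = q]]) (use pq in auto)
    have comb: "integral {0..q} (\<lambda>s. a (f s)) = integral {0..p} (\<lambda>s. a (f s)) + integral {p..q} (\<lambda>s. a (f s))"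
      using Henstock_Kurzweil_Integration.integral_combine[where a = 0 and c = p and b = q and f = "\<lambda>s. a (f s)"] int_a pq by simp
    have fq: "f q = f p + integral {p..q} (\<lambda>s. a (f s)) + (z q - z p)"
      using eq[of p] eq[of q] pq comb by simp
    have Iaf: "\<bar>integral {p..q} (\<lambda>s. a (f s))\<bar> \<le> K * h"
    proof -
      have "norm (integral {p..q} (\<lambda>s. a (f s))) \<le> integral {p..q} (\<lambda>_. K)"
        using aK pq by (intro integral_norm_bound_integral[OF int_pq]) auto
      then show ?thesis using pq by (simp add: mult.commute)
    qed
    have int_Gpq: "G h integrable_on {p..q}"
      by (rule integrable_subinterval_real[OF int_G[OF that(1,2)]]) (use pq in auto)
    have Gcell: "G h s = \<bar>f q - f s\<bar>" if "s \<in> {p..q} - {p}" for s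
      using that grid_above_cell[OF \<open>0 < h\<close>, of i s] by (auto simp: G_def p_def q_def)
    have int_q: "(\<lambda>s. \<bar>f q - f s\<bar>) integrable_on {p..q}"
      by (rule integrable_spike[OF int_Gpq, of "{p}"]) (use Gcell in auto)
    have int_Lq: "(\<lambda>s. L * \<bar>f q - f s\<bar>) integrable_on {p..q}"
      using integrable_on_cmult_left[OF int_q, of L] by simp
    have I_q: "integral {p..q} (\<lambda>s. \<bar>f q - f s\<bar>) = integral {p..q} (G h)"
      by (rule integral_spike[of "{p}"]) (use Gcell in auto)
    have uq: "\<bar>u - f q\<bar> \<le> \<bar>d\<bar> + K * h"
      using Iaf unfolding u_def d_def fq by linarith
    have "\<bar>h * a u - integral {p..q} (\<lambda>s. a (f s))\<bar> = \<bar>integral {p..q} (\<lambda>s. a u - a (f s))\<bar>"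
      using int_pq pq by (subst Henstock_Kurzweil_Integration.integral_diff) auto
    also have "\<dots> \<le> integral {p..q} (\<lambda>s. L * (\<bar>d\<bar> + K * h) + L * \<bar>f q - f s\<bar>)"
    proof -
      have "norm (integral {p..q} (\<lambda>s. a u - a (f s)))
        \<le> integral {p..q} (\<lambda>s. L * (\<bar>d\<bar> + K * h) + L * \<bar>f q - f s\<bar>)"
      proof (rule integral_norm_bound_integral)
        show "(\<lambda>s. a u - a (f s)) integrable_on {p..q}"
          using int_pq by (intro integrable_diff) auto
        show "(\<lambda>s. L * (\<bar>d\<bar> + K * h) + L * \<bar>f q - f s\<bar>) integrable_on {p..q}"
          using int_Lq by (intro integrable_add) auto
        fix s assume "s \<in> {p..q}"
        have "\<bar>a u - a (f s)\<bar> \<le> L * \<bar>u - f s\<bar>" by (rule lip)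
        also have "\<dots> \<le> L * (\<bar>d\<bar> + K * h + \<bar>f q - f s\<bar>)"
          using uq L by (intro mult_left_mono) linarith+
        finally show "norm (a u - a (f s)) \<le> L * (\<bar>d\<bar> + K * h) + L * \<bar>f q - f s\<bar>"
          by (simp add: algebra_simps)
      qed
      then show ?thesis by simp
    qed
    also have "\<dots> = h * (L * (\<bar>d\<bar> + K * h)) + L * integral {p..q} (G h)"
      using int_Lq pq unfolding I_q[symmetric]
      by (subst Henstock_Kurzweil_Integration.integral_add) auto
    finally have err: "\<bar>h * a u - integral {p..q} (\<lambda>s. a (f s))\<bar>
      \<le> h * (L * (\<bar>d\<bar> + K * h)) + L * integral {p..q} (G h)" .
    have "S (Suc i) - f q = d + (h * a u - integral {p..q} (\<lambda>s. a (f s)))"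
      unfolding fq d_def u_def by (simp add: S_def p_def q_def)
    then have 1: "\<bar>S (Suc i) - f q\<bar> \<le> (1 + L * h) * \<bar>d\<bar> + (L * (h * h * K) + L * integral {p..q} (G h))"
      using err by (simp add: algebra_simps)
    have IG0: "0 \<le> integral {p..q} (G h)"
      by (rule integral_nonneg[OF int_Gpq]) (auto simp: G_def)
    have IH: "\<bar>d\<bar> \<le> exp (L * h * i) * (L * (real i * h * h * K) + L * integral {0..p} (G h))"
      using Suc pq unfolding d_def S_def p_def q_def by auto
    have "(1 + L * h) * \<bar>d\<bar> \<le> exp (L * h) * (exp (L * h * i) * (L * (real i * h * h * K) + L * integral {0..p} (G h)))"
      using IH L that(1) exp_ge_add_one_self[of "L * h"] by (intro mult_mono) auto
    also have "\<dots> = exp (L * h * Suc i) * (L * (real i * h * h * K) + L * integral {0..p} (G h))"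
    proof -
      have "L * h * real (Suc i) = L * h + L * h * real i" by (simp add: distrib_left)
      then show ?thesis by (simp only: exp_add mult.assoc)
    qed
    finally have 2: "(1 + L * h) * \<bar>d\<bar> \<le> exp (L * h * Suc i) * (L * (real i * h * h * K) + L * integral {0..p} (G h))" .
    have "L * (h * h * K) + L * integral {p..q} (G h) \<le> exp (L * h * Suc i) * (L * (h * h * K) + L * integral {p..q} (G h))"
    proof -
      have "0 \<le> L * (h * h * K) + L * integral {p..q} (G h)" using L K IG0 by simp
      moreover have "1 \<le> exp (L * h * Suc i)" using L that(1) by simp
      ultimately show ?thesis
        using mult_right_mono[of 1 "exp (L * h * Suc i)"] by fastforce
    qed
    then have 3: "\<bar>S (Suc i) - f q\<bar> \<le> exp (L * h * Suc i) * (L * (real i * h * h * K) + L * integral {0..p} (G h)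
      + (L * (h * h * K) + L * integral {p..q} (G h)))"
      using 1 2 unfolding distrib_left[of "exp _" "_ + _" "_ + _"] by linarith
    have "integral {0..q} (G h) = integral {0..p} (G h) + integral {p..q} (G h)"
      using Henstock_Kurzweil_Integration.integral_combine[where a = 0 and c = p and b = q and f = "G h"] int_G[OF that(1,2)] pq
      by (simp add: integrable_subinterval_real)
    then have "L * (real i * h * h * K) + L * integral {0..p} (G h) + (L * (h * h * K) + L * integral {p..q} (G h))
      = L * (real (Suc i) * h * h * K) + L * integral {0..q} (G h)"
      by (simp add: distrib_left distrib_right)
    then show ?case using 3 unfolding S_def q_def[symmetric] by (simp only:)
  qed
  have I0: "(\<lambda>r. integral {0..b} (G (\<delta> / real r))) \<longlonglongrightarrow> 0"
  proof -
    have "(\<lambda>r. integral {0..b} (G (\<delta> / real (Suc r)))) \<longlonglongrightarrow> integral {0..b} (\<lambda>s. 0)"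
    proof (rule dominated_convergence(2)[where h = "\<lambda>_. 2 * C"])
      have le: "0 < \<delta> / real (Suc r)" "\<delta> / real (Suc r) \<le> \<delta>" for r
        using \<delta> by (auto simp: field_simps)
      show "G (\<delta> / real (Suc r)) integrable_on {0..b}" for r using int_G[OF le] .
      show "norm (G (\<delta> / real (Suc r)) s) \<le> 2 * C" if "s \<in> {0..b}" for r s
        using G_bound[OF _ _ le] that by auto
      show "(\<lambda>r. G (\<delta> / real (Suc r)) s) \<longlonglongrightarrow> 0" if "s \<in> {0..b}" for s
      proof -
        have "(\<lambda>r. f (grid_above (\<delta> / real r) s)) \<longlonglongrightarrow> f s"
          using that grid_above_tendsto[OF f _ \<delta>, of s] by auto
        then have "(\<lambda>r. G (\<delta> / real r) s) \<longlonglongrightarrow> \<bar>f s - f s\<bar>"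
          unfolding G_def by (intro tendsto_intros)
        then show ?thesis using LIMSEQ_Suc by fastforce
      qed
    qed auto
    then show ?thesis by (simp only: integral_0 LIMSEQ_imp_Suc[of "\<lambda>r. integral {0..b} (G (\<delta> / real r))"])
  qed
  have lim: "(\<lambda>r. exp (L * b) * (L * (b * (\<delta> / real r) * K) + L * integral {0..b} (G (\<delta> / real r)))) \<longlonglongrightarrow>
    exp (L * b) * (L * (b * 0 * K) + L * 0)"
    by (intro tendsto_intros I0 lim_const_over_n)
  show ?thesis
  proof (rule LIM_zero_cancel, rule tendsto_rabs_zero_cancel, rule tendsto_sandwich[OF _ _ tendsto_const])
    show "(\<lambda>r. exp (L * b) * (L * (b * (\<delta> / real r) * K) + L * integral {0..b} (G (\<delta> / real r)))) \<longlonglongrightarrow> 0"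
      using lim by simp
    show "\<forall>\<^sub>F r in sequentially. \<bar>splitting_scheme a (\<delta> / real r) x
      (\<lambda>i. z (real (Suc i) * (\<delta> / real r)) - z (real i * (\<delta> / real r))) (j * r) - f (real j * \<delta>)\<bar>
       \<le> exp (L * b) * (L * (b * (\<delta> / real r) * K) + L * integral {0..b} (G (\<delta> / real r)))"
      using eventually_gt_at_top[of 0]
    proof eventually_elim
      case (elim r)
      have e: "real (j * r) * (\<delta> / real r) = b" using elim by (simp add: b_def)
      have e': "L * (\<delta> / real r) * real (j * r) = L * b" using elim by (simp add: b_def)
      have "0 < \<delta> / real r" "\<delta> / real r \<le> \<delta>" using elim \<delta> by (auto simp: field_simps)
      from step[OF this, of "j * r"] show ?case unfolding e e' by (simp add: b_def)
    qed
  qed simp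
qed

section \<open>Paths with a jump that changes the drift\<close>

text \<open>
  The telescoping sums of the configuration with the large increment moved to the front skip exactly
  the cell between \<open>g i\<close> and \<open>g (Suc i)\<close>.
\<close>

lemma sum_move_back:
  assumes "p \<le> i" "p \<le> k" and w: "\<And>l. w l = g (Suc l) - g l"
  shows "(\<Sum>l\<in>{p<..k}. (w \<circ> move_back p i) l) =
    (if k \<le> i then g k - g p else (g i - g p) + (g (Suc k) - g (Suc i)) :: real)"
  using assms(2)
proof (induction k rule: dec_induct)
  case (step k)
  have "{p<..Suc k} = insert (Suc k) {p<..k}" using step by auto
  then have "(\<Sum>l\<in>{p<..Suc k}. (w \<circ> move_back p i) l) =
    (w \<circ> move_back p i) (Suc k) + (\<Sum>l\<in>{p<..k}. (w \<circ> move_back p i) l)" by simp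
  then show ?case using step assms(1) by (cases "k = i") (auto simp: move_back_def w)
qed (use assms in simp)

lemma eq_increment_bound:
  fixes f z a :: "real \<Rightarrow> real"
  assumes eq: "\<And>t. 0 \<le> t \<Longrightarrow> f t = x + integral {0..t} (\<lambda>s. a (f s)) + z t"
    and int: "\<And>c. (\<lambda>s. a (f s)) integrable_on {0..c}"
    and K: "\<And>s. 0 \<le> s \<Longrightarrow> s \<le> b \<Longrightarrow> \<bar>a (f s)\<bar> \<le> K"
    and uv: "0 \<le> u" "u \<le> v" "v \<le> b"
  shows "\<bar>(z v - z u) - (f v - f u)\<bar> \<le> K * (v - u)"
proof -
  have int_uv: "(\<lambda>s. a (f s)) integrable_on {u..v}"
    by (rule integrable_subinterval_real[OF int[of v]]) (use uv in auto)
  have "integral {0..v} (\<lambda>s. a (f s)) = integral {0..u} (\<lambda>s. a (f s)) + integral {u..v} (\<lambda>s. a (f s))"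
    using Henstock_Kurzweil_Integration.integral_combine[where a = 0 and c = u and b = v and f = "\<lambda>s. a (f s)"]
      int uv by simp
  then have "(z v - z u) - (f v - f u) = - integral {u..v} (\<lambda>s. a (f s))"
    using eq[of u] eq[of v] uv by simp
  moreover have "norm (integral {u..v} (\<lambda>s. a (f s))) \<le> integral {u..v} (\<lambda>_. K)"
    using K uv by (intro integral_norm_bound_integral[OF int_uv]) auto
  ultimately show ?thesis using uv by (simp add: mult.commute)
qed

text \<open>
  The path is close to \<open>fl\<close> shortly before \<open>T\<close> and close to \<open>f T\<close> shortly after it. A cell
  \<open>(j t / k, (j + 1) t / k]\<close> containing \<open>T\<close> and contained in this neighbourhood serves as the window,
  so that the increments of \<open>z\<close> which do not straddle \<open>T\<close> have small partial sums. All parameters can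
  be chosen rational because each of the required inequalities is strict.
\<close>

lemma jump_in_window:
  fixes f z a :: "real \<Rightarrow> real" and x t T L fl :: real
  assumes f: "cadlag f" and lip: "\<And>u v. \<bar>a u - a v\<bar> \<le> L * \<bar>u - v\<bar>" and L: "0 \<le> L"
    and eq: "\<And>t. 0 \<le> t \<Longrightarrow> f t = x + integral {0..t} (\<lambda>s. a (f s)) + z t"
    and z0: "z 0 = 0" and T: "0 < T" "T < t"
    and fl: "(f \<longlongrightarrow> fl) (at_left T)" and jump: "a fl \<noteq> a (f T)"
  shows "\<exists>(k::nat) (j::nat) (\<rho>::rat) (J::rat) (\<epsilon>::rat) (K::nat) (c::rat) (b::bool).
    j < k \<and> 0 < c \<and> t / real k * real K \<le> real_of_rat \<epsilon> \<and> 3 * real_of_rat \<epsilon> < \<bar>real_of_rat J\<bar> \<and>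
    drift_separated a (real_of_rat \<rho>) (real_of_rat J) (real_of_rat \<epsilon>) (if b then 1 else - 1) (real_of_rat c) \<and>
    (\<forall>u. \<bar>u - real_of_rat \<rho>\<bar> \<le> 3 * real_of_rat \<epsilon> \<longrightarrow> \<bar>a u\<bar> \<le> real K) \<and>
    (\<forall>\<^sub>F r in sequentially. one_big_jump a (t / real k / real r) x (j * r) r
      (real_of_rat \<rho>) (real_of_rat J) (real_of_rat \<epsilon>)
      (\<lambda>i. z (real (Suc i) * (t / real k / real r)) - z (real i * (t / real k / real r))))"
proof -
  have cont: "continuous_on UNIV a" using lip L by (rule lipschitz_continuous)
  have int: "(\<lambda>s. a (f s)) integrable_on {0..c}" for c
    by (rule set_borel_integral_eq_integral(1)[OF cadlag_set_integrable[OF f cont]])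
  define D where "D = \<bar>a fl - a (f T)\<bar>"
  define J' where "J' = f T - fl"
  have D: "0 < D" using jump by (simp add: D_def)
  have J': "0 < \<bar>J'\<bar>" using jump by (auto simp: J'_def)
  define b where "b = (a (f T) < a fl)"
  define s where "s = (if b then 1 else - 1 :: real)"
  have sD: "s * (a fl - a (f T)) = D" using jump by (auto simp: s_def b_def D_def)
  have s1: "\<bar>s\<bar> = 1" by (simp add: s_def)
  obtain \<epsilon>' where \<epsilon>': "0 < real_of_rat \<epsilon>'" "real_of_rat \<epsilon>' < min (D / (20 * (L + 1))) (\<bar>J'\<bar> / 8)"
    using of_rat_dense[of 0 "min (D / (20 * (L + 1))) (\<bar>J'\<bar> / 8)"] D J' L by auto
  define \<epsilon> where "\<epsilon> = real_of_rat \<epsilon>'"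
  have \<epsilon>: "0 < \<epsilon>" "8 * \<epsilon> < \<bar>J'\<bar>" "10 * L * \<epsilon> \<le> D / 2"
  proof -
    have e: "0 < \<epsilon>" "\<epsilon> < D / (20 * (L + 1))" "\<epsilon> < \<bar>J'\<bar> / 8"
      using \<epsilon>' unfolding \<epsilon>_def by simp_all
    then have "\<epsilon> * (20 * (L + 1)) < D" using L by (simp add: pos_less_divide_eq)
    then show "0 < \<epsilon>" "8 * \<epsilon> < \<bar>J'\<bar>" "10 * L * \<epsilon> \<le> D / 2"
      using e by (auto simp: algebra_simps)
  qed
  obtain \<rho>' where \<rho>': "fl - \<epsilon> / 4 < real_of_rat \<rho>'" "real_of_rat \<rho>' < fl + \<epsilon> / 4"
    using of_rat_dense[of "fl - \<epsilon> / 4" "fl + \<epsilon> / 4"] \<epsilon> by auto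
  define \<rho> where "\<rho> = real_of_rat \<rho>'"
  have \<rho>: "\<bar>\<rho> - fl\<bar> < \<epsilon> / 4" using \<rho>' unfolding \<rho>_def by linarith
  obtain J'' where J'': "J' - \<epsilon> / 4 < real_of_rat J''" "real_of_rat J'' < J' + \<epsilon> / 4"
    using of_rat_dense[of "J' - \<epsilon> / 4" "J' + \<epsilon> / 4"] \<epsilon> by auto
  define J where "J = real_of_rat J''"
  have J: "\<bar>J - J'\<bar> < \<epsilon> / 4" using J'' unfolding J_def by linarith
  obtain c' where c': "0 < real_of_rat c'" "real_of_rat c' < D / 2"
    using of_rat_dense[of 0 "D / 2"] D by auto
  have sep: "drift_separated a \<rho> J \<epsilon> s (real_of_rat c')"
    unfolding drift_separated_def
  proof (intro allI impI)
    fix u v assume uv: "\<bar>u - \<rho>\<bar> \<le> 4 * \<epsilon>" "\<bar>v - (\<rho> + J)\<bar> \<le> 4 * \<epsilon>"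
    have "\<bar>a u - a fl\<bar> \<le> L * (5 * \<epsilon>)"
      using uv \<rho> \<epsilon> L by (intro order_trans[OF lip mult_left_mono]) linarith+
    moreover have "\<bar>v - f T\<bar> \<le> 5 * \<epsilon>" using uv \<rho> J unfolding J'_def by linarith
    then have "\<bar>a v - a (f T)\<bar> \<le> L * (5 * \<epsilon>)"
      using L by (intro order_trans[OF lip mult_left_mono])
    ultimately have "\<bar>(a u - a v) - (a fl - a (f T))\<bar> \<le> L * (5 * \<epsilon>) + L * (5 * \<epsilon>)"
      by linarith
    then have "\<bar>s * ((a u - a v) - (a fl - a (f T)))\<bar> \<le> 10 * L * \<epsilon>"
      unfolding abs_mult s1 by simp
    then show "real_of_rat c' \<le> s * (a u - a v)"
      using sD \<epsilon>(3) c' by (simp add: algebra_simps)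
  qed
  obtain C where C: "0 \<le> C" "\<And>s. 0 \<le> s \<Longrightarrow> s \<le> t \<Longrightarrow> \<bar>f s\<bar> \<le> C" using cadlag_bounded[OF f] by metis
  obtain K :: nat where K: "1 + \<bar>a 0\<bar> + L * (\<bar>\<rho>\<bar> + 3 * \<epsilon>) + L * C \<le> real K" using real_arch_simple by blast
  have nonneg: "0 \<le> L * C" "0 \<le> L * (\<bar>\<rho>\<bar> + 3 * \<epsilon>)" using L C \<epsilon> by auto
  have K1: "1 \<le> real K" using K nonneg by linarith
  have bound: "\<bar>a u\<bar> \<le> real K" if "\<bar>u - \<rho>\<bar> \<le> 3 * \<epsilon>" for u
  proof -
    have "\<bar>a u\<bar> \<le> \<bar>a 0\<bar> + L * \<bar>u\<bar>" using lip[of u 0] by simp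
    also have "L * \<bar>u\<bar> \<le> L * (\<bar>\<rho>\<bar> + 3 * \<epsilon>)" using that L by (intro mult_left_mono) linarith+
    finally show ?thesis using K nonneg by linarith
  qed
  have boundf: "\<bar>a (f s)\<bar> \<le> real K" if "0 \<le> s" "s \<le> t" for s
  proof -
    have "\<bar>a (f s)\<bar> \<le> \<bar>a 0\<bar> + L * \<bar>f s\<bar>" using lip[of "f s" 0] by simp
    also have "L * \<bar>f s\<bar> \<le> L * C" using that L C by (intro mult_left_mono) auto
    finally show ?thesis using K nonneg by linarith
  qed
  obtain d1 where d1: "0 < d1" "\<And>s. T - d1 < s \<Longrightarrow> s < T \<Longrightarrow> \<bar>f s - fl\<bar> < \<epsilon> / 8"
    using left_limit_close[OF fl, of "\<epsilon> / 8"] \<epsilon> by auto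
  obtain d2 where d2: "0 < d2" "\<And>s. T \<le> s \<Longrightarrow> s < T + d2 \<Longrightarrow> \<bar>f s - f T\<bar> < \<epsilon> / 8"
    using cadlag_right_close[OF f, of T "\<epsilon> / 8"] \<epsilon> T by auto
  obtain k :: nat where k: "0 < k" "t / real k < min (min d1 d2) (\<epsilon> / (8 * real K))"
  proof -
    let ?e = "min (min d1 d2) (\<epsilon> / (8 * real K))"
    have e: "0 < ?e" using d1 d2 \<epsilon> K1 by simp
    obtain k :: nat where k: "t / ?e < real k" using reals_Archimedean2 by blast
    moreover have "0 < t / ?e" using e T by simp
    ultimately have k0: "0 < real k" by linarith
    have "t / real k < ?e" using k k0 e by (metis divide_less_eq mult.commute)
    then show ?thesis using k0 by (intro that[of k]) auto
  qed
  define \<delta> where "\<delta> = t / real k"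
  have \<delta>: "0 < \<delta>" "\<delta> < d1" "\<delta> < d2" "real K * \<delta> \<le> \<epsilon> / 8"
    using k T K1 by (auto simp: \<delta>_def field_simps)
  \<comment> \<open>The cell is open on the left and closed on the right, so that a jump at a grid point belongs to
    the increment ending there.\<close>
  define j where "j = nat (\<lceil>T / \<delta>\<rceil> - 1)"
  have "0 < T / \<delta>" using T \<delta> by simp
  then have "0 < \<lceil>T / \<delta>\<rceil>" by simp
  then have "real j = of_int \<lceil>T / \<delta>\<rceil> - 1" by (simp add: j_def)
  then have "real j < T / \<delta>" "T / \<delta> \<le> real j + 1" by linarith+
  then have j: "real j * \<delta> < T" "T \<le> (real j + 1) * \<delta>" using \<delta> by (auto simp: field_simps)
  have jk: "j < k"
  proof -
    have "real j * \<delta> < real k * \<delta>" using j(1) T k by (simp add: \<delta>_def)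
    then show ?thesis using \<delta> by simp
  qed
  have top: "(real j + 1) * \<delta> \<le> t"
  proof -
    have "(real j + 1) * \<delta> \<le> real k * \<delta>" using jk \<delta> by (intro mult_right_mono) auto
    then show ?thesis using k by (simp add: \<delta>_def)
  qed
  have ev: "\<forall>\<^sub>F r in sequentially. one_big_jump a (\<delta> / real r) x (j * r) r \<rho> J \<epsilon>
      (\<lambda>i. z (real (Suc i) * (\<delta> / real r)) - z (real i * (\<delta> / real r)))"
  proof -
    have fj: "\<bar>f (real j * \<delta>) - fl\<bar> < \<epsilon> / 8" using d1(2)[of "real j * \<delta>"] j \<delta> by (auto simp: algebra_simps)
    have "(\<lambda>r. splitting_scheme a (\<delta> / real r) x
        (\<lambda>i. z (real (Suc i) * (\<delta> / real r)) - z (real i * (\<delta> / real r))) (j * r)) \<longlonglongrightarrow> f (real j * \<delta>)"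
      using f lip L eq z0 \<delta>(1) by (rule scheme_tendsto)
    then have "\<forall>\<^sub>F r in sequentially. dist (splitting_scheme a (\<delta> / real r) x
        (\<lambda>i. z (real (Suc i) * (\<delta> / real r)) - z (real i * (\<delta> / real r))) (j * r)) (f (real j * \<delta>)) < \<epsilon> / 8"
      by (rule tendstoD) (use \<epsilon> in simp)
    then show ?thesis using eventually_gt_at_top[of 0]
    proof eventually_elim
      case (elim r)
      define h where "h = \<delta> / real r"
      define g where "g l = z (real l * h)" for l :: nat
      define w where "w l = g (Suc l) - g l" for l
      define p where "p = j * r"
      have h: "0 < h" using elim \<delta> by (simp add: h_def)
      have ph: "real p * h = real j * \<delta>" and prh: "real (p + r) * h = (real j + 1) * \<delta>"
        using elim by (auto simp: p_def h_def field_simps)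
      define i where "i = nat (\<lceil>T / h\<rceil> - 1)"
      have "0 < T / h" using T h by simp
      then have "0 < \<lceil>T / h\<rceil>" by simp
      then have "real i = of_int \<lceil>T / h\<rceil> - 1" by (simp add: i_def)
      then have "real i < T / h" "T / h \<le> real i + 1" by linarith+
      then have i: "real i * h < T" "T \<le> real (Suc i) * h" using h by (auto simp: field_simps)
      have "real p * h < real (Suc i) * h" using ph j i by linarith
      then have pi: "p \<le> i" using h by simp
      have "real i * h < real (p + r) * h" using prh j i by linarith
      then have ipr: "i < p + r" using h by (metis mult_less_cancel_right_pos of_nat_less_iff)
      have mono: "real l * h \<le> real l' * h" if "l \<le> l'" for l l' :: nat
        using that h by (intro mult_right_mono) auto
      have before: "\<bar>f (real l * h) - fl\<bar> < \<epsilon> / 8" if "p \<le> l" "l \<le> i" for l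
      proof (rule d1(2))
        show "real l * h < T" using mono[OF that(2)] i by linarith
        show "T - d1 < real l * h" using mono[OF that(1)] ph j \<delta> by (simp add: algebra_simps)
      qed
      have after: "\<bar>f (real l * h) - f T\<bar> < \<epsilon> / 8" if "i < l" "l \<le> p + r" for l
      proof (rule d2(2))
        show "T \<le> real l * h" using mono[OF Suc_leI[OF that(1)]] i by linarith
        show "real l * h < T + d2" using mono[OF that(2)] prh j \<delta> by (simp add: algebra_simps)
      qed
      have gf: "\<bar>(g l' - g l) - (f (real l' * h) - f (real l * h))\<bar> \<le> \<epsilon> / 8"
        if "p \<le> l" "l \<le> l'" "l' \<le> p + r" for l l'
      proof -
        have "\<bar>(g l' - g l) - (f (real l' * h) - f (real l * h))\<bar> \<le> real K * (real l' * h - real l * h)"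
          unfolding g_def
        proof (rule eq_increment_bound[OF eq int boundf])
          show "0 \<le> real l * h" using h by simp
          show "real l * h \<le> real l' * h" using mono[OF that(2)] .
          show "real l' * h \<le> t" using mono[OF that(3)] prh top by linarith
        qed
        also have "\<dots> \<le> real K * \<delta>"
          using mono[OF that(1)] mono[OF that(3)] ph prh by (intro mult_left_mono) (auto simp: algebra_simps)
        finally show ?thesis using \<delta> by linarith
      qed
      have "big_jump_first a h x p r \<rho> J \<epsilon> (w \<circ> move_back p i)"
        unfolding big_jump_first_def
      proof (intro conjI ballI)
        have "splitting_scheme a h x (w \<circ> move_back p i) p = splitting_scheme a h x w p"
          by (rule splitting_scheme_cong) (auto simp: move_back_def)
        moreover have "\<bar>splitting_scheme a h x w p - f (real j * \<delta>)\<bar> < \<epsilon> / 8"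
          using elim(1) unfolding w_def g_def h_def p_def dist_real_def .
        ultimately show "\<bar>splitting_scheme a h x (w \<circ> move_back p i) p - \<rho>\<bar> \<le> \<epsilon>"
          using fj \<rho> \<epsilon> by linarith
        show "\<bar>(w \<circ> move_back p i) p - J\<bar> \<le> \<epsilon>"
        proof -
          have "(w \<circ> move_back p i) p = g (Suc i) - g i" by (simp add: move_back_def w_def)
          then show ?thesis
            using gf[OF pi _ Suc_leI[OF ipr]] before[OF pi order_refl] after[OF lessI Suc_leI[OF ipr]] J \<epsilon>(1)
            unfolding J'_def by linarith
        qed
        fix l assume l: "l \<in> {p<..<p + r}"
        have g_before: "\<bar>g l' - g p\<bar> \<le> 3 * \<epsilon> / 8" if "p \<le> l'" "l' \<le> i" for l'
        proof -
          have "l' \<le> p + r" using that ipr by simp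
          then show ?thesis using gf[OF order_refl that(1)] before[OF order_refl pi] before[OF that] by linarith
        qed
        have g_after: "\<bar>g l' - g (Suc i)\<bar> \<le> 3 * \<epsilon> / 8" if "i < l'" "l' \<le> p + r" for l'
          using gf[OF _ Suc_leI[OF that(1)] that(2)] after[OF lessI Suc_leI[OF ipr]] after[OF that] pi
          by linarith
        have "(\<Sum>l\<in>{p<..l}. (w \<circ> move_back p i) l) =
          (if l \<le> i then g l - g p else (g i - g p) + (g (Suc l) - g (Suc i)))"
          using l by (intro sum_move_back pi) (auto simp: w_def)
        moreover have "\<bar>g l - g p\<bar> \<le> 3 * \<epsilon> / 8" if "l \<le> i" using l that by (intro g_before) auto
        moreover have "\<bar>g (Suc l) - g (Suc i)\<bar> \<le> 3 * \<epsilon> / 8" if "\<not> l \<le> i"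
          using l that by (intro g_after) auto
        moreover note g_before[OF pi order_refl]
        ultimately show "\<bar>\<Sum>l\<in>{p<..l}. (w \<circ> move_back p i) l\<bar> \<le> \<epsilon>"
          using \<epsilon>(1) by (cases "l \<le> i"; simp only: if_True if_False; linarith)
      qed
      then have "one_big_jump a h x p r \<rho> J \<epsilon> w"
        unfolding one_big_jump_def using pi ipr by (intro bexI[of _ i]) auto
      then show ?case unfolding w_def g_def h_def p_def .
    qed
  qed
  have "t / real k * real K \<le> \<epsilon>"
    using \<delta>(4) \<epsilon>(1) unfolding \<delta>_def mult.commute[of "real K"] by linarith
  moreover have "3 * \<epsilon> < \<bar>J\<bar>" using \<epsilon> J by linarith
  moreover have "0 < c'" using c' by simp
  ultimately show ?thesis
    using jk sep bound ev unfolding \<epsilon>_def \<rho>_def J_def \<delta>_def s_def by blast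
qed

section \<open>Paths along which the drift never jumps\<close>

text \<open>
  Sard's theorem in dimension one. An interval of length \<open>l\<close> that contains a critical point and is so
  short that \<open>a'\<close> varies by less than \<open>\<eta>\<close> on it is mapped into an interval of length
  \<open>2 \<eta> l\<close>.
\<close>

lemma negligible_critical_values:
  fixes a :: "real \<Rightarrow> real"
  assumes a: "\<And>u. (a has_real_derivative a' u) (at u)" and a': "continuous_on UNIV a'"
  shows "negligible (a ` {u. a' u = 0})"
proof -
  have bounded: "negligible (a ` {u\<in>{-real N..real N}. a' u = 0})" for N :: nat
  proof (rule negligible_outer_le[THEN iffD2], intro allI impI)
    fix e :: real assume e: "0 < e"
    define R where "R = real N + 1"
    have R: "0 < R" by (simp add: R_def)
    define \<eta> where "\<eta> = e / (4 * R)"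
    have \<eta>: "0 < \<eta>" using e R by (simp add: \<eta>_def)
    have "uniformly_continuous_on {-R..R} a'"
      using a' by (intro compact_uniformly_continuous) (auto intro: continuous_on_subset)
    then obtain d where d: "0 < d" "\<And>u v. u \<in> {-R..R} \<Longrightarrow> v \<in> {-R..R} \<Longrightarrow> dist v u < d \<Longrightarrow> dist (a' v) (a' u) < \<eta>"
      using \<eta> unfolding uniformly_continuous_on_def by metis
    obtain m :: nat where m: "2 * R / d < real m" using reals_Archimedean2 by blast
    have "0 < 2 * R / d" using R d by simp
    then have m0: "0 < real m" using m by linarith
    define l where "l = 2 * R / real m"
    have l: "0 < l" "l < d" "real m * l = 2 * R"
    proof -
      have "2 * R < d * real m" using m d(1) by (simp add: pos_divide_less_eq mult.commute)
      then show "0 < l" "l < d" "real m * l = 2 * R"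
        using R m0 by (simp_all add: l_def pos_divide_less_eq)
    qed
    define I where "I i = {- R + real i * l..- R + real (Suc i) * l}" for i
    have I_sub: "I i \<subseteq> {-R..R}" if "i < m" for i
    proof -
      have "real (Suc i) * l \<le> real m * l" using that l by (intro mult_right_mono) auto
      then have "- R + real (Suc i) * l \<le> R" using l(3) by linarith
      moreover have "- R \<le> - R + real i * l" using l(1) by simp
      ultimately show ?thesis unfolding I_def by (simp only: atLeastatMost_subset_iff simp_thms)
    qed
    define c where "c i = (SOME u. u \<in> I i \<and> a' u = 0)" for i
    define T where "T i = {a (c i) - \<eta> * l..a (c i) + \<eta> * l}" for i
    have cover: "a u \<in> T i" if "i < m" "u \<in> I i" "a' u = 0" for i u
    proof -
      have c: "c i \<in> I i \<and> a' (c i) = 0" unfolding c_def by (rule someI[of _ u]) (use that in simp)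
      have len: "\<bar>v - v'\<bar> \<le> l" if "v \<in> I i" "v' \<in> I i" for v v'
        using that by (auto simp: I_def abs_le_iff algebra_simps)
      have small: "norm (a' v) \<le> \<eta>" if "v \<in> I i" for v
      proof -
        have "dist (a' v) (a' (c i)) < \<eta>"
        proof (rule d(2))
          show "c i \<in> {-R..R}" "v \<in> {-R..R}" using c that I_sub[OF \<open>i < m\<close>] by blast+
          show "dist v (c i) < d" using len[OF that, of "c i"] c l by (auto simp: dist_real_def)
        qed
        then show ?thesis using c by (simp add: dist_real_def)
      qed
      have "norm (a u - a (c i)) \<le> \<eta> * norm (u - c i)"
      proof (rule field_differentiable_bound[of "I i" a a'])
        show "convex (I i)" by (simp add: I_def)
        show "(a has_field_derivative a' v) (at v within I i)" for v
          using a by (rule has_field_derivative_at_within)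
      qed (use small c that in auto)
      also have "\<dots> \<le> \<eta> * l" using len[of u "c i"] that c \<eta> by (intro mult_left_mono) auto
      finally show ?thesis by (auto simp: T_def abs_le_iff)
    qed
    have sub: "a ` {u\<in>{-real N..real N}. a' u = 0} \<subseteq> (\<Union>i\<in>{..<m}. T i)"
    proof
      fix y assume "y \<in> a ` {u\<in>{-real N..real N}. a' u = 0}"
      then obtain u where u: "y = a u" "- real N \<le> u" "u \<le> real N" "a' u = 0" by auto
      define i where "i = nat \<lfloor>(u + R) / l\<rfloor>"
      have "0 \<le> (u + R) / l" using u l by (simp add: R_def)
      then have "real i = of_int \<lfloor>(u + R) / l\<rfloor>" by (simp add: i_def)
      then have "real i \<le> (u + R) / l" "(u + R) / l < real i + 1" by linarith+
      then have i: "real i * l \<le> u + R" "u + R < real (Suc i) * l" using l by (auto simp: field_simps)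
      have "real i * l < real m * l" using i(1) l(3) u by (simp add: R_def)
      then have "i < m" using l(1) by simp
      moreover have "u \<in> I i" using i by (simp add: I_def)
      ultimately show "y \<in> (\<Union>i\<in>{..<m}. T i)" using cover u by blast
    qed
    have meas: "measure lebesgue (\<Union>i\<in>{..<m}. T i) \<le> e"
    proof -
      have "measure lebesgue (\<Union>i\<in>{..<m}. T i) \<le> (\<Sum>i<m. measure lebesgue (T i))"
        by (intro measure_UNION_le) (auto simp: T_def)
      also have "\<dots> = (\<Sum>i<m. 2 * \<eta> * l)" using \<eta> l by (intro sum.cong) (auto simp: T_def)
      also have "\<dots> = 2 * \<eta> * (real m * l)" by simp
      also have "\<dots> = e" unfolding l(3) \<eta>_def using R by (simp add: field_simps)
      finally show ?thesis by simp
    qed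
    show "\<exists>T. a ` {u\<in>{-real N..real N}. a' u = 0} \<subseteq> T \<and> T \<in> lmeasurable \<and> measure lebesgue T \<le> e"
    proof (intro exI conjI)
      show "(\<Union>i\<in>{..<m}. T i) \<in> lmeasurable"
        by (intro fmeasurable.finite_UN) (auto simp: T_def)
    qed (use sub meas in auto)
  qed
  have eq: "a ` {u. a' u = 0} = (\<Union>N::nat. a ` {u\<in>{-real N..real N}. a' u = 0})"
  proof -
    have "\<exists>N::nat. u \<in> {-real N..real N}" for u :: real
    proof -
      obtain N :: nat where "\<bar>u\<bar> \<le> real N" using real_arch_simple by blast
      then show ?thesis by (intro exI[of _ N]) auto
    qed
    then show ?thesis by blast
  qed
  show ?thesis
    unfolding eq by (rule negligible_countable_Union) (use bounded in auto)
qed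

text \<open>
  A measurable consequence of the continuity of \<open>z\<close> on the cell \<open>[j \<delta>, (j + 1) \<delta>]\<close>: the
  increments over its equidistant partitions become uniformly small.
\<close>

definition small_oscillation :: "(real \<Rightarrow> real) \<Rightarrow> real \<Rightarrow> nat \<Rightarrow> bool" where
  "small_oscillation z \<delta> j \<longleftrightarrow> (\<forall>l::nat. \<forall>\<^sub>F n in sequentially. \<forall>i<n.
     \<bar>z (real j * \<delta> + real (Suc i) * (\<delta> / real n)) - z (real j * \<delta> + real i * (\<delta> / real n))\<bar>
       \<le> 1 / real (Suc l))"

lemma continuous_small_oscillation:
  assumes z: "continuous_on {real j * \<delta>..real (Suc j) * \<delta>} z" and \<delta>: "0 < \<delta>"
  shows "small_oscillation z \<delta> j"
  unfolding small_oscillation_def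
proof
  fix l :: nat
  let ?I = "{real j * \<delta>..real (Suc j) * \<delta>}"
  have "uniformly_continuous_on ?I z"
    using z by (intro compact_uniformly_continuous) auto
  moreover have "0 < 1 / real (Suc l)" by simp
  ultimately obtain d where d: "0 < d" "\<And>u v. u \<in> ?I \<Longrightarrow> v \<in> ?I \<Longrightarrow> dist v u < d \<Longrightarrow> dist (z v) (z u) < 1 / real (Suc l)"
    unfolding uniformly_continuous_on_def by blast
  have "(\<lambda>n. \<delta> / real n) \<longlonglongrightarrow> 0" by (rule lim_const_over_n)
  then have "\<forall>\<^sub>F n in sequentially. \<delta> / real n < d" using d(1) by (rule order_tendstoD)
  then show "\<forall>\<^sub>F n in sequentially. \<forall>i<n.
     \<bar>z (real j * \<delta> + real (Suc i) * (\<delta> / real n)) - z (real j * \<delta> + real i * (\<delta> / real n))\<bar>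
       \<le> 1 / real (Suc l)"
  proof (eventually_elim, intro allI impI)
    fix n i :: nat assume n: "\<delta> / real n < d" "i < n"
    have mem: "real j * \<delta> + real i' * (\<delta> / real n) \<in> ?I" if "i' \<le> n" for i'
    proof -
      have "real i' * (\<delta> / real n) \<le> real n * (\<delta> / real n)" using that \<delta> by (intro mult_right_mono) auto
      moreover have "real n * (\<delta> / real n) = \<delta>" using n by simp
      moreover have "0 \<le> real i' * (\<delta> / real n)" using \<delta> by simp
      moreover have "real (Suc j) * \<delta> = real j * \<delta> + \<delta>" by (simp add: distrib_right)
      ultimately show ?thesis unfolding atLeastAtMost_iff by linarith
    qed
    have "dist (z (real j * \<delta> + real (Suc i) * (\<delta> / real n))) (z (real j * \<delta> + real i * (\<delta> / real n))) < 1 / real (Suc l)"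
    proof (rule d(2)[OF mem mem])
      show "dist (real j * \<delta> + real (Suc i) * (\<delta> / real n)) (real j * \<delta> + real i * (\<delta> / real n)) < d"
      proof -
        have gen: "dist (c + real (Suc i) * q) (c + real i * q) = \<bar>q\<bar>" for c q :: real
          by (simp add: dist_real_def algebra_simps)
        show ?thesis unfolding gen using n \<delta> by simp
      qed
    qed (use n in auto)
    then show "\<bar>z (real j * \<delta> + real (Suc i) * (\<delta> / real n)) - z (real j * \<delta> + real i * (\<delta> / real n))\<bar>
       \<le> 1 / real (Suc l)" by (simp add: dist_real_def)
  qed
qed

text \<open>
  If \<open>a' (f s) \<noteq> 0\<close>, then \<open>a\<close> is injective on a neighbourhood in which \<open>f\<close> stays for a short time
  after \<open>s\<close>. There the absence of jumps of \<open>a \<circ> f\<close> is the absence of jumps of \<open>f\<close>, and \<open>z\<close> is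
  continuous as well.
\<close>

lemma critical_along_path:
  fixes f z a a' :: "real \<Rightarrow> real"
  assumes f: "cadlag f" and a: "\<And>u. (a has_real_derivative a' u) (at u)" and a': "continuous_on UNIV a'"
    and eq: "\<And>t. 0 \<le> t \<Longrightarrow> f t = x + integral {0..t} (\<lambda>s. a (f s)) + z t"
    and no_jump: "\<And>T l. 0 < T \<Longrightarrow> T < t \<Longrightarrow> (f \<longlongrightarrow> l) (at_left T) \<Longrightarrow> a l = a (f T)"
    and osc: "\<And>k j. j < k \<Longrightarrow> \<not> small_oscillation z (t / real k) j"
    and s: "0 \<le> s" "s < t"
  shows "a' (f s) = 0"
proof (rule ccontr)
  assume nz: "a' (f s) \<noteq> 0"
  have cont: "continuous_on UNIV a"
    using a by (intro continuous_at_imp_continuous_on) (auto intro: DERIV_isCont)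
  have int: "(\<lambda>s. a (f s)) integrable_on {0..c}" for c
    by (rule set_borel_integral_eq_integral(1)[OF cadlag_set_integrable[OF f cont]])
  obtain e where e: "0 < e" "\<And>u. \<bar>u - f s\<bar> < e \<Longrightarrow> a' u \<noteq> 0"
  proof -
    have "continuous (at (f s)) a'" using a' by (simp add: continuous_on_eq_continuous_at)
    then show ?thesis using continuous_at_avoid[of "f s" a' 0] nz that by (auto simp: dist_real_def abs_minus_commute)
  qed
  have inj: "u = v" if uv: "\<bar>u - f s\<bar> < e" "\<bar>v - f s\<bar> < e" "a u = a v" for u v
  proof (rule ccontr)
    assume "u \<noteq> v"
    have Rolle': "\<exists>w. u < w \<and> w < v \<and> a' w = 0" if "u < v" "a u = a v" for u v
    proof -
      have "\<exists>w>u. w < v \<and> DERIV a w :> 0"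
        using that a cont
        by (intro Rolle) (auto intro: continuous_on_subset simp: real_differentiable_def)
      then show ?thesis using a DERIV_unique by blast
    qed
    show False
    proof (cases "u < v")
      case True
      then obtain w where "u < w" "w < v" "a' w = 0" using Rolle' uv by blast
      then show False using e(2)[of w] uv by auto
    next
      case False
      then obtain w where "v < w" "w < u" "a' w = 0" using Rolle'[of v u] uv \<open>u \<noteq> v\<close> by auto
      then show False using e(2)[of w] uv by auto
    qed
  qed
  obtain d where d: "0 < d" "\<And>y. s \<le> y \<Longrightarrow> y < s + d \<Longrightarrow> \<bar>f y - f s\<bar> < e / 2"
    using cadlag_right_close[OF f s(1), of "e / 2"] e by auto
  define b where "b = min t (s + d)"
  have b: "s < b" "b \<le> t" "b \<le> s + d" using s d by (auto simp: b_def)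
  have f_cont: "isCont f T" if T: "s < T" "T < b" for T
  proof -
    have T0: "0 < T" using T s by simp
    obtain l where l: "(f \<longlongrightarrow> l) (at_left T)" using cadlag_left_limit[OF f T0] .
    have "\<bar>l - f s\<bar> \<le> e / 2"
    proof (rule tendsto_upperbound)
      show "((\<lambda>y. \<bar>f y - f s\<bar>) \<longlongrightarrow> \<bar>l - f s\<bar>) (at_left T)" by (intro tendsto_intros l)
      show "\<forall>\<^sub>F y in at_left T. \<bar>f y - f s\<bar> \<le> e / 2"
        using T b d(2) by (force simp: eventually_at_left_field intro!: exI[of _ s] less_imp_le)
    qed simp
    moreover have "\<bar>f T - f s\<bar> < e" using d(2)[of T] T b e by simp
    moreover have "a l = a (f T)" using no_jump[OF T0 _ l] T b by simp
    ultimately have "l = f T" using inj[of l "f T"] e by simp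
    moreover have "(f \<longlongrightarrow> f T) (at_right T)" using f T0 by (simp add: cadlag_def)
    ultimately show ?thesis using l by (simp add: isCont_def filterlim_at_split)
  qed
  define k :: nat where "k = Suc (nat \<lceil>3 * t / (b - s)\<rceil>)"
  define \<delta> where "\<delta> = t / real k"
  have k: "3 * t / (b - s) < real k" unfolding k_def by linarith
  have t0: "0 < t" using s by simp
  have k0: "0 < real k" by (simp add: k_def)
  have \<delta>: "0 < \<delta>" "3 * \<delta> < b - s"
  proof -
    have "3 * t < real k * (b - s)" using k b by (simp add: pos_divide_less_eq)
    then have "3 * t / real k < b - s" using k0 by (simp add: pos_divide_less_eq mult.commute)
    then show "0 < \<delta>" "3 * \<delta> < b - s" using t0 k0 by (simp_all add: \<delta>_def)
  qed
  define j where "j = Suc (nat \<lfloor>s / \<delta>\<rfloor>)"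
  have "real j = of_int \<lfloor>s / \<delta>\<rfloor> + 1" using s \<delta> by (simp add: j_def)
  then have "s / \<delta> < real j" "real j \<le> s / \<delta> + 1" by linarith+
  then have j: "s < real j * \<delta>" "real j * \<delta> \<le> s + \<delta>" using \<delta> by (auto simp: field_simps)
  have j': "real (Suc j) * \<delta> < b" using j \<delta> by (simp add: algebra_simps)
  then have "real (Suc j) * \<delta> < real k * \<delta>" using b by (simp add: \<delta>_def k_def)
  then have "j < k" using \<delta> by simp
  have "continuous_on {real j * \<delta>..real (Suc j) * \<delta>} (\<lambda>u. f u - x - integral {0..u} (\<lambda>s. a (f s)))"
  proof (intro continuous_intros)
    show "continuous_on {real j * \<delta>..real (Suc j) * \<delta>} f"
      using f_cont j j' by (intro continuous_at_imp_continuous_on) auto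
    have "continuous_on {0..real (Suc j) * \<delta>} (\<lambda>u. integral {0..u} (\<lambda>s. a (f s)))"
      by (rule indefinite_integral_continuous_1[OF int])
    then show "continuous_on {real j * \<delta>..real (Suc j) * \<delta>} (\<lambda>u. integral {0..u} (\<lambda>s. a (f s)))"
      by (rule continuous_on_subset) (use \<delta> in auto)
  qed
  then have "continuous_on {real j * \<delta>..real (Suc j) * \<delta>} z"
  proof (rule continuous_on_eq)
    fix u assume "u \<in> {real j * \<delta>..real (Suc j) * \<delta>}"
    then have "0 \<le> u" using \<delta> j s by auto
    then show "f u - x - integral {0..u} (\<lambda>s. a (f s)) = z u" using eq[of u] by simp
  qed
  then have "small_oscillation z \<delta> j" using \<delta>(1) by (rule continuous_small_oscillation)
  then show False using osc[OF \<open>j < k\<close>] by (simp add: \<delta>_def)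
qed

text \<open>
  The image of \<open>a \<circ> f\<close> is a connected subset of the null set of critical values, hence a point.
\<close>

lemma drift_constant:
  fixes f z a a' :: "real \<Rightarrow> real"
  assumes f: "cadlag f" and a: "\<And>u. (a has_real_derivative a' u) (at u)" and a': "continuous_on UNIV a'"
    and eq: "\<And>t. 0 \<le> t \<Longrightarrow> f t = x + integral {0..t} (\<lambda>s. a (f s)) + z t"
    and no_jump: "\<And>T l. 0 < T \<Longrightarrow> T < t \<Longrightarrow> (f \<longlongrightarrow> l) (at_left T) \<Longrightarrow> a l = a (f T)"
    and osc: "\<And>k j. j < k \<Longrightarrow> \<not> small_oscillation z (t / real k) j"
    and s: "0 \<le> s" "s < t"
  shows "a (f s) = a (f 0)"
proof -
  have acont: "isCont a u" for u using a by (rule DERIV_isCont)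
  have right: "((\<lambda>y. a (f y)) \<longlongrightarrow> a (f T)) (at_right T)" if "0 \<le> T" for T
    using f that by (intro isCont_tendsto_compose[OF acont]) (simp add: cadlag_def)
  have left: "((\<lambda>y. a (f y)) \<longlongrightarrow> a (f T)) (at_left T)" if T: "0 < T" "T < t" for T
  proof -
    obtain l where l: "(f \<longlongrightarrow> l) (at_left T)" using cadlag_left_limit[OF f T(1)] .
    then show ?thesis
      using isCont_tendsto_compose[OF acont l] no_jump[OF T l] by simp
  qed
  have "continuous_on {0..<t} (\<lambda>y. a (f y))"
    unfolding continuous_on_def
  proof
    fix T assume T: "T \<in> {0..<t}"
    show "((\<lambda>y. a (f y)) \<longlongrightarrow> a (f T)) (at T within {0..<t})"
    proof (cases "T = 0")
      case True
      have "at 0 within {0..<t} \<le> at_right (0::real)"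
        unfolding at_within_def by (intro inf_mono) auto
      then show ?thesis using right[of 0] True by (auto intro: tendsto_mono)
    next
      case False
      then have "((\<lambda>y. a (f y)) \<longlongrightarrow> a (f T)) (at T)"
        using left[of T] right[of T] T by (simp add: filterlim_at_split)
      then show ?thesis by (rule tendsto_within_subset) simp
    qed
  qed
  then have conn: "connected ((\<lambda>y. a (f y)) ` {0..<t})"
    by (rule connected_continuous_image) simp
  have "(\<lambda>y. a (f y)) ` {0..<t} \<subseteq> a ` {u. a' u = 0}"
  proof
    fix r assume "r \<in> (\<lambda>y. a (f y)) ` {0..<t}"
    then obtain y where y: "r = a (f y)" "0 \<le> y" "y < t" by auto
    have "a' (f y) = 0" by (rule critical_along_path[OF f a a' eq no_jump osc y(2,3)])
    then show "r \<in> a ` {u. a' u = 0}" using y(1) by simp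
  qed
  then have negl: "negligible ((\<lambda>y. a (f y)) ` {0..<t})"
    by (rule negligible_subset[OF negligible_critical_values[OF a a']])
  have no_less: "\<not> a (f u) < a (f v)" if "u \<in> {0..<t}" "v \<in> {0..<t}" for u v
  proof
    assume less: "a (f u) < a (f v)"
    have "{a (f u)..a (f v)} \<subseteq> (\<lambda>y. a (f y)) ` {0..<t}"
      using that by (intro connected_contains_Icc[OF conn]) auto
    then have "negligible {a (f u)..a (f v)}" using negl negligible_subset by blast
    then show False using less negligible_interval(1)[of "a (f u)" "a (f v)"] by simp
  qed
  show ?thesis using no_less[of s 0] no_less[of 0 s] s by simp
qed

section \<open>Truncated moments and Levy exponents\<close>

lemma (in prob_space) variance_sum_le:
  fixes Y :: "'i \<Rightarrow> 'a \<Rightarrow> real"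
  assumes I: "finite I" and ind: "indep_vars (\<lambda>_. borel) Y I"
    and B: "\<And>i \<omega>. i \<in> I \<Longrightarrow> \<bar>Y i \<omega>\<bar> \<le> B"
  shows "variance (\<lambda>\<omega>. \<Sum>i\<in>I. Y i \<omega>) \<le> (\<Sum>i\<in>I. expectation (\<lambda>\<omega>. (Y i \<omega>)\<^sup>2))"
proof -
  have Y[measurable]: "Y i \<in> borel_measurable M" if "i \<in> I" for i
    using ind that by (auto simp: indep_vars_def)
  have intY: "integrable M (Y i)" if "i \<in> I" for i
    using that by (intro integrable_const_bound[where B = B]) (auto intro: B)
  define C where "C i \<omega> = Y i \<omega> - expectation (Y i)" for i \<omega>
  have EY: "\<bar>expectation (Y i)\<bar> \<le> B" if "i \<in> I" for i
  proof -
    have "norm (expectation (Y i)) \<le> expectation (\<lambda>\<omega>. norm (Y i \<omega>))" by (rule integral_norm_bound)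
    also have "\<dots> \<le> expectation (\<lambda>\<omega>. B)"
      using that intY by (intro integral_mono) (auto intro: B)
    finally show ?thesis by (simp add: prob_space)
  qed
  have CB: "\<bar>C i \<omega>\<bar> \<le> 2 * B" if "i \<in> I" for i \<omega>
    using EY[OF that] B[OF that, of \<omega>] unfolding C_def by linarith
  have [measurable]: "C i \<in> borel_measurable M" if "i \<in> I" for i
    unfolding C_def using that by measurable
  have intC: "integrable M (C i)" if "i \<in> I" for i
    unfolding C_def using intY[OF that] by simp
  have intCC: "integrable M (\<lambda>\<omega>. C i \<omega> * C j \<omega>)" if "i \<in> I" "j \<in> I" for i j
  proof (rule integrable_const_bound[where B = "(2 * B) * (2 * B)"])
    show "AE \<omega> in M. norm (C i \<omega> * C j \<omega>) \<le> 2 * B * (2 * B)"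
    proof (rule AE_I2)
      fix \<omega>
      have "\<bar>C i \<omega>\<bar> * \<bar>C j \<omega>\<bar> \<le> 2 * B * (2 * B)"
        using CB[OF that(1), of \<omega>] CB[OF that(2), of \<omega>] by (intro mult_mono) linarith+
      then show "norm (C i \<omega> * C j \<omega>) \<le> 2 * B * (2 * B)" by (simp add: abs_mult)
    qed
  qed (use that in measurable)
  have EC: "expectation (C i) = 0" if "i \<in> I" for i
    unfolding C_def using intY[OF that] by (simp add: prob_space)
  have indC: "indep_vars (\<lambda>_. borel) C I"
    unfolding C_def by (rule indep_vars_compose2[OF ind]) auto
  have cross: "expectation (\<lambda>\<omega>. C i \<omega> * C j \<omega>) = 0" if "i \<in> I" "j \<in> I" "i \<noteq> j" for i j
  proof -
    have "expectation (\<lambda>\<omega>. \<Prod>l\<in>{i, j}. C l \<omega>) = (\<Prod>l\<in>{i, j}. expectation (C l))"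
      using that intC by (intro indep_vars_lebesgue_integral indep_vars_subset[OF indC]) auto
    then show ?thesis using that EC by simp
  qed
  have ES: "expectation (\<lambda>\<omega>. \<Sum>i\<in>I. Y i \<omega>) = (\<Sum>i\<in>I. expectation (Y i))"
    using intY by simp
  have "variance (\<lambda>\<omega>. \<Sum>i\<in>I. Y i \<omega>) = expectation (\<lambda>\<omega>. \<Sum>i\<in>I. \<Sum>j\<in>I. C i \<omega> * C j \<omega>)"
    unfolding ES C_def sum_subtractf[symmetric] power2_eq_square sum_product ..
  also have "\<dots> = (\<Sum>i\<in>I. \<Sum>j\<in>I. expectation (\<lambda>\<omega>. C i \<omega> * C j \<omega>))"
    using intCC by (simp add: Bochner_Integration.integral_sum)
  also have "\<dots> = (\<Sum>i\<in>I. expectation (\<lambda>\<omega>. C i \<omega> * C i \<omega>))"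
  proof (intro sum.cong refl)
    fix i assume i: "i \<in> I"
    have "(\<Sum>j\<in>I. expectation (\<lambda>\<omega>. C i \<omega> * C j \<omega>)) =
      (\<Sum>j\<in>I. if j = i then expectation (\<lambda>\<omega>. C i \<omega> * C i \<omega>) else 0)"
      using i cross by (intro sum.cong) auto
    then show "(\<Sum>j\<in>I. expectation (\<lambda>\<omega>. C i \<omega> * C j \<omega>)) = expectation (\<lambda>\<omega>. C i \<omega> * C i \<omega>)"
      using i I by simp
  qed
  also have "\<dots> \<le> (\<Sum>i\<in>I. expectation (\<lambda>\<omega>. (Y i \<omega>)\<^sup>2))"
  proof (rule sum_mono)
    fix i assume i: "i \<in> I"
    have int2: "integrable M (\<lambda>\<omega>. (Y i \<omega>)\<^sup>2)"
    proof (rule integrable_const_bound[where B = "B\<^sup>2"])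
      show "AE \<omega> in M. norm ((Y i \<omega>)\<^sup>2) \<le> B\<^sup>2"
        using power_mono[OF B[OF i] abs_ge_zero, of _ 2] by (intro AE_I2) simp
    qed (use i in measurable)
    have "expectation (\<lambda>\<omega>. C i \<omega> * C i \<omega>) = variance (Y i)" unfolding C_def power2_eq_square ..
    also have "\<dots> = expectation (\<lambda>\<omega>. (Y i \<omega>)\<^sup>2) - (expectation (Y i))\<^sup>2"
      using intY[OF i] int2 by (rule variance_eq)
    finally show "expectation (\<lambda>\<omega>. C i \<omega> * C i \<omega>) \<le> expectation (\<lambda>\<omega>. (Y i \<omega>)\<^sup>2)" by simp
  qed
  finally show ?thesis .
qed

definition truncate :: "real \<Rightarrow> real \<Rightarrow> real" where
  "truncate \<epsilon> y = (if \<bar>y\<bar> \<le> \<epsilon> then y else 0)"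

lemma measurable_truncate[measurable]: "truncate \<epsilon> \<in> borel_measurable borel"
  unfolding truncate_def by measurable

lemma square_le_cos:
  fixes y :: real
  assumes "\<bar>y\<bar> \<le> 1"
  shows "y\<^sup>2 \<le> 4 * (1 - cos y)"
proof -
  let ?T = "iexp y - (\<Sum>k\<le>3. (\<i> * complex_of_real y) ^ k / fact k)"
  have "cos y - (1 - y\<^sup>2 / 2) = Re ?T"
    by (simp add: numeral_3_eq_3 power_mult_distrib Re_exp power2_eq_square)
  then have "\<bar>cos y - (1 - y\<^sup>2 / 2)\<bar> \<le> cmod ?T" by (simp only: abs_Re_le_cmod)
  also have "\<dots> \<le> \<bar>y\<bar> ^ Suc 3 / fact (Suc 3)" by (rule iexp_approx1)
  finally have "\<bar>cos y - (1 - y\<^sup>2 / 2)\<bar> \<le> \<bar>y\<bar> ^ Suc 3 / fact (Suc 3)" .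
  moreover have "\<bar>y\<bar> ^ Suc 3 / fact (Suc 3) \<le> y\<^sup>2 / 24"
  proof -
    have "\<bar>y\<bar> ^ Suc 3 \<le> \<bar>y\<bar> ^ 2" using assms by (intro power_decreasing) auto
    then show ?thesis by (simp add: fact_numeral)
  qed
  ultimately have "\<bar>cos y - (1 - y\<^sup>2 / 2)\<bar> \<le> y\<^sup>2 / 24" by (rule order_trans)
  from abs_le_D1[OF this] show ?thesis using zero_le_power2[of y] by argo
qed

lemma iexp_first_order:
  "cmod (iexp y - 1 - \<i> * complex_of_real y) \<le> y\<^sup>2 / 2"
  using iexp_approx1[of y 1] by (simp add: power2_eq_square diff_diff_eq)

text \<open>
  The real part of \<open>1 - char M (1 / \<epsilon>)\<close> is the mean of \<open>1 - cos (y / \<epsilon>)\<close>, which dominates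
  \<open>y\<^sup>2 / (4 \<epsilon>\<^sup>2)\<close> for \<open>\<bar>y\<bar> \<le> \<epsilon>\<close>.
\<close>

lemma (in real_distribution) truncated_second_moment_le:
  assumes \<epsilon>: "0 < \<epsilon>"
  shows "expectation (\<lambda>y. (truncate \<epsilon> y)\<^sup>2) \<le> 4 * \<epsilon>\<^sup>2 * cmod (1 - char M (1 / \<epsilon>))"
proof -
  have int: "integrable M (\<lambda>y. iexp (1 / \<epsilon> * y))"
    by (intro integrable_iexp) auto
  have Re_char: "Re (char M (1 / \<epsilon>)) = expectation (\<lambda>y. cos (y / \<epsilon>))"
  proof -
    have "Re (char M (1 / \<epsilon>)) = expectation (\<lambda>y. Re (iexp (1 / \<epsilon> * y)))"
      unfolding char_def by (rule integral_Re[OF int, symmetric])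
    then show ?thesis by (simp add: Re_exp)
  qed
  have intcos: "integrable M (\<lambda>y. cos (y / \<epsilon>))"
    by (rule integrable_const_bound[where B = 1]) auto
  have le: "(truncate \<epsilon> y)\<^sup>2 \<le> 4 * \<epsilon>\<^sup>2 * (1 - cos (y / \<epsilon>))" for y
  proof (cases "\<bar>y\<bar> \<le> \<epsilon>")
    case True
    then have "(y / \<epsilon>)\<^sup>2 \<le> 4 * (1 - cos (y / \<epsilon>))" using \<epsilon> by (intro square_le_cos) simp
    then have "\<epsilon>\<^sup>2 * (y / \<epsilon>)\<^sup>2 \<le> \<epsilon>\<^sup>2 * (4 * (1 - cos (y / \<epsilon>)))" by (intro mult_left_mono) auto
    moreover have "\<epsilon>\<^sup>2 * (y / \<epsilon>)\<^sup>2 = y\<^sup>2" using \<epsilon> by (simp add: power_divide)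
    ultimately show ?thesis using True by (simp add: truncate_def algebra_simps)
  qed (auto simp: truncate_def)
  have "expectation (\<lambda>y. (truncate \<epsilon> y)\<^sup>2) \<le> expectation (\<lambda>y. 4 * \<epsilon>\<^sup>2 * (1 - cos (y / \<epsilon>)))"
  proof (rule integral_mono)
    show "integrable M (\<lambda>y. (truncate \<epsilon> y)\<^sup>2)"
    proof (rule integrable_const_bound[where B = "\<epsilon>\<^sup>2"])
      show "AE y in M. norm ((truncate \<epsilon> y)\<^sup>2) \<le> \<epsilon>\<^sup>2"
        using \<epsilon> by (intro AE_I2) (auto simp: truncate_def abs_le_square_iff[symmetric])
    qed auto
    show "integrable M (\<lambda>y. 4 * \<epsilon>\<^sup>2 * (1 - cos (y / \<epsilon>)))" using intcos by auto
  qed (use le in auto)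
  also have "\<dots> = 4 * \<epsilon>\<^sup>2 * Re (1 - char M (1 / \<epsilon>))"
    using intcos by (simp add: Re_char prob_space del: space_eq_univ)
  also have "\<dots> \<le> 4 * \<epsilon>\<^sup>2 * cmod (1 - char M (1 / \<epsilon>))"
    by (intro mult_left_mono complex_Re_le_cmod) simp
  finally show ?thesis .
qed

text \<open>
  This is where the vanishing Gaussian variance enters: it is the limit of twice the real part of
  \<open>- levy_exponent b q \<nu> u / u\<^sup>2\<close>. The remaining integrand, divided by \<open>u\<^sup>2\<close>, tends to \<open>0\<close> pointwise
  and is dominated by \<open>2 min 1 z\<^sup>2\<close>.
\<close>

lemma levy_exponent_over_square_tendsto:
  assumes "levy_measure \<nu>"
  shows "(\<lambda>l. cmod (levy_exponent b 0 \<nu> (real (Suc l))) / (real (Suc l))\<^sup>2) \<longlonglongrightarrow> 0"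
proof -
  have sets[measurable_cong]: "sets \<nu> = sets borel" and fin: "(\<integral>\<^sup>+ z. ennreal (min 1 (z\<^sup>2)) \<partial>\<nu>) < \<infinity>"
    using assms by (auto simp: levy_measure_def)
  define F where "F u z = iexp (u * z) - 1 - \<i> * complex_of_real (u * z * indicator {-1..1} z)" for u z :: real
  define G where "G l z = cmod (F (real (Suc l)) z) / (real (Suc l))\<^sup>2" for l z
  have G_le: "G l z \<le> 2 * min 1 (z\<^sup>2)" "G l z \<le> \<bar>z\<bar> * 2 / real (Suc l) + 2 / (real (Suc l))\<^sup>2" for l z
  proof -
    let ?u = "real (Suc l)"
    have u: "1 \<le> ?u" "1 \<le> ?u\<^sup>2" by (auto simp: one_le_power)
    have bd: "cmod (iexp (?u * z) - 1) \<le> 2"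
      using norm_triangle_ineq4[of "iexp (?u * z)" 1] by simp
    show "G l z \<le> 2 * min 1 (z\<^sup>2)"
    proof (cases "\<bar>z\<bar> \<le> 1")
      case True
      then have z2: "z\<^sup>2 \<le> 1" by (simp add: abs_square_le_1)
      have "F ?u z = iexp (?u * z) - 1 - \<i> * complex_of_real (?u * z)"
        using True by (simp add: F_def indicator_def abs_le_iff del: of_nat_Suc)
      then have "cmod (F ?u z) \<le> (?u * z)\<^sup>2 / 2" using iexp_first_order[of "?u * z"] by (simp only:)
      then have "G l z \<le> z\<^sup>2 / 2" using u by (simp add: G_def power_mult_distrib divide_le_eq mult.commute del: of_nat_Suc)
      then show ?thesis using zero_le_power2[of z] unfolding min_absorb2[OF z2] by linarith
    next
      case False
      then have z2: "1 < z\<^sup>2" using abs_square_le_1[of z] by linarith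
      have "z \<notin> {-1..1}" using False by auto
      then have "cmod (F ?u z) \<le> 2" using bd by (simp add: F_def del: of_nat_Suc)
      then have "cmod (F ?u z) \<le> 2 * ?u\<^sup>2" using u(2) by linarith
      then have "G l z \<le> 2" using u unfolding G_def by (subst pos_divide_le_eq) (auto simp del: of_nat_Suc)
      then show ?thesis using z2 by (simp add: min_def)
    qed
    have "cmod (F ?u z) \<le> 2 + cmod (\<i> * complex_of_real (?u * z * indicator {-1..1} z))"
      unfolding F_def
      using bd norm_triangle_ineq4[of "iexp (?u * z) - 1" "\<i> * complex_of_real (?u * z * indicator {-1..1} z)"]
      by linarith
    also have "cmod (\<i> * complex_of_real (?u * z * indicator {-1..1} z)) \<le> \<bar>z\<bar> * 2 * ?u"
      by (simp add: norm_mult indicator_def abs_mult del: of_nat_Suc of_real_mult)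
    finally have "G l z \<le> (2 + \<bar>z\<bar> * 2 * ?u) / ?u\<^sup>2"
      unfolding G_def by (intro divide_right_mono) auto
    also have "\<dots> = \<bar>z\<bar> * 2 / ?u + 2 / ?u\<^sup>2"
      using u by (simp add: add_divide_distrib power2_eq_square del: of_nat_Suc)
    finally show "G l z \<le> \<bar>z\<bar> * 2 / ?u + 2 / ?u\<^sup>2" .
  qed
  have G0: "0 \<le> G l z" for l z by (simp add: G_def)
  have [measurable]: "F u \<in> borel_measurable \<nu>" for u unfolding F_def by measurable
  have dom: "integrable \<nu> (\<lambda>z. 2 * min 1 (z\<^sup>2))"
    using fin by (intro integrable_mult_right integrableI_nonneg) auto
  have Glim: "(\<lambda>l. G l z) \<longlonglongrightarrow> 0" for z
  proof (rule tendsto_sandwich[OF _ _ tendsto_const])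
    have inv: "(\<lambda>l. 1 / real (Suc l)) \<longlonglongrightarrow> 0" by (intro LIMSEQ_Suc lim_const_over_n)
    have "(\<lambda>l. \<bar>z\<bar> * 2 * (1 / real (Suc l)) + 2 * (1 / real (Suc l))\<^sup>2) \<longlonglongrightarrow> \<bar>z\<bar> * 2 * 0 + 2 * 0\<^sup>2"
      by (intro tendsto_intros inv)
    then show "(\<lambda>l. \<bar>z\<bar> * 2 / real (Suc l) + 2 / (real (Suc l))\<^sup>2) \<longlonglongrightarrow> 0"
      by (simp add: power_divide)
  qed (use G_le G0 in auto)
  have "(\<lambda>l. integral\<^sup>L \<nu> (G l)) \<longlonglongrightarrow> integral\<^sup>L \<nu> (\<lambda>z. 0)"
  proof (rule integral_dominated_convergence[OF _ _ dom])
    show "G l \<in> borel_measurable \<nu>" for l unfolding G_def by measurable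
    show "AE z in \<nu>. norm (G l z) \<le> 2 * min 1 (z\<^sup>2)" for l using G_le(1)[of l] G0[of l] by auto
  qed (use Glim in auto)
  then have IG: "(\<lambda>l. integral\<^sup>L \<nu> (G l)) \<longlonglongrightarrow> 0" by simp
  have inv: "(\<lambda>l. \<bar>b\<bar> * (1 / real (Suc l))) \<longlonglongrightarrow> \<bar>b\<bar> * 0"
    by (intro tendsto_intros LIMSEQ_Suc lim_const_over_n)
  show ?thesis
  proof (rule tendsto_sandwich[OF _ _ tendsto_const])
    show "(\<lambda>l. \<bar>b\<bar> * (1 / real (Suc l)) + integral\<^sup>L \<nu> (G l)) \<longlonglongrightarrow> 0"
      using tendsto_add[OF inv IG] by simp
    show "\<forall>\<^sub>F l in sequentially. cmod (levy_exponent b 0 \<nu> (real (Suc l))) / (real (Suc l))\<^sup>2 \<le>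
        \<bar>b\<bar> * (1 / real (Suc l)) + integral\<^sup>L \<nu> (G l)"
    proof (intro always_eventually allI)
      fix l
      let ?u = "real (Suc l)"
      have "levy_exponent b 0 \<nu> ?u = \<i> * complex_of_real (?u * b) + integral\<^sup>L \<nu> (F ?u)"
        by (simp add: levy_exponent_def F_def[abs_def])
      then have "cmod (levy_exponent b 0 \<nu> ?u) \<le> ?u * \<bar>b\<bar> + cmod (integral\<^sup>L \<nu> (F ?u))"
        using norm_triangle_ineq[of "\<i> * complex_of_real (?u * b)" "integral\<^sup>L \<nu> (F ?u)"]
        by (simp add: norm_mult abs_mult del: of_nat_Suc)
      also have "cmod (integral\<^sup>L \<nu> (F ?u)) \<le> integral\<^sup>L \<nu> (\<lambda>z. cmod (F ?u z))"
        by (rule integral_norm_bound)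
      finally have "cmod (levy_exponent b 0 \<nu> ?u) / ?u\<^sup>2 \<le> (?u * \<bar>b\<bar> + integral\<^sup>L \<nu> (\<lambda>z. cmod (F ?u z))) / ?u\<^sup>2"
        by (intro divide_right_mono) auto
      also have "\<dots> = \<bar>b\<bar> * (1 / ?u) + integral\<^sup>L \<nu> (G l)"
      proof -
        have "integral\<^sup>L \<nu> (G l) = (LINT z|\<nu>. cmod (F ?u z)) / ?u\<^sup>2"
          unfolding G_def by (rule integral_divide_zero)
        then show ?thesis by (simp add: add_divide_distrib power2_eq_square del: of_nat_Suc)
      qed
      finally show "cmod (levy_exponent b 0 \<nu> ?u) / ?u\<^sup>2 \<le> \<bar>b\<bar> * (1 / ?u) + integral\<^sup>L \<nu> (G l)" .
    qed
  qed (auto intro!: always_eventually)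
qed

lemma exp_minus_one_le:
  fixes w :: complex
  assumes "cmod w \<le> 1"
  shows "cmod (1 - exp w) \<le> 3 * cmod w"
proof -
  have "cmod (exp w - (\<Sum>k\<le>0. w ^ k / fact k)) \<le> exp \<bar>Re w\<bar> * cmod w ^ Suc 0 / fact 0"
    by (rule Taylor_exp)
  then have "cmod (1 - exp w) \<le> exp \<bar>Re w\<bar> * cmod w" by (simp add: norm_minus_commute)
  also have "\<dots> \<le> 3 * cmod w"
  proof (rule mult_right_mono)
    have "exp \<bar>Re w\<bar> \<le> exp 1" using assms abs_Re_le_cmod[of w] by simp
    then show "exp \<bar>Re w\<bar> \<le> 3" using exp_le by linarith
  qed simp
  finally show ?thesis .
qed

section \<open>A Levy process without Gaussian part is nowhere continuous\<close>

context levy_process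
begin

definition sub_increment :: "real \<Rightarrow> nat \<Rightarrow> nat \<Rightarrow> nat \<Rightarrow> 'w \<Rightarrow> real" where
  "sub_increment \<delta> j n i \<omega> =
     Z (real j * \<delta> + real (Suc i) * (\<delta> / real n)) \<omega> - Z (real j * \<delta> + real i * (\<delta> / real n)) \<omega>"

lemma measurable_sub_increment[measurable]:
  "0 \<le> \<delta> \<Longrightarrow> sub_increment \<delta> j n i \<in> borel_measurable M"
  unfolding sub_increment_def[abs_def] by (intro borel_measurable_diff random_variable) auto

lemma sum_sub_increment:
  assumes "0 < n"
  shows "(\<Sum>i<n. sub_increment \<delta> j n i \<omega>) = increment \<delta> \<omega> j"
proof -
  have "(\<Sum>i<n. sub_increment \<delta> j n i \<omega>) =
    (\<Sum>i<n. (\<lambda>i. Z (real j * \<delta> + real i * (\<delta> / real n)) \<omega>) (Suc i) - (\<lambda>i. Z (real j * \<delta> + real i * (\<delta> / real n)) \<omega>) i)"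
    by (simp add: sub_increment_def)
  also have "\<dots> = Z (real j * \<delta> + real n * (\<delta> / real n)) \<omega> - Z (real j * \<delta> + real 0 * (\<delta> / real n)) \<omega>"
    by (rule sum_lessThan_telescope)
  also have "real j * \<delta> + real n * (\<delta> / real n) = real (Suc j) * \<delta>"
    using assms by (simp add: algebra_simps)
  finally show ?thesis by (simp add: increment_def)
qed

text \<open>
  The \<open>n\<close> increments over a partition of an interval of length \<open>\<delta>\<close> have the characteristic function
  \<open>exp ((\<delta> / n) \<psi>)\<close>, so each truncated second moment is of order \<open>\<epsilon>\<^sup>2 (\<delta> / n) \<bar>\<psi>(1 / \<epsilon>)\<bar>\<close>.
  The resulting bound does not depend on \<open>n\<close> and tends to \<open>0\<close> with \<open>\<epsilon>\<close>.
\<close>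

lemma truncated_sum_concentrates:
  assumes trip: "has_levy_triplet M Z b 0 \<nu>" and \<delta>: "0 < \<delta>" and \<epsilon>: "0 < \<epsilon>"
  shows "\<forall>\<^sub>F n in sequentially.
    variance (\<lambda>\<omega>. \<Sum>i<n. truncate \<epsilon> (sub_increment \<delta> j n i \<omega>))
      \<le> 12 * \<delta> * (\<epsilon>\<^sup>2 * cmod (levy_exponent b 0 \<nu> (1 / \<epsilon>)))"
proof -
  let ?\<psi> = "levy_exponent b 0 \<nu> (1 / \<epsilon>)"
  have "(\<lambda>n. \<delta> / real n * cmod ?\<psi>) \<longlonglongrightarrow> 0 * cmod ?\<psi>"
    by (intro tendsto_intros lim_const_over_n)
  then have "\<forall>\<^sub>F n in sequentially. \<delta> / real n * cmod ?\<psi> < 1"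
    by (rule order_tendstoD) simp
  then show ?thesis using eventually_gt_at_top[of 0]
  proof eventually_elim
    case (elim n)
    define h where "h = \<delta> / real n"
    have h: "0 \<le> h" using \<delta> by (simp add: h_def)
    define \<mu> where "\<mu> = distr M borel (Z h)"
    interpret \<mu>: real_distribution \<mu>
      unfolding \<mu>_def using random_variable[OF h] by (rule real_distribution_distr)
    have second: "\<mu>.expectation (\<lambda>y. (truncate \<epsilon> y)\<^sup>2) \<le> 12 * \<epsilon>\<^sup>2 * (h * cmod ?\<psi>)"
    proof -
      have "char \<mu> (1 / \<epsilon>) = exp (complex_of_real h * ?\<psi>)"
        using trip h unfolding has_levy_triplet_def \<mu>_def by blast
      moreover have norm: "cmod (complex_of_real h * ?\<psi>) = h * cmod ?\<psi>" using h by (simp add: norm_mult)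
      moreover have "cmod (1 - exp (complex_of_real h * ?\<psi>)) \<le> 3 * cmod (complex_of_real h * ?\<psi>)"
        using elim(1)[folded h_def] by (intro exp_minus_one_le) (simp add: norm)
      ultimately have "cmod (1 - char \<mu> (1 / \<epsilon>)) \<le> 3 * (h * cmod ?\<psi>)" by simp
      then have "4 * \<epsilon>\<^sup>2 * cmod (1 - char \<mu> (1 / \<epsilon>)) \<le> 4 * \<epsilon>\<^sup>2 * (3 * (h * cmod ?\<psi>))"
        by (intro mult_left_mono) auto
      also have "\<dots> = 12 * \<epsilon>\<^sup>2 * (h * cmod ?\<psi>)" by simp
      finally show ?thesis by (rule order_trans[OF \<mu>.truncated_second_moment_le[OF \<epsilon>]])
    qed
    have law: "distr M borel (sub_increment \<delta> j n i) = \<mu>" for i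
      unfolding \<mu>_def sub_increment_def[abs_def] using \<delta> h unfolding h_def
      by (intro distr_increment_from) auto
    have ind: "indep_vars (\<lambda>_. borel) (\<lambda>i. sub_increment \<delta> j n i) {..<n}"
      unfolding sub_increment_def[abs_def] using \<delta> h unfolding h_def
      by (intro indep_increments_from) auto
    have "variance (\<lambda>\<omega>. \<Sum>i<n. truncate \<epsilon> (sub_increment \<delta> j n i \<omega>))
      \<le> (\<Sum>i<n. expectation (\<lambda>\<omega>. (truncate \<epsilon> (sub_increment \<delta> j n i \<omega>))\<^sup>2))"
    proof (rule variance_sum_le)
      show "indep_vars (\<lambda>_. borel) (\<lambda>i \<omega>. truncate \<epsilon> (sub_increment \<delta> j n i \<omega>)) {..<n}"
        by (rule indep_vars_compose2[OF ind]) simp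
      show "\<bar>truncate \<epsilon> (sub_increment \<delta> j n i \<omega>)\<bar> \<le> \<epsilon>" for i \<omega>
        using \<epsilon> by (simp add: truncate_def)
    qed simp
    also have "\<dots> = (\<Sum>i<n. \<mu>.expectation (\<lambda>y. (truncate \<epsilon> y)\<^sup>2))"
    proof (intro sum.cong refl)
      fix i
      have "\<mu>.expectation (\<lambda>y. (truncate \<epsilon> y)\<^sup>2) =
        (\<integral>y. (truncate \<epsilon> y)\<^sup>2 \<partial>distr M borel (sub_increment \<delta> j n i))" by (simp only: law)
      also have "\<dots> = expectation (\<lambda>\<omega>. (truncate \<epsilon> (sub_increment \<delta> j n i \<omega>))\<^sup>2)"
        using \<delta> by (intro integral_distr) auto
      finally show "expectation (\<lambda>\<omega>. (truncate \<epsilon> (sub_increment \<delta> j n i \<omega>))\<^sup>2) = \<mu>.expectation (\<lambda>y. (truncate \<epsilon> y)\<^sup>2)" ..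
    qed
    also have "\<dots> \<le> real n * (12 * \<epsilon>\<^sup>2 * (h * cmod ?\<psi>))"
      using second by (simp add: mult_left_mono)
    also have "\<dots> = 12 * \<delta> * (\<epsilon>\<^sup>2 * cmod ?\<psi>)"
      using elim(2) by (simp add: h_def)
    finally show ?case .
  qed
qed

lemma sets_small_oscillation:
  assumes \<delta>: "0 < \<delta>"
  shows "{\<omega>\<in>space M. small_oscillation (\<lambda>s. Z s \<omega>) \<delta> j} \<in> events"
proof -
  have [measurable]: "sub_increment \<delta> j n i \<in> borel_measurable M" for n i using \<delta> by simp
  have eq: "small_oscillation (\<lambda>s. Z s \<omega>) \<delta> j \<longleftrightarrow>
      (\<forall>l::nat. \<forall>\<^sub>F n in sequentially. \<forall>i\<in>{..<n}. \<bar>sub_increment \<delta> j n i \<omega>\<bar> \<le> 1 / real (Suc l))" for \<omega>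
    unfolding small_oscillation_def sub_increment_def Ball_def lessThan_iff ..
  have fin: "{\<omega>\<in>space M. \<forall>i\<in>{..<n}. \<bar>sub_increment \<delta> j n i \<omega>\<bar> \<le> 1 / real (Suc l)} \<in> events" for n l
    by (intro sets.sets_Collect_finite_All) (auto intro!: borel_measurable_le borel_measurable_abs)
  show ?thesis
    unfolding eq
    by (intro sets.sets_Collect_countable_All sets_Collect_eventually_sequentially fin)
qed

text \<open>
  On the event of small oscillation the truncation at level \<open>\<epsilon>\<close> has no effect on fine partitions, so
  the increment of \<open>Z\<close> equals a sum whose variance is arbitrarily small. By the Borel--Cantelli lemma
  the means \<open>m\<close> of suitable such sums converge to the increment. As \<open>m\<close> is not random, the
  increment is constant on this event.
\<close>

lemma increment_constant_where_continuous:
  assumes trip: "has_levy_triplet M Z b 0 \<nu>" and \<delta>: "0 < \<delta>"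
  shows "\<exists>m::nat \<Rightarrow> real. AE \<omega> in M. small_oscillation (\<lambda>s. Z s \<omega>) \<delta> j \<longrightarrow> m \<longlonglongrightarrow> increment \<delta> \<omega> j"
proof -
  define C where "C = {\<omega>\<in>space M. small_oscillation (\<lambda>s. Z s \<omega>) \<delta> j}"
  have C[measurable]: "C \<in> events" unfolding C_def using \<delta> by (rule sets_small_oscillation)
  have [measurable]: "sub_increment \<delta> j n i \<in> borel_measurable M" for n i using \<delta> by simp
  have [measurable]: "(\<lambda>\<omega>. increment \<delta> \<omega> j) \<in> borel_measurable M" using \<delta> by simp
  have nu: "levy_measure \<nu>" using trip by (simp add: has_levy_triplet_def)
  define S where "S n l \<omega> = (\<Sum>i<n. truncate (1 / real (Suc l)) (sub_increment \<delta> j n i \<omega>))" for n l \<omega>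
  have S_meas[measurable]: "S n l \<in> borel_measurable M" for n l unfolding S_def by measurable
  have S_int: "integrable M (\<lambda>\<omega>. (S n l \<omega>)\<^sup>2)" for n l
  proof (rule integrable_const_bound[where B = "(real n * (1 / real (Suc l)))\<^sup>2"])
    have bd: "\<bar>S n l \<omega>\<bar> \<le> real n * (1 / real (Suc l))" for \<omega>
    proof -
      have "\<bar>S n l \<omega>\<bar> \<le> (\<Sum>i<n. \<bar>truncate (1 / real (Suc l)) (sub_increment \<delta> j n i \<omega>)\<bar>)"
        unfolding S_def by (rule sum_abs)
      also have "\<dots> \<le> (\<Sum>i<n. 1 / real (Suc l))"
        by (intro sum_mono) (simp add: truncate_def)
      finally show ?thesis by simp
    qed
    show "AE \<omega> in M. norm ((S n l \<omega>)\<^sup>2) \<le> (real n * (1 / real (Suc l)))\<^sup>2"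
    proof (rule AE_I2)
      fix \<omega>
      show "norm ((S n l \<omega>)\<^sup>2) \<le> (real n * (1 / real (Suc l)))\<^sup>2"
        using power_mono[OF bd abs_ge_zero, of \<omega> 2] by (simp only: power2_abs real_norm_def abs_power2)
    qed
  qed measurable
  \<comment> \<open>The variance \<open>8\<^sup>-\<^sup>k\<close> makes the Chebyshev bound at distance \<open>2\<^sup>-\<^sup>k\<close> summable in \<open>k\<close>.\<close>
  have pick: "\<exists>\<mu>. prob (C \<inter> {\<omega>\<in>space M. (1 / 2) ^ k \<le> \<bar>increment \<delta> \<omega> j - \<mu>\<bar>}) \<le> 2 * (1 / 2) ^ k" for k :: nat
  proof -
    have "(\<lambda>l. 12 * \<delta> * (cmod (levy_exponent b 0 \<nu> (real (Suc l))) / (real (Suc l))\<^sup>2)) \<longlonglongrightarrow> 12 * \<delta> * 0"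
      by (intro tendsto_mult_left levy_exponent_over_square_tendsto[OF nu])
    then have "\<forall>\<^sub>F l in sequentially. 12 * \<delta> * (cmod (levy_exponent b 0 \<nu> (real (Suc l))) / (real (Suc l))\<^sup>2) < (1 / 8) ^ k"
      by (rule order_tendstoD) simp
    then obtain l where l: "12 * \<delta> * (cmod (levy_exponent b 0 \<nu> (real (Suc l))) / (real (Suc l))\<^sup>2) < (1 / 8) ^ k"
      by (auto simp: eventually_sequentially)
    have pos: "0 < 1 / real (Suc l)" by simp
    have var: "\<forall>\<^sub>F n in sequentially. variance (S n l) \<le> (1 / 8) ^ k"
      using truncated_sum_concentrates[OF trip \<delta> pos, of j]
    proof eventually_elim
      case (elim n)
      then show ?case using l unfolding S_def by (simp add: power_divide del: of_nat_Suc)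
    qed
    define E where "E n = C \<inter> {\<omega>\<in>space M. \<exists>i\<in>{..<n}. 1 / real (Suc l) < \<bar>sub_increment \<delta> j n i \<omega>\<bar>}" for n
    have E[measurable]: "E n \<in> events" for n unfolding E_def by measurable
    have E_lim: "(\<lambda>n. prob (E n)) \<longlonglongrightarrow> 0"
    proof -
      have "(\<lambda>n. \<integral>\<omega>. (indicator (E n) \<omega> :: real) \<partial>M) \<longlonglongrightarrow> (\<integral>\<omega>. 0 \<partial>M)"
      proof (rule integral_dominated_convergence[where w = "\<lambda>_. 1"])
        show "AE \<omega> in M. (\<lambda>n. indicator (E n) \<omega> :: real) \<longlonglongrightarrow> 0"
        proof (rule AE_I2)
          fix \<omega>
          have "\<forall>\<^sub>F n in sequentially. \<omega> \<notin> E n"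
          proof (cases "\<omega> \<in> C")
            case True
            then have "\<forall>\<^sub>F n in sequentially. \<forall>i<n. \<bar>sub_increment \<delta> j n i \<omega>\<bar> \<le> 1 / real (Suc l)"
              by (auto simp: C_def small_oscillation_def sub_increment_def)
            then show ?thesis by eventually_elim (auto simp: E_def not_less)
          qed (simp add: E_def)
          then show "(\<lambda>n. indicator (E n) \<omega> :: real) \<longlonglongrightarrow> 0"
            by (intro tendsto_eventually) (erule eventually_mono, simp)
        qed
      qed (auto simp: indicator_def)
      then show ?thesis by (simp add: Int_absorb2 sets.sets_into_space[OF E])
    qed
    then have "\<forall>\<^sub>F n in sequentially. prob (E n) < (1 / 2) ^ k" by (rule order_tendstoD) simp
    then have "\<forall>\<^sub>F n in sequentially. 0 < n \<and> prob (E n) < (1 / 2) ^ k \<and> variance (S n l) \<le> (1 / 8) ^ k"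
      using var eventually_gt_at_top[of 0] by eventually_elim simp
    then obtain n where n: "0 < n" "prob (E n) < (1 / 2) ^ k" "variance (S n l) \<le> (1 / 8) ^ k"
      by (auto simp: eventually_sequentially)
    define \<mu> where "\<mu> = expectation (S n l)"
    define F where "F = {\<omega>\<in>space M. (1 / 2) ^ k \<le> \<bar>S n l \<omega> - \<mu>\<bar>}"
    have F[measurable]: "F \<in> events" unfolding F_def by measurable
    have "prob F \<le> variance (S n l) / ((1 / 2) ^ k)\<^sup>2"
      unfolding F_def \<mu>_def by (rule Chebyshev_inequality) (use S_int in auto)
    also have "\<dots> \<le> (1 / 8) ^ k / ((1 / 2) ^ k)\<^sup>2" using n by (intro divide_right_mono) auto
    also have "\<dots> = (1 / 2) ^ k"
    proof -
      have "((1 / 2 :: real) ^ k)\<^sup>2 = (1 / 4) ^ k" by (simp add: power2_eq_square power_mult_distrib[symmetric])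
      then show ?thesis by (simp add: power_divide[symmetric])
    qed
    finally have probF: "prob F \<le> (1 / 2) ^ k" .
    have "C \<inter> {\<omega>\<in>space M. (1 / 2) ^ k \<le> \<bar>increment \<delta> \<omega> j - \<mu>\<bar>} \<subseteq> E n \<union> F"
    proof
      fix \<omega> assume w: "\<omega> \<in> C \<inter> {\<omega>\<in>space M. (1 / 2) ^ k \<le> \<bar>increment \<delta> \<omega> j - \<mu>\<bar>}"
      show "\<omega> \<in> E n \<union> F"
      proof (cases "\<omega> \<in> E n")
        case False
        then have "S n l \<omega> = (\<Sum>i<n. sub_increment \<delta> j n i \<omega>)"
          using w unfolding S_def by (intro sum.cong) (auto simp: E_def truncate_def not_less)
        then have "S n l \<omega> = increment \<delta> \<omega> j" using sum_sub_increment[OF n(1)] by simp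
        then show ?thesis using w by (simp add: F_def)
      qed simp
    qed
    then have "prob (C \<inter> {\<omega>\<in>space M. (1 / 2) ^ k \<le> \<bar>increment \<delta> \<omega> j - \<mu>\<bar>}) \<le> prob (E n \<union> F)"
      by (intro finite_measure_mono) auto
    also have "\<dots> \<le> prob (E n) + prob F" by (rule measure_Un_le) auto
    also have "\<dots> \<le> 2 * (1 / 2) ^ k" using n probF by simp
    finally show ?thesis by blast
  qed
  then obtain m where m: "\<And>k. prob (C \<inter> {\<omega>\<in>space M. (1 / 2) ^ k \<le> \<bar>increment \<delta> \<omega> j - m k\<bar>}) \<le> 2 * (1 / 2) ^ k"
    by metis
  let ?A = "\<lambda>k. C \<inter> {\<omega>\<in>space M. (1 / 2) ^ k \<le> \<bar>increment \<delta> \<omega> j - m k\<bar>}"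
  have "AE \<omega> in M. \<forall>\<^sub>F k in sequentially. \<omega> \<in> space M - ?A k"
  proof (rule borel_cantelli_AE1)
    show "summable (\<lambda>k. prob (?A k))"
      by (rule summable_comparison_test'[where g = "\<lambda>k. 2 * (1 / 2) ^ k"]) (use m in \<open>auto intro!: summable_mult summable_geometric\<close>)
  qed (auto simp: emeasure_eq_measure)
  then have "AE \<omega> in M. small_oscillation (\<lambda>s. Z s \<omega>) \<delta> j \<longrightarrow> m \<longlonglongrightarrow> increment \<delta> \<omega> j"
    using AE_space
  proof eventually_elim
    case (elim \<omega>)
    show ?case
    proof
      assume "small_oscillation (\<lambda>s. Z s \<omega>) \<delta> j"
      then have "\<omega> \<in> C" using elim by (simp add: C_def)
      then have ev: "\<forall>\<^sub>F k in sequentially. \<bar>increment \<delta> \<omega> j - m k\<bar> \<le> (1 / 2) ^ k"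
        using elim(2) by (intro eventually_mono[OF elim(1)]) auto
      have "(\<lambda>k. m k - increment \<delta> \<omega> j) \<longlonglongrightarrow> 0"
      proof (rule Lim_null_comparison)
        show "\<forall>\<^sub>F k in sequentially. norm (m k - increment \<delta> \<omega> j) \<le> (1 / 2) ^ k"
          by (rule eventually_mono[OF ev]) (simp add: abs_minus_commute)
        show "(\<lambda>k. (1 / 2 :: real) ^ k) \<longlonglongrightarrow> 0" by (rule LIMSEQ_realpow_zero) auto
      qed
      then show "m \<longlonglongrightarrow> increment \<delta> \<omega> j" by (rule LIM_zero_cancel)
    qed
  qed
  then show ?thesis by blast
qed

text \<open>
  If the increment over one cell equals \<open>\<beta>\<close> with positive probability, then by independence and
  stationarity all \<open>k\<close> increments up to time \<open>t\<close> equal \<open>\<beta>\<close> with positive probability, and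
  \<open>k \<beta>\<close> is an atom of the law of \<open>Z\<^sub>t\<close>.
\<close>

lemma no_continuity_interval:
  fixes k j :: nat
  assumes ng: "no_gaussian_part M Z" and t: "0 < t" and j: "j < k"
    and ac: "absolutely_continuous lborel (distr M borel (Z t))"
  shows "AE \<omega> in M. \<not> small_oscillation (\<lambda>s. Z s \<omega>) (t / real k) j"
proof -
  obtain b \<nu> where trip: "has_levy_triplet M Z b 0 \<nu>" using ng by (auto simp: no_gaussian_part_def)
  define \<delta> where "\<delta> = t / real k"
  have \<delta>: "0 < \<delta>" using t j by (simp add: \<delta>_def)
  have [measurable]: "(\<lambda>\<omega>. increment \<delta> \<omega> i) \<in> borel_measurable M" for i using \<delta> by simp
  obtain m where m: "AE \<omega> in M. small_oscillation (\<lambda>s. Z s \<omega>) \<delta> j \<longrightarrow> m \<longlonglongrightarrow> increment \<delta> \<omega> j"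
    using increment_constant_where_continuous[OF trip \<delta>] by blast
  define C where "C = {\<omega>\<in>space M. small_oscillation (\<lambda>s. Z s \<omega>) \<delta> j}"
  have C[measurable]: "C \<in> events" unfolding C_def using \<delta> by (rule sets_small_oscillation)
  have law: "distr M borel (\<lambda>\<omega>. increment \<delta> \<omega> i) = distr M borel (Z \<delta>)" for i
    using distr_increment_from[of 0 \<delta> i] \<delta> by (simp add: increment_def)
  have same: "prob {\<omega>\<in>space M. increment \<delta> \<omega> i = \<beta>} = prob {\<omega>\<in>space M. increment \<delta> \<omega> j = \<beta>}" for i \<beta>
  proof -
    have "prob {\<omega>\<in>space M. increment \<delta> \<omega> i = \<beta>} = measure (distr M borel (Z \<delta>)) {\<beta>}" for i
      unfolding law[of i, symmetric] by (subst measure_distr) (auto intro!: arg_cong[where f = prob])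
    then show ?thesis by simp
  qed
  have "prob C = 0"
  proof (rule ccontr)
    assume "prob C \<noteq> 0"
    have "\<exists>\<beta>. m \<longlonglongrightarrow> \<beta>"
    proof (rule ccontr)
      assume none: "\<not> (\<exists>\<beta>. m \<longlonglongrightarrow> \<beta>)"
      have "AE \<omega> in M. \<omega> \<notin> C" using m by eventually_elim (use none in \<open>auto simp: C_def\<close>)
      then have "prob C = 0" by (subst prob_eq_0) auto
      then show False using \<open>prob C \<noteq> 0\<close> by simp
    qed
    then obtain \<beta> where \<beta>: "m \<longlonglongrightarrow> \<beta>" by blast
    have "prob C \<le> prob {\<omega>\<in>space M. increment \<delta> \<omega> j = \<beta>}"
    proof (rule finite_measure_mono_AE)
      show "AE \<omega> in M. \<omega> \<in> C \<longrightarrow> \<omega> \<in> {\<omega>\<in>space M. increment \<delta> \<omega> j = \<beta>}"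
        using m AE_space
        by eventually_elim (use \<beta> LIMSEQ_unique in \<open>auto simp: C_def\<close>)
    qed measurable
    then have pos: "0 < prob {\<omega>\<in>space M. increment \<delta> \<omega> j = \<beta>}"
      using \<open>prob C \<noteq> 0\<close> measure_nonneg[of M C] by linarith
    have ind: "indep_vars (\<lambda>_. borel) (\<lambda>i \<omega>. increment \<delta> \<omega> i) {..<k}"
      using indep_increments_from[of 0 \<delta> k] \<delta> by (simp add: increment_def)
    have "prob (\<Inter>i\<in>{..<k}. (\<lambda>\<omega>. increment \<delta> \<omega> i) -` {\<beta>} \<inter> space M) =
      (\<Prod>i\<in>{..<k}. prob ((\<lambda>\<omega>. increment \<delta> \<omega> i) -` {\<beta>} \<inter> space M))"
      using j by (intro indep_varsD[OF ind]) auto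
    also have "\<dots> = (\<Prod>i\<in>{..<k}. prob {\<omega>\<in>space M. increment \<delta> \<omega> i = \<beta>})"
      by (intro prod.cong refl arg_cong[where f = prob]) auto
    also have "\<dots> > 0" using pos same by (intro prod_pos) metis
    finally have "0 < prob (\<Inter>i\<in>{..<k}. (\<lambda>\<omega>. increment \<delta> \<omega> i) -` {\<beta>} \<inter> space M)" .
    also have "\<dots> \<le> prob {\<omega>\<in>space M. Z t \<omega> = real k * \<beta>}"
    proof (rule finite_measure_mono_AE)
      have [measurable]: "Z t \<in> borel_measurable M" using t by (intro random_variable) simp
      show "{\<omega>\<in>space M. Z t \<omega> = real k * \<beta>} \<in> events" by measurable
      show "AE \<omega> in M. \<omega> \<in> (\<Inter>i\<in>{..<k}. (\<lambda>\<omega>. increment \<delta> \<omega> i) -` {\<beta>} \<inter> space M) \<longrightarrow>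
          \<omega> \<in> {\<omega>\<in>space M. Z t \<omega> = real k * \<beta>}"
        using start_zero
      proof eventually_elim
        case (elim \<omega>)
        show ?case
        proof
          assume w: "\<omega> \<in> (\<Inter>i\<in>{..<k}. (\<lambda>\<omega>. increment \<delta> \<omega> i) -` {\<beta>} \<inter> space M)"
          have "Z (real k * \<delta>) \<omega> - Z (real 0 * \<delta>) \<omega> = (\<Sum>i<k. increment \<delta> \<omega> i)"
            unfolding increment_def by (rule sum_lessThan_telescope[of "\<lambda>i. Z (real i * \<delta>) \<omega>", symmetric])
          also have "\<dots> = (\<Sum>i<k. \<beta>)" using INT_D[OF w] by (intro sum.cong) auto
          also have "\<dots> = real k * \<beta>" by simp
          finally show "\<omega> \<in> {\<omega>\<in>space M. Z t \<omega> = real k * \<beta>}"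
            using elim INT_D[OF w, of j] j by (simp add: \<delta>_def)
        qed
      qed
    qed
    finally have "0 < prob {\<omega>\<in>space M. Z t \<omega> = real k * \<beta>}" .
    moreover have "prob {\<omega>\<in>space M. Z t \<omega> = real k * \<beta>} = 0"
    proof -
      have "{real k * \<beta>} \<in> null_sets (distr M borel (Z t))"
        using ac unfolding absolutely_continuous_def
        by (rule subsetD) (simp add: null_sets_def)
      then have "emeasure M (Z t -` {real k * \<beta>} \<inter> space M) = 0"
        using random_variable[of t] t by (auto simp: null_sets_def emeasure_distr)
      moreover have "Z t -` {real k * \<beta>} \<inter> space M = {\<omega>\<in>space M. Z t \<omega> = real k * \<beta>}" by auto
      ultimately show ?thesis by (simp add: measure_def)
    qed
    ultimately show False by simp
  qed
  then have "AE \<omega> in M. \<omega> \<notin> C" by (subst (asm) prob_eq_0) auto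
  then show ?thesis using AE_space by eventually_elim (auto simp: C_def \<delta>_def)
qed

end

section \<open>Absolute continuity of the solution\<close>

lemma strong_solution_measurable:
  assumes "strong_solution M Z a x X" "0 \<le> t"
    and Z: "\<And>s. 0 \<le> s \<Longrightarrow> Z s \<in> borel_measurable M"
  shows "X t \<in> borel_measurable M"
proof -
  let ?G = "{Z s -` A \<inter> space M | s A. 0 \<le> s \<and> s \<le> t \<and> A \<in> sets borel} \<union> null_sets M"
  have G: "?G \<subseteq> sets M" using Z by (auto intro: measurable_sets)
  then have "?G \<subseteq> Pow (space M)" using sets.sets_into_space by blast
  then have "sets (augmented_filtration M Z t) = sigma_sets (space M) ?G"
    and sp: "space (augmented_filtration M Z t) = space M"
    unfolding augmented_filtration_def by (simp_all add: sets_measure_of space_measure_of)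
  then have sub: "sets (augmented_filtration M Z t) \<subseteq> sets M"
    using sets.sigma_sets_subset[OF G] by simp
  have "X t \<in> borel_measurable (augmented_filtration M Z t)"
    using assms by (simp add: strong_solution_def)
  then show ?thesis using sub sp unfolding measurable_def by auto
qed

text \<open>
  The exceptional sets are countable unions of null sets: over the rational window parameters for the
  paths on which \<open>a(X)\<close> jumps, and over the cells \<open>[j t / k, (j + 1) t / k]\<close> for the others.
\<close>

theorem theoremB:
  fixes M :: "'w measure" and Z X :: "real \<Rightarrow> 'w \<Rightarrow> real"
    and a :: "real \<Rightarrow> real" and x t :: real
  assumes "levy_process M Z"
    and "no_gaussian_part M Z"
    and "a C1_differentiable_on UNIV"
    and "bounded (range (deriv a))"
    and "strong_solution M Z a x X"
    and "0 < t"
    and "absolutely_continuous lborel (distr M borel (Z t))"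
  shows "absolutely_continuous lborel (distr M borel (X t))"
proof -
  interpret levy_process M Z by fact
  have t: "0 < t" by fact
  have ac: "absolutely_continuous lborel (distr M borel (Z t))" by fact
  have [measurable]: "Z t \<in> borel_measurable M" using t by (intro random_variable) simp
  have X[measurable]: "X t \<in> borel_measurable M"
    using assms(5) t random_variable by (intro strong_solution_measurable) auto
  define a' where "a' = deriv a"
  obtain D where D: "\<And>u. (a has_vector_derivative D u) (at u)" "continuous_on UNIV D"
    using assms(3) unfolding C1_differentiable_on_def by blast
  have aD: "(a has_real_derivative D u) (at u)" for u
    using D(1)[of u] by (simp add: has_real_derivative_iff_has_vector_derivative)
  then have "D = a'" unfolding a'_def by (auto intro!: ext DERIV_imp_deriv[symmetric])
  then have a: "(a has_real_derivative a' u) (at u)" and a': "continuous_on UNIV a'" for u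
    using aD D(2) by auto
  obtain L where L: "0 < L" "\<And>u. norm (a' u) \<le> L"
    using assms(4) unfolding a'_def bounded_pos by auto
  have lip: "\<bar>a u - a v\<bar> \<le> L * \<bar>u - v\<bar>" for u v
    using field_differentiable_bound[of UNIV a a' L u v] a L by (simp add: has_field_derivative_at_within)
  have L0: "0 \<le> L" using L by simp
  have cont: "continuous_on UNIV a" using lip L0 by (rule lipschitz_continuous)
  have a_borel: "a \<in> borel_measurable borel" using cont by (rule borel_measurable_continuous_onI)
  have path: "AE \<omega> in M. cadlag (\<lambda>s. X s \<omega>) \<and> Z 0 \<omega> = 0 \<and>
    (\<forall>s\<ge>0. X s \<omega> = x + integral {0..s} (\<lambda>r. a (X r \<omega>)) + Z s \<omega>)"
  proof -
    have "AE \<omega> in M. cadlag (\<lambda>t. X t \<omega>)"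
      and "AE \<omega> in M. \<forall>t\<ge>0. X t \<omega> = x + (LBINT s:{0..t}. a (X s \<omega>)) + Z t \<omega>"
      using assms(5) by (simp_all add: strong_solution_def)
    then show ?thesis using start_zero
    proof eventually_elim
      case (elim \<omega>)
      have "(LBINT s:{0..r}. a (X s \<omega>)) = integral {0..r} (\<lambda>s. a (X s \<omega>))" for r
        by (rule set_borel_integral_eq_integral(2)[OF cadlag_set_integrable[OF elim(1) cont]])
      then show ?case using elim by simp
    qed
  qed
  show ?thesis
    unfolding absolutely_continuous_def
  proof
    fix A :: "real set" assume A: "A \<in> null_sets lborel"
    then have A_borel[measurable]: "A \<in> sets borel" by (auto simp: null_sets_def)
    have linear: "AE \<omega> in M. x + t * a x + Z t \<omega> \<notin> A"
    proof -
      define B where "B = {y. y - (- (x + t * a x)) \<in> A}"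
      have "B \<in> null_sets lborel" unfolding B_def using A by (rule null_sets_translation)
      then have "B \<in> null_sets (distr M borel (Z t))"
        using ac by (auto simp: absolutely_continuous_def)
      then have "AE y in distr M borel (Z t). y \<notin> B" by (rule AE_not_in)
      then have "AE \<omega> in M. Z t \<omega> \<notin> B"
        by (subst (asm) AE_distr_iff) (auto simp: B_def)
      then show ?thesis by (simp add: B_def algebra_simps)
    qed
    have conv: "AE \<omega> in M. (\<lambda>r. splitting_scheme a (t / real k / real r) x
      (increment (t / real k / real r) \<omega>) (k * r)) \<longlonglongrightarrow> X t \<omega>" if k: "0 < k" for k :: nat
      using path
    proof eventually_elim
      case (elim \<omega>)
      have "(\<lambda>r. splitting_scheme a (t / real k / real r) x
          (\<lambda>i. Z (real (Suc i) * (t / real k / real r)) \<omega> - Z (real i * (t / real k / real r)) \<omega>) (k * r))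
        \<longlonglongrightarrow> X (real k * (t / real k)) \<omega>"
        by (rule scheme_tendsto[OF _ lip L0]) (use elim t k in auto)
      then show ?case using k by (simp add: increment_def[abs_def])
    qed
    have strat: "AE \<omega> in M. \<forall>(k::nat) (j::nat) (\<rho>::rat) (J::rat) (\<epsilon>::rat) (K::nat) (c::rat) (b::bool).
      j < k \<longrightarrow> 0 < c \<longrightarrow> t / real k * real K \<le> real_of_rat \<epsilon> \<longrightarrow> 3 * real_of_rat \<epsilon> < \<bar>real_of_rat J\<bar> \<longrightarrow>
      drift_separated a (real_of_rat \<rho>) (real_of_rat J) (real_of_rat \<epsilon>) (if b then 1 else - 1) (real_of_rat c) \<longrightarrow>
      (\<forall>u. \<bar>u - real_of_rat \<rho>\<bar> \<le> 3 * real_of_rat \<epsilon> \<longrightarrow> \<bar>a u\<bar> \<le> real K) \<longrightarrow>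
      (\<forall>\<^sub>F r in sequentially. one_big_jump a (t / real k / real r) x (j * r) r
        (real_of_rat \<rho>) (real_of_rat J) (real_of_rat \<epsilon>) (increment (t / real k / real r) \<omega>)) \<longrightarrow>
      X t \<omega> \<notin> A"
      unfolding AE_all_countable
    proof (intro allI)
      fix k j :: nat and \<rho> J \<epsilon> :: rat and K :: nat and c :: rat and b :: bool
      show "AE \<omega> in M. j < k \<longrightarrow> 0 < c \<longrightarrow> t / real k * real K \<le> real_of_rat \<epsilon> \<longrightarrow> 3 * real_of_rat \<epsilon> < \<bar>real_of_rat J\<bar> \<longrightarrow>
        drift_separated a (real_of_rat \<rho>) (real_of_rat J) (real_of_rat \<epsilon>) (if b then 1 else - 1) (real_of_rat c) \<longrightarrow>
        (\<forall>u. \<bar>u - real_of_rat \<rho>\<bar> \<le> 3 * real_of_rat \<epsilon> \<longrightarrow> \<bar>a u\<bar> \<le> real K) \<longrightarrow>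
        (\<forall>\<^sub>F r in sequentially. one_big_jump a (t / real k / real r) x (j * r) r
          (real_of_rat \<rho>) (real_of_rat J) (real_of_rat \<epsilon>) (increment (t / real k / real r) \<omega>)) \<longrightarrow>
        X t \<omega> \<notin> A" (is "AE \<omega> in M. ?P1 \<longrightarrow> ?P2 \<longrightarrow> ?P3 \<longrightarrow> ?P4 \<longrightarrow> ?P5 \<longrightarrow> ?P6 \<longrightarrow> ?W \<omega> \<longrightarrow> X t \<omega> \<notin> A")
      proof (cases "?P1 \<and> ?P2 \<and> ?P3 \<and> ?P4 \<and> ?P5 \<and> ?P6")
        case True
        then have "AE \<omega> in M. ?W \<omega> \<longrightarrow> X t \<omega> \<notin> A"
          using conv[of k] t
          by (intro one_big_jump_avoids_null_set[OF X _ lip L0 a_borel, where s = "if b then 1 else - 1" and c = "real_of_rat c" and K = "real K"] A)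
            auto
        then show ?thesis by eventually_elim simp
      qed auto
    qed
    have no_osc: "AE \<omega> in M. \<forall>(k::nat) (j::nat). j < k \<longrightarrow> \<not> small_oscillation (\<lambda>s. Z s \<omega>) (t / real k) j"
      unfolding AE_all_countable
    proof (intro allI)
      fix k j :: nat
      show "AE \<omega> in M. j < k \<longrightarrow> \<not> small_oscillation (\<lambda>s. Z s \<omega>) (t / real k) j"
        using no_continuity_interval[OF assms(2) t _ ac] by (cases "j < k") auto
    qed
    have "AE \<omega> in M. X t \<omega> \<notin> A"
      using path linear strat no_osc
    proof eventually_elim
      case (elim \<omega>)
      have cad: "cadlag (\<lambda>s. X s \<omega>)" and Z0: "Z 0 \<omega> = 0"
        and eq: "\<And>s. 0 \<le> s \<Longrightarrow> X s \<omega> = x + integral {0..s} (\<lambda>r. a (X r \<omega>)) + Z s \<omega>"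
        using elim(1) by blast+
      have osc: "\<And>k j. j < k \<Longrightarrow> \<not> small_oscillation (\<lambda>s. Z s \<omega>) (t / real k) j" using elim(4) by blast
      show ?case
      proof (cases "\<exists>T l. 0 < T \<and> T < t \<and> ((\<lambda>s. X s \<omega>) \<longlongrightarrow> l) (at_left T) \<and> a l \<noteq> a (X T \<omega>)")
        case True
        then obtain T l where T: "0 < T" "T < t" "((\<lambda>s. X s \<omega>) \<longlongrightarrow> l) (at_left T)" "a l \<noteq> a (X T \<omega>)"
          by blast
        show ?thesis
          using jump_in_window[OF cad lip L0 eq Z0 T] elim(3) unfolding increment_def[abs_def] by blast
      next
        case False
        have const: "a (X s \<omega>) = a (X 0 \<omega>)" if "0 \<le> s" "s < t" for s
          by (rule drift_constant[OF cad a a' eq _ osc that]) (use False in auto)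
        have "X 0 \<omega> = x" using eq[of 0] Z0 by simp
        then have "integral {0..t} (\<lambda>r. a (X r \<omega>)) = integral {0..t} (\<lambda>r. a x)"
          using const by (intro integral_spike[of "{t}"]) auto
        then have "X t \<omega> = x + t * a x + Z t \<omega>" using eq[of t] t by simp
        then show ?thesis using elim(2) by simp
      qed
    qed
    then have "AE y in distr M borel (X t). y \<notin> A" by (subst AE_distr_iff) auto
    then show "A \<in> null_sets (distr M borel (X t))"
      by (subst (asm) AE_iff_null_sets[symmetric]) auto
  qed
qed

end
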